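(* Let $\lambda\ge 1$ be an integer and let $G$ be a $\lambda$-connected graph of minimum degree $\delta$. Let $C$ be a longest cycle in $G$, and let $\overline{c}$ denote the length of a longest cycle in $G\setminus C$. If $\overline{c}\ge \min\{\lambda-1,\ \delta-\lambda+1\}$, then $|C|\ge \lambda(\delta-\lambda+2)$.
   Context: All graphs are finite, undirected, without loops or multiple edges. $|C|$ is the number of edges of $C$. $G\setminus C$ denotes the graph obtained from $G$ by deleting the vertices of $C$. The length of a cycle is its number of edges; by convention a single vertex is regarded as a cycle of length $1$ and a single edge as a cycle of length $2$. If $G\setminus C$ is empty, $\overline{c}=0$. *)

theory Defs
  imports "Graph_Theory.Graph_Theory"
begin

text \<open>
  Finite simple undirected graphs are rendered by the locale predicate
  \<^const>\<open>graph\<close>: finite, loop-free, symmetric digraphs without parallel arcs.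
  An undirected edge is a pair of opposite arcs, so the degree of a vertex is its out-degree.
\<close>

definition min_degree :: "('a, 'b) pre_digraph \<Rightarrow> nat" where
  "min_degree G = Min (out_degree G ` verts G)"

definition vertex_connected :: "nat \<Rightarrow> ('a, 'b) pre_digraph \<Rightarrow> bool" where
  "vertex_connected k G \<longleftrightarrow>
     k < card (verts G) \<and>
     (\<forall>X \<subseteq> verts G. card X < k \<longrightarrow> connected (G \<restriction> (verts G - X)))"

text \<open>
  A cycle is given by a base vertex \<open>u\<close> and the list \<open>p\<close> of the arcs it
  traverses. The empty list stands for the single vertex \<open>u\<close>, which counts as a cycle
  of length 1. A single edge counts as a cycle of length 2; it needs no separate case, since the
  closed walk along an arc and back along the opposite arc satisfies
  \<^const>\<open>pre_digraph.cycle\<close>. From length 3 on,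
  \<^const>\<open>pre_digraph.cycle\<close> describes the ordinary cycles of an undirected graph,
  and the length of \<open>p\<close> is the number of edges.
\<close>

definition graph_cycle :: "('a, 'b) pre_digraph \<Rightarrow> 'a \<Rightarrow> 'b awalk \<Rightarrow> bool" where
  "graph_cycle G u p \<longleftrightarrow>
     pre_digraph.awalk G u p u \<and> (p = [] \<or> pre_digraph.cycle G p)"

definition cycle_length :: "'b awalk \<Rightarrow> nat" where
  "cycle_length p = (if p = [] then 1 else length p)"

definition longest_cycle :: "('a, 'b) pre_digraph \<Rightarrow> 'a \<Rightarrow> 'b awalk \<Rightarrow> bool" where
  "longest_cycle G u p \<longleftrightarrow>
     graph_cycle G u p \<and>
     (\<forall>v q. graph_cycle G v q \<longrightarrow> cycle_length q \<le> cycle_length p)"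

definition circumference :: "('a, 'b) pre_digraph \<Rightarrow> nat" where
  "circumference G =
     (if verts G = {} then 0 else Max {cycle_length p | u p. graph_cycle G u p})"

definition delete_cycle ::
  "('a, 'b) pre_digraph \<Rightarrow> 'a \<Rightarrow> 'b awalk \<Rightarrow> ('a, 'b) pre_digraph" where
  "delete_cycle G u p = G \<restriction> (verts G - set (pre_digraph.awalk_verts G u p))"

end

theory Submission
  imports Defs
begin

text \<open>
  Let \<open>H\<close> be a longest cycle outside the longest cycle \<open>C\<close>, with \<open>h\<close> vertices, and hang
  disjoint paths (tails) on its vertices, chosen to be long in total and then to have tips with few
  neighbours outside \<open>C\<close>. If the tips of two tails are joined outside \<open>C\<close> by a path with
  \<open>m\<close> vertices, then any two distinct neighbours of these tips on \<open>C\<close> are at distance at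
  least \<open>m + 1\<close> on \<open>C\<close>; a weighted count of such neighbours bounds \<open>length C\<close> from
  below. If \<open>h = k - 1\<close>, the tips have few neighbours outside \<open>C\<close> on average, hence many on
  \<open>C\<close>, and counting all of these suffices. If \<open>h \<ge> k\<close>, Menger's theorem provides
  \<open>k\<close> disjoint paths from \<open>H\<close> to \<open>C\<close>. Either at least \<open>k\<close> vertices outside
  \<open>C\<close> are pairwise joined by paths with \<open>\<delta> - k + 1\<close> vertices, and \<open>k\<close> disjoint paths
  from them to \<open>C\<close> give the bound at once; or \<open>k\<close> of the tips have distinct
  representatives among their neighbours on \<open>C\<close>, and what the paths between these tips lack in
  length is made up for by the remaining neighbours.
\<close>

section \<open>Paths, cycles and weights\<close>

text \<open>A vertex of \<open>H\<close> may have many neighbours outside both \<open>C\<close> and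
  \<open>H\<close>, hence few on \<open>C\<close>. Tails repair this: in a maximal system the outer
  neighbours of a tip lie on \<open>H\<close> and the tails only. Since \<open>H\<close> is longest,
  a tip attached to a slot other than its own has at most \<open>h / 2\<close> outer neighbours; a
  tip with more has them all in its own slot. Then the tail can be reversed from any such neighbour
  on, the minimal choice of tip degrees keeps the degrees of the new ends large, and one slot yields
  many ends.

  For \<open>h \<ge> k\<close> the obstacle is that \<open>H\<close> by itself joins two tips by
  about \<open>h / 2\<close> vertices only, while the bound asks for
  \<open>\<delta> - k + 1\<close>. A rotation makes the paths from slot \<open>x\<close> as long as
  the outer degree of the next slot, up to a correction for tails; and if that degree falls short of
  \<open>\<delta> - k\<close>, the next slot has at least as many neighbours on \<open>C\<close>
  beyond \<open>k\<close>, each adding one to the bound on \<open>length C\<close>.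

  The factors 2 stem from averaging: a gap on a cycle is compared with the mean of two weights, and
  a gap is often estimated by two different paths at once.\<close>

definition gpath :: "('v \<Rightarrow> 'v \<Rightarrow> bool) \<Rightarrow> 'v set \<Rightarrow> 'v list \<Rightarrow> bool" where
  "gpath E W p \<longleftrightarrow> p \<noteq> [] \<and> distinct p \<and> set p \<subseteq> W \<and> successively E p"

text \<open>An edge is a cycle of length 2 without a clause of its own: for symmetric
  \<open>E\<close> it is its own closing edge. Only the single vertex has to be exempted from
  closing.\<close>

definition gcycle :: "('v \<Rightarrow> 'v \<Rightarrow> bool) \<Rightarrow> 'v set \<Rightarrow> 'v list \<Rightarrow> bool" where
  "gcycle E W p \<longleftrightarrow> gpath E W p \<and> (length p = 1 \<or> E (last p) (hd p))"

definition longest :: "('v \<Rightarrow> 'v \<Rightarrow> bool) \<Rightarrow> 'v set \<Rightarrow> 'v list \<Rightarrow> bool" where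
  "longest E W C \<longleftrightarrow> gcycle E W C \<and> (\<forall>D. gcycle E W D \<longrightarrow> length D \<le> length C)"

lemma gpath_append:
  assumes "p \<noteq> []" "q \<noteq> []"
  shows "gpath E W (p @ q) \<longleftrightarrow>
    gpath E W p \<and> gpath E W q \<and> set p \<inter> set q = {} \<and> E (last p) (hd q)"
  using assms by (auto simp: gpath_def successively_append_iff)

lemma gpath_single [simp]: "gpath E W [x] \<longleftrightarrow> x \<in> W"
  by (auto simp: gpath_def)

lemma gpath_Cons:
  assumes "q \<noteq> []"
  shows "gpath E W (x # q) \<longleftrightarrow> x \<in> W \<and> gpath E W q \<and> x \<notin> set q \<and> E x (hd q)"
  using gpath_append[of "[x]" q E W] assms by auto

lemma gpath_rev:
  assumes "symp E"
  shows "gpath E W (rev p) \<longleftrightarrow> gpath E W p"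
proof -
  have "(\<lambda>x y. E y x) = E" using assms by (auto simp: symp_def intro!: ext)
  from arg_cong[OF this, of "\<lambda>F. successively F p"]
  have "successively (\<lambda>x y. E y x) p = successively E p" .
  then show ?thesis unfolding gpath_def successively_rev by simp
qed

lemma gpath_mono: "gpath E W p \<Longrightarrow> W \<subseteq> W' \<Longrightarrow> gpath E W' p"
  by (auto simp: gpath_def)

lemma gpath_nonempty: "gpath E W p \<Longrightarrow> p \<noteq> []"
  by (simp add: gpath_def)

lemma gpath_distinct: "gpath E W p \<Longrightarrow> distinct p"
  by (simp add: gpath_def)

lemma gpath_subset: "gpath E W p \<Longrightarrow> set p \<subseteq> W"
  by (simp add: gpath_def)

lemma gpath_takeI: "gpath E W p \<Longrightarrow> 0 < n \<Longrightarrow> gpath E W (take n p)"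
  unfolding gpath_def
  by (metis append_take_drop_id distinct_take gr0_conv_Suc order_trans set_take_subset
      successively_append_iff take_eq_Nil less_irrefl)

lemma gpath_dropI: "gpath E W p \<Longrightarrow> n < length p \<Longrightarrow> gpath E W (drop n p)"
  unfolding gpath_def
  by (metis append_take_drop_id distinct_drop drop_eq_Nil leD order_trans set_drop_subset
      successively_append_iff)

lemma gpath_nth: "gpath E W p \<Longrightarrow> Suc i < length p \<Longrightarrow> E (p ! i) (p ! Suc i)"
  by (simp add: gpath_def successively_nth)

lemma gpath_join:
  assumes "gpath E W p" "gpath E W q" "set p \<inter> set q = {}" "E (last p) (hd q)"
  shows "gpath E W (p @ q)"
  using assms gpath_append[of p q E W] gpath_nonempty by blast

lemma gpath_both_tails:
  assumes sym: "symp E" and q: "gpath E W q" "hd q = x" "last q = y"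
    and a: "gpath E W (x # as)" "set as \<inter> set q = {}"
    and b: "gpath E W (y # bs)" "set bs \<inter> set q = {}"
    and ab: "set as \<inter> set bs = {}"
  shows "gpath E W (rev as @ q @ bs)" "hd (rev as @ q @ bs) = last (x # as)"
    "last (rev as @ q @ bs) = last (y # bs)"
proof -
  have qne: "q \<noteq> []" using q(1) by (rule gpath_nonempty)
  have 1: "gpath E W (q @ bs)"
  proof (cases "bs = []")
    case False
    then have "gpath E W bs" "E y (hd bs)" using b(1) by (simp_all add: gpath_Cons)
    then show ?thesis using q b(2) by (intro gpath_join) auto
  qed (simp add: q)
  show "gpath E W (rev as @ q @ bs)"
  proof (cases "as = []")
    case False
    then have t: "gpath E W as" "E x (hd as)" using a(1) by (simp_all add: gpath_Cons)
    then have r: "gpath E W (rev as)" using gpath_rev[OF sym] by blast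
    show ?thesis
    proof (rule gpath_join[OF r 1])
      show "set (rev as) \<inter> set (q @ bs) = {}" using a(2) ab by auto
      show "E (last (rev as)) (hd (q @ bs))"
        using q(2) qne t False sym by (simp add: last_rev symp_def)
    qed
  qed (simp add: 1)
  show "hd (rev as @ q @ bs) = last (x # as)" using qne q(2) by (auto simp: hd_append hd_rev)
  show "last (rev as @ q @ bs) = last (y # bs)" using qne q(3) by auto
qed

lemma set_take_drop_disjoint:
  assumes "distinct xs" "m \<le> n"
  shows "set (take m xs) \<inter> set (drop n xs) = {}"
  using assms by (meson set_take_disj_set_drop_if_distinct)

text \<open>The path \<open>Q\<close> replaces either of the two arcs of \<open>C\<close> between its attachments.\<close>

lemma longest_gap:
  assumes sym: "symp E" and C: "longest E W C" and Q: "gpath E W Q"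
    and disj: "set Q \<inter> set C = {}" and ij: "i < j" "j < length C"
    and a: "E (C ! i) (hd Q)" and b: "E (last Q) (C ! j)"
  shows "length Q + 1 \<le> j - i" "length Q + 1 \<le> length C - (j - i)"
proof -
  have Cp: "gpath E W C" and lst: "E (last C) (hd C)"
    and mx: "\<And>D. gcycle E W D \<Longrightarrow> length D \<le> length C"
    using C ij by (auto simp: longest_def gcycle_def)
  have Qne: "Q \<noteq> []" using Q gpath_nonempty by blast
  have Cne: "C \<noteq> []" using ij by auto
  have dC: "distinct C" using Cp gpath_distinct by blast
  let ?A = "drop j C" and ?B = "take (Suc i) C"
  have A: "gpath E W ?A" using Cp ij by (simp add: gpath_dropI)
  have B: "gpath E W ?B" using Cp by (simp add: gpath_takeI)
  have lA: "last ?A = last C" "hd ?A = C ! j" using ij by (auto simp: hd_drop_conv_nth)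
  have lB: "hd ?B = hd C" "last ?B = C ! i" using ij Cne
    by (simp_all add: take_Suc_conv_app_nth[of i C] hd_append hd_conv_nth)
  have AB: "gpath E W (?A @ ?B)"
    using gpath_join[OF A B] lA lB lst set_take_drop_disjoint[OF dC, of "Suc i" j] ij by auto
  have ABQ: "gpath E W ((?A @ ?B) @ Q)"
  proof (rule gpath_join[OF AB Q])
    show "set (?A @ ?B) \<inter> set Q = {}"
      using disj set_drop_subset[of j C] set_take_subset[of "Suc i" C] by auto
    show "E (last (?A @ ?B)) (hd Q)" using lB a Cne by simp
  qed
  \<comment> \<open>\<open>Q\<close> is exchanged for the \<open>j - i - 1\<close> vertices strictly
    between the two positions; this is the origin of the summand 1.\<close>
  have "gcycle E W ((?A @ ?B) @ Q)"
    unfolding gcycle_def using ABQ Qne lA b ij by auto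
  from mx[OF this] show "length Q + 1 \<le> j - i" using ij by simp
  let ?M = "drop i (take (Suc j) C)"
  have M: "gpath E W ?M" using Cp ij by (intro gpath_dropI gpath_takeI) auto
  have Mne: "?M \<noteq> []" using ij by auto
  have hM: "hd ?M = C ! i" using ij by (simp add: hd_drop_conv_nth)
  have lM: "last ?M = C ! j" using ij by (simp add: take_Suc_conv_app_nth)
  have "gpath E W (?M @ rev Q)"
  proof (rule gpath_join[OF M])
    show "gpath E W (rev Q)" using Q sym gpath_rev by blast
    show "set ?M \<inter> set (rev Q) = {}"
      using disj set_drop_subset[of i "take (Suc j) C"] set_take_subset[of "Suc j" C] by auto
    show "E (last ?M) (hd (rev Q))" using lM b sym Qne by (simp add: hd_rev symp_def)
  qed
  then have "gcycle E W (?M @ rev Q)"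
    unfolding gcycle_def using Qne Mne hM a sym by (auto simp: last_rev symp_def)
  from mx[OF this] show "length Q + 1 \<le> length C - (j - i)" using ij by simp
qed

text \<open>Elements of one class act as a single weighted point; every further element of
  the class costs at least one more unit of length.\<close>

lemma linear_weights:
  fixes w :: "'c \<Rightarrow> int" and A :: "nat set"
  assumes "finite A" "A \<noteq> {}"
    and "\<And>p q. p \<in> A \<Longrightarrow> q \<in> A \<Longrightarrow> p < q \<Longrightarrow> f p \<noteq> f q \<Longrightarrow> w (f p) + w (f q) \<le> 2 * (int q - int p)"
    and "\<And>p. p \<in> A \<Longrightarrow> 1 \<le> w (f p)"
  shows "2 * (sum w (f ` A) + int (card A) - int (card (f ` A)))
      + (if f (Min A) = f (Max A) \<and> card (f ` A) \<ge> 2 then 2 * w (f (Max A)) - 2 else 0)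
      \<le> 2 * (int (Max A) - int (Min A)) + w (f (Min A)) + w (f (Max A))"
  using assms
proof (induction A rule: finite_linorder_max_induct)
  case empty
  then show ?case by simp
next
  case (insert M A)
  show ?case
  proof (cases "A = {}")
    case True
    then show ?thesis by simp
  next
    case False
    let ?M0 = "Max A" and ?m = "Min A"
    have M0: "?M0 \<in> A" "?m \<in> A" using False insert by auto
    have MnA: "M \<notin> A" using insert by auto
    have mx: "Max (insert M A) = M" "Min (insert M A) = ?m"
      using insert.hyps False M0 by (auto intro!: Max_eqI Min_eqI dest: less_imp_le Min_le order_trans[OF Min_le])
    have lt: "?M0 < M" "?m < M" using insert M0 by auto
    have cA: "card (insert M A) = Suc (card A)" using MnA insert by simp
    have IH: "2 * (sum w (f ` A) + int (card A) - int (card (f ` A)))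
      + (if f ?m = f ?M0 \<and> card (f ` A) \<ge> 2 then 2 * w (f ?M0) - 2 else 0)
      \<le> 2 * (int ?M0 - int ?m) + w (f ?m) + w (f ?M0)"
      using insert False by auto
    have w1: "1 \<le> w (f M)" "1 \<le> w (f ?M0)" using insert.prems M0 by auto
    \<comment> \<open>Staying in a class costs 1, changing the class costs the mean of two weights.
      A return to an old class adds nothing to \<open>sum w\<close>, so its cost is surplus; if it
      is the class of the minimum, the surplus is recorded in the conditional summand.\<close>
    consider (same) "f M = f ?M0" | (new) "f M \<noteq> f ?M0" "f M \<notin> f ` A"
      | (old) "f M \<noteq> f ?M0" "f M \<in> f ` A" by blast
    then show ?thesis
    proof cases
      case same
      then have "f ` insert M A = f ` A" using M0 by auto
      then have "2 * (sum w (f ` insert M A) + int (card (insert M A)) - int (card (f ` insert M A)))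
          = 2 * (sum w (f ` A) + int (card A) - int (card (f ` A))) + 2"
        by (simp add: cA)
      moreover have "2 * (int ?M0 - int ?m) + 2 \<le> 2 * (int M - int ?m)" using lt by simp
      ultimately show ?thesis using IH same \<open>f ` insert M A = f ` A\<close> unfolding mx
        by (auto split: if_splits)
    next
      case new
      have g: "w (f ?M0) + w (f M) \<le> 2 * (int M - int ?M0)"
        using insert.prems(2)[of ?M0 M] M0 lt new by auto
      have c: "card (f ` insert M A) = Suc (card (f ` A))" "sum w (f ` insert M A) = w (f M) + sum w (f ` A)"
        using new insert by auto
      have "f ?m \<noteq> f M" using new M0 by (metis imageI)
      then show ?thesis using IH g w1 unfolding mx c cA by (auto split: if_splits)
    next
      case old
      have g: "w (f ?M0) + w (f M) \<le> 2 * (int M - int ?M0)"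
        using insert.prems(2)[of ?M0 M] M0 lt old by auto
      have c: "f ` insert M A = f ` A" using old by auto
      show ?thesis using IH g w1 unfolding mx c cA by (auto split: if_splits)
    qed
  qed
qed

text \<open>The step from the last position around to the first has to be paid as well. Between
  different classes the second gap condition covers it. Within one class only its length 1 is at
  hand, and the conditional summand of \<open>linear_weights\<close> makes this sufficient.\<close>

lemma cyclic_weights:
  fixes w :: "'c \<Rightarrow> int" and A :: "nat set"
  assumes "A \<subseteq> {..<n}"
    and gap: "\<And>p q. p \<in> A \<Longrightarrow> q \<in> A \<Longrightarrow> p < q \<Longrightarrow> f p \<noteq> f q \<Longrightarrow>
        w (f p) + w (f q) \<le> 2 * (int q - int p) \<and> w (f p) + w (f q) \<le> 2 * (int n - (int q - int p))"
    and pos: "\<And>p. p \<in> A \<Longrightarrow> 1 \<le> w (f p)"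
    and two: "2 \<le> card (f ` A)"
  shows "sum w (f ` A) + int (card A) - int (card (f ` A)) \<le> int n"
proof -
  have fin: "finite A" using assms(1) finite_subset by blast
  have ne: "A \<noteq> {}" using two by auto
  let ?m = "Min A" and ?M = "Max A"
  have mM: "?m \<in> A" "?M \<in> A" "?m \<le> ?M" using fin ne by auto
  have Mn: "?M < n" using mM assms(1) by auto
  note lw = linear_weights[OF fin ne, of f w]
  show ?thesis
  proof (cases "f ?m = f ?M")
    case True
    then show ?thesis using lw gap pos two Mn by (simp add: mM)
  next
    case False
    then have "?m < ?M" using mM by (metis le_neq_implies_less)
    have "2 * (sum w (f ` A) + int (card A) - int (card (f ` A)))
      \<le> 2 * (int ?M - int ?m) + w (f ?m) + w (f ?M)"
      using lw gap pos False by simp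
    moreover have "w (f ?m) + w (f ?M) \<le> 2 * (int n - (int ?M - int ?m))"
      using gap[of ?m ?M] \<open>?m < ?M\<close> False mM by simp
    ultimately show ?thesis by (smt (verit))
  qed
qed

section \<open>Menger's theorem\<close>

text \<open>The splice at \<open>z\<close> need not be a path, but \<open>separates\<close> speaks
  of walks. Apart from \<open>z\<close> it uses only \<open>p\<close> before its end and
  \<open>q\<close> after its start; in \<open>menger_arcs\<close> these parts avoid the separator,
  so \<open>z\<close> must belong to it.\<close>

lemma gpath_between_split:
  assumes "gpath E W p" "gpath E W q" "z \<in> set p" "z \<in> set q"
  obtains w where "w \<noteq> []" "successively E w" "hd w = hd p" "last w = last q"
    "set w \<subseteq> (set p - {last p}) \<union> {z} \<union> (set q - {hd q})"
proof -
  obtain a1 a2 where a: "p = a1 @ z # a2" using assms(3) by (meson split_list)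
  obtain b1 b2 where b: "q = b1 @ z # b2" using assms(4) by (meson split_list)
  have "successively E (a1 @ z # b2)"
    using assms(1,2) unfolding a b gpath_def by (auto simp: successively_append_iff successively_Cons)
  moreover have "hd (a1 @ z # b2) = hd p" by (simp add: a hd_append)
  moreover have "last (a1 @ z # b2) = last q" by (simp add: b)
  moreover have "set (a1 @ z # b2) \<subseteq> (set p - {last p}) \<union> {z} \<union> (set q - {hd q})"
    using assms(1,2) unfolding a b gpath_def by (cases b1) auto
  ultimately show thesis using that[of "a1 @ z # b2"] by simp
qed

lemma gpath_first_hit:
  assumes "gpath E W p" "set p \<inter> P \<noteq> {}"
  obtains p' where "gpath E W p'" "hd p' = hd p" "last p' \<in> P" "set (butlast p') \<inter> P = {}"
    "set p' \<subseteq> set p"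
proof -
  obtain p1 z p2 where s: "p = p1 @ z # p2" "z \<in> P" "\<forall>v\<in>set p1. v \<notin> P"
    using split_list_first_prop[of p "\<lambda>v. v \<in> P"] assms(2) by blast
  have "gpath E W (take (Suc (length p1)) p)" using assms(1) by (intro gpath_takeI) auto
  then have "gpath E W (p1 @ [z])" using s by simp
  then show thesis using that[of "p1 @ [z]"] s by (cases p1) auto
qed

lemma gpath_last_hit:
  assumes "gpath E W p" "set p \<inter> P \<noteq> {}"
  obtains p' where "gpath E W p'" "last p' = last p" "hd p' \<in> P" "set (tl p') \<inter> P = {}"
    "set p' \<subseteq> set p"
proof -
  obtain p1 z p2 where s: "p = p1 @ z # p2" "z \<in> P" "\<forall>v\<in>set p2. v \<notin> P"
    using split_list_last_prop[of p "\<lambda>v. v \<in> P"] assms(2) by blast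
  have "gpath E W (drop (length p1) p)" using assms(1) s by (intro gpath_dropI) auto
  then have "gpath E W (z # p2)" using s by simp
  then show thesis using that[of "z # p2"] s by auto
qed

text \<open>Walks instead of paths save the shortcuts after a splice; every walk contains a path
  with the same ends, so the separators are the same. Vertices of \<open>A\<close> and
  \<open>B\<close> may be used.\<close>

definition separates :: "('v \<times> 'v) set \<Rightarrow> 'v set \<Rightarrow> 'v set \<Rightarrow> 'v set \<Rightarrow> bool" where
  "separates F A B S \<longleftrightarrow>
     (\<forall>w. w \<noteq> [] \<longrightarrow> successively (\<lambda>x y. (x, y) \<in> F) w \<longrightarrow> hd w \<in> A \<longrightarrow> last w \<in> B \<longrightarrow> set w \<inter> S \<noteq> {})"

text \<open>
  Directed Menger, by induction on the arcs: if deleting the arc \<open>(x, y)\<close> leaves a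
  separator \<open>S\<close> with fewer than \<open>k\<close> vertices, then \<open>S \<union> {x}\<close> and
  \<open>S \<union> {y}\<close> have exactly \<open>k\<close> vertices, and path systems from \<open>A\<close> to the
  former and from the latter to \<open>B\<close> meet only in \<open>S\<close>.
\<close>

lemma menger_arcs:
  assumes "finite F" "finite A" "finite B"
    and "\<And>S. finite S \<Longrightarrow> separates F A B S \<Longrightarrow> k \<le> card S"
  shows "\<exists>P. finite P \<and> card P = k \<and>
    (\<forall>p\<in>P. gpath (\<lambda>x y. (x, y) \<in> F) UNIV p \<and> hd p \<in> A \<and> last p \<in> B) \<and>
    (\<forall>p\<in>P. \<forall>q\<in>P. p \<noteq> q \<longrightarrow> set p \<inter> set q = {})"
  using assms
proof (induction F arbitrary: A B rule: finite_induct)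
  case empty
  have "separates {} A B (A \<inter> B)"
    unfolding separates_def
  proof (intro allI impI)
    fix w :: "'a list"
    assume "w \<noteq> []" "successively (\<lambda>x y. (x, y) \<in> {}) w" "hd w \<in> A" "last w \<in> B"
    then show "set w \<inter> (A \<inter> B) \<noteq> {}" by (cases w) (auto simp: successively_Cons split: if_splits)
  qed
  then have "k \<le> card (A \<inter> B)" using empty by blast
  then obtain D where D: "D \<subseteq> A \<inter> B" "card D = k" "finite D"
    by (meson obtain_subset_with_card_n)
  show ?case
    by (rule exI[of _ "(\<lambda>v. [v]) ` D"]) (use D in \<open>auto simp: card_image inj_on_def\<close>)
next
  case (insert e F)
  obtain x y where e: "e = (x, y)" by force
  let ?E = "\<lambda>x y. (x, y) \<in> F" and ?E' = "\<lambda>x y. (x, y) \<in> insert e F"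
  show ?case
  proof (cases "\<forall>S. finite S \<longrightarrow> separates F A B S \<longrightarrow> k \<le> card S")
    case True
    then obtain P where P: "finite P" "card P = k"
      "\<forall>p\<in>P. gpath ?E UNIV p \<and> hd p \<in> A \<and> last p \<in> B"
      "\<forall>p\<in>P. \<forall>q\<in>P. p \<noteq> q \<longrightarrow> set p \<inter> set q = {}"
      using insert.IH[of A B] insert.prems by blast
    moreover have "gpath ?E' UNIV p" if "gpath ?E UNIV p" for p
      using that by (auto simp: gpath_def elim: successively_mono)
    ultimately show ?thesis by blast
  next
    case False
    then obtain S where S: "finite S" "separates F A B S" "card S < k" by force
    let ?P = "insert x S" and ?Q = "insert y S"
    \<comment> \<open>The arc \<open>(x, y)\<close> can be used only by leaving \<open>x\<close> and
      entering \<open>y\<close>; \<open>inF'\<close> is the counterpart for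
      \<open>y\<close>.\<close>
    have inF: "successively ?E w" if "successively ?E' w" "x \<notin> set (butlast w)" for w
      using that by (induction w rule: induct_list012) (auto simp: e)
    have inF': "successively ?E w" if "successively ?E' w" "y \<notin> set (tl w)" for w
      using that by (induction w rule: induct_list012) (auto simp: e)
    have hitP: "set w \<inter> ?P \<noteq> {}"
      if "w \<noteq> []" "successively ?E' w" "hd w \<in> A" "last w \<in> B" for w
    proof (cases "x \<in> set w")
      case False
      then have "successively ?E w" using inF that by (meson in_set_butlastD)
      then show ?thesis using S(2) that unfolding separates_def by blast
    qed auto
    have hitQ: "set w \<inter> ?Q \<noteq> {}"
      if "w \<noteq> []" "successively ?E' w" "hd w \<in> A" "last w \<in> B" for w
    proof (cases "y \<in> set w")
      case False
      then have "successively ?E w" using inF' that by (meson list.set_sel(2) that(1))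
      then show ?thesis using S(2) that unfolding separates_def by blast
    qed auto
    have "separates (insert e F) A B ?P" "separates (insert e F) A B ?Q"
      using hitP hitQ unfolding separates_def by blast+
    then have "k \<le> card ?P" "k \<le> card ?Q" using insert.prems S(1) by (meson finite_insert)+
    then have xS: "x \<notin> S" "y \<notin> S" and cP: "card ?P = k" "card ?Q = k"
      using S by (auto simp: card_insert_if split: if_splits)
    \<comment> \<open>Up to its first vertex in \<open>?P\<close> a walk cannot use the new arc. A
      separator of \<open>A\<close> from \<open>?P\<close> without the arc therefore separates
      \<open>A\<close> from \<open>B\<close> with it, and the induction hypothesis applies to
      \<open>A\<close> and \<open>?P\<close>.\<close>
    have sepA: "k \<le> card T" if T: "finite T" "separates F A ?P T" for T
    proof -
      have "separates (insert e F) A B T"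
        unfolding separates_def
      proof (intro allI impI)
        fix w assume w: "w \<noteq> []" "successively ?E' w" "hd w \<in> A" "last w \<in> B"
        obtain w1 z w2 where s: "w = w1 @ z # w2" "z \<in> ?P" "\<forall>v\<in>set w1. v \<notin> ?P"
          using split_list_first_prop[of w "\<lambda>v. v \<in> ?P"] hitP[OF w] by blast
        have "successively ?E' (w1 @ [z])" using w s by (auto simp: successively_append_iff)
        then have "successively ?E (w1 @ [z])" using inF s by auto
        moreover have "hd (w1 @ [z]) \<in> A" using w(3) s(1) by (cases w1) auto
        moreover have "last (w1 @ [z]) \<in> ?P" "w1 @ [z] \<noteq> []" using s(2) by auto
        ultimately have "set (w1 @ [z]) \<inter> T \<noteq> {}" using T(2) unfolding separates_def by blast
        then show "set w \<inter> T \<noteq> {}" using s by auto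
      qed
      then show ?thesis using insert.prems T by blast
    qed
    have sepB: "k \<le> card T" if T: "finite T" "separates F ?Q B T" for T
    proof -
      have "separates (insert e F) A B T"
        unfolding separates_def
      proof (intro allI impI)
        fix w assume w: "w \<noteq> []" "successively ?E' w" "hd w \<in> A" "last w \<in> B"
        obtain w1 z w2 where s: "w = w1 @ z # w2" "z \<in> ?Q" "\<forall>v\<in>set w2. v \<notin> ?Q"
          using split_list_last_prop[of w "\<lambda>v. v \<in> ?Q"] hitQ[OF w] by blast
        have "successively ?E' (z # w2)" using w s by (auto simp: successively_append_iff)
        then have "successively ?E (z # w2)" using inF' s by auto
        moreover have "last (z # w2) \<in> B" using w(4) s(1) by simp
        moreover have "hd (z # w2) \<in> ?Q" "z # w2 \<noteq> []" using s(2) by auto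
        ultimately have "set (z # w2) \<inter> T \<noteq> {}" using T(2) unfolding separates_def by blast
        then show "set w \<inter> T \<noteq> {}" using s by auto
      qed
      then show ?thesis using insert.prems T by blast
    qed
    obtain PA where PA: "finite PA" "card PA = k"
      "\<forall>p\<in>PA. gpath ?E UNIV p \<and> hd p \<in> A \<and> last p \<in> ?P"
      "\<forall>p\<in>PA. \<forall>q\<in>PA. p \<noteq> q \<longrightarrow> set p \<inter> set q = {}"
      using insert.IH[of A ?P] sepA insert.prems(1) S(1) by blast
    obtain PB where PB: "finite PB" "card PB = k"
      "\<forall>p\<in>PB. gpath ?E UNIV p \<and> hd p \<in> ?Q \<and> last p \<in> B"
      "\<forall>p\<in>PB. \<forall>q\<in>PB. p \<noteq> q \<longrightarrow> set p \<inter> set q = {}"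
      using insert.IH[of ?Q B] sepB insert.prems(2) S(1) by blast
    have "\<exists>p'. gpath ?E UNIV p' \<and> hd p' \<in> A \<and> last p' \<in> ?P \<and> set (butlast p') \<inter> ?P = {} \<and> set p' \<subseteq> set p"
      if "p \<in> PA" for p
      using that PA(3) gpath_first_hit[of ?E UNIV p ?P] by (metis IntI empty_iff gpath_nonempty last_in_set)
    then obtain f where f: "\<And>p. p \<in> PA \<Longrightarrow> gpath ?E UNIV (f p) \<and> hd (f p) \<in> A \<and> last (f p) \<in> ?P
        \<and> set (butlast (f p)) \<inter> ?P = {} \<and> set (f p) \<subseteq> set p"
      by metis
    have "\<exists>p'. gpath ?E UNIV p' \<and> last p' \<in> B \<and> hd p' \<in> ?Q \<and> set (tl p') \<inter> ?Q = {} \<and> set p' \<subseteq> set p"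
      if "p \<in> PB" for p
      using that PB(3) gpath_last_hit[of ?E UNIV p ?Q] by (metis IntI empty_iff gpath_nonempty hd_in_set)
    then obtain g where g: "\<And>p. p \<in> PB \<Longrightarrow> gpath ?E UNIV (g p) \<and> last (g p) \<in> B \<and> hd (g p) \<in> ?Q
        \<and> set (tl (g p)) \<inter> ?Q = {} \<and> set (g p) \<subseteq> set p"
      by metis
    have injA: "inj_on (\<lambda>p. last (f p)) PA"
    proof (rule inj_onI)
      fix p q assume pq: "p \<in> PA" "q \<in> PA" "last (f p) = last (f q)"
      have "last (f p) \<in> set p" "last (f q) \<in> set q"
        using pq f gpath_nonempty by (metis last_in_set subsetD)+
      then show "p = q" using PA(4) pq by auto
    qed
    have surA: "(\<lambda>p. last (f p)) ` PA = ?P"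
      using f injA PA cP S(1) by (intro card_subset_eq) (auto simp: card_image)
    have injB: "inj_on (\<lambda>p. hd (g p)) PB"
    proof (rule inj_onI)
      fix p q assume pq: "p \<in> PB" "q \<in> PB" "hd (g p) = hd (g q)"
      have "hd (g p) \<in> set p" "hd (g q) \<in> set q"
        using pq g gpath_nonempty by (metis hd_in_set subsetD)+
      then show "p = q" using PB(4) pq by auto
    qed
    have surB: "(\<lambda>p. hd (g p)) ` PB = ?Q"
      using g injB PB cP S(1) by (intro card_subset_eq) (auto simp: card_image)
    have "\<forall>s\<in>?P. \<exists>p\<in>PA. last (f p) = s" using surA by (metis imageE)
    then obtain a where a: "\<And>s. s \<in> ?P \<Longrightarrow> a s \<in> PA \<and> last (f (a s)) = s" by metis
    have "\<forall>s\<in>?Q. \<exists>p\<in>PB. hd (g p) = s" using surB by (metis imageE)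
    then obtain b where b: "\<And>s. s \<in> ?Q \<Longrightarrow> b s \<in> PB \<and> hd (g (b s)) = s" by metis
    define \<alpha> where "\<alpha> s = f (a s)" for s
    define \<beta> where "\<beta> s = g (b s)" for s
    have al: "gpath ?E UNIV (\<alpha> s)" "hd (\<alpha> s) \<in> A" "last (\<alpha> s) = s" "set (butlast (\<alpha> s)) \<inter> ?P = {}"
      if "s \<in> ?P" for s
      using a[OF that] f unfolding \<alpha>_def by auto
    have be: "gpath ?E UNIV (\<beta> s)" "last (\<beta> s) \<in> B" "hd (\<beta> s) = s" "set (tl (\<beta> s)) \<inter> ?Q = {}"
      if "s \<in> ?Q" for s
      using b[OF that] g unfolding \<beta>_def by auto
    have aldis: "set (\<alpha> s) \<inter> set (\<alpha> t) = {}" if "s \<in> ?P" "t \<in> ?P" "s \<noteq> t" for s t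
    proof -
      have "a s \<noteq> a t" using a that by metis
      then have "set (a s) \<inter> set (a t) = {}" using PA(4) a that by blast
      then show ?thesis using a f that unfolding \<alpha>_def by blast
    qed
    have bedis: "set (\<beta> s) \<inter> set (\<beta> t) = {}" if "s \<in> ?Q" "t \<in> ?Q" "s \<noteq> t" for s t
    proof -
      have "b s \<noteq> b t" using b that by metis
      then have "set (b s) \<inter> set (b t) = {}" using PB(4) b that by blast
      then show ?thesis using b g that unfolding \<beta>_def by blast
    qed
    \<comment> \<open>Otherwise the splice at \<open>z\<close> would be a walk from \<open>A\<close>
      to \<open>B\<close> in \<open>F\<close> that misses \<open>S\<close>. Inside \<open>S\<close>,
      a vertex is met only as the end of the one path and the start of the other.\<close>
    have meet: "z \<in> S \<and> z = s \<and> z = t" if st: "s \<in> ?P" "t \<in> ?Q" "z \<in> set (\<alpha> s)" "z \<in> set (\<beta> t)" for s t z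
    proof -
      have bl: "set (\<alpha> s) - {last (\<alpha> s)} \<subseteq> set (butlast (\<alpha> s))"
        using al(1)[OF st(1)] gpath_nonempty by (metis Diff_subset_conv append_butlast_last_id Un_commute equalityE set_append list.simps(15) empty_set)
      have ht: "set (\<beta> t) - {hd (\<beta> t)} \<subseteq> set (tl (\<beta> t))"
        using be(1)[OF st(2)] gpath_nonempty by (metis Diff_subset_conv insert_is_Un list.exhaust_sel list.simps(15) order_refl)
      obtain w where w: "w \<noteq> []" "successively ?E w" "hd w = hd (\<alpha> s)" "last w = last (\<beta> t)"
        "set w \<subseteq> (set (\<alpha> s) - {last (\<alpha> s)}) \<union> {z} \<union> (set (\<beta> t) - {hd (\<beta> t)})"
        using gpath_between_split[OF al(1)[OF st(1)] be(1)[OF st(2)] st(3,4)] by blast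
      have "set w \<inter> S \<noteq> {}"
        using S(2) w al(2)[OF st(1)] be(2)[OF st(2)] unfolding separates_def by metis
      then obtain v where v: "v \<in> set w" "v \<in> S" by blast
      have "v = z" using v w(5) bl ht al(4)[OF st(1)] be(4)[OF st(2)] by blast
      then have zS: "z \<in> S" using v by simp
      have "z = s" using zS bl al(3,4)[OF st(1)] st(3) by blast
      moreover have "z = t" using zS ht be(3,4)[OF st(2)] st(4) by blast
      ultimately show ?thesis using zS by simp
    qed
    \<comment> \<open>For \<open>s\<close> in \<open>S\<close> both paths contain \<open>s\<close>,
      hence \<open>tl\<close>; the path into \<open>x\<close> and the path out of \<open>y\<close>
      are linked by the new arc.\<close>
    define \<gamma> where "\<gamma> s = (if s = x then \<alpha> x @ \<beta> y else \<alpha> s @ tl (\<beta> s))" for s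
    define \<sigma> where "\<sigma> s = (if s = x then y else s)" for s
    have sQ: "\<sigma> s \<in> ?Q" if "s \<in> ?P" for s using that by (auto simp: \<sigma>_def)
    have gsub: "set (\<gamma> s) \<subseteq> set (\<alpha> s) \<union> set (\<beta> (\<sigma> s))" for s
      by (cases "\<beta> s") (auto simp: \<gamma>_def \<sigma>_def)
    have up: "gpath ?E' UNIV p" if "gpath ?E UNIV p" for p
      using that by (auto simp: gpath_def elim: successively_mono)
    have gp: "gpath ?E' UNIV (\<gamma> s) \<and> hd (\<gamma> s) \<in> A \<and> last (\<gamma> s) \<in> B" if s: "s \<in> ?P" for s
    proof (cases "s = x")
      case True
      have d: "set (\<alpha> x) \<inter> set (\<beta> y) = {}" using meet[of x y] xS by blast
      have "gpath ?E' UNIV (\<alpha> x @ \<beta> y)"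
        by (rule gpath_join) (use d up al(1)[of x] al(3)[of x] be(1)[of y] be(3)[of y] in \<open>auto simp: e\<close>)
      then show ?thesis using True al(1,2)[of x] be(1,2)[of y] unfolding \<gamma>_def
        by (auto simp: hd_append dest: gpath_nonempty)
    next
      case False
      then have sS: "s \<in> S" using s by simp
      have bne: "\<beta> s \<noteq> []" "\<alpha> s \<noteq> []" using be(1)[of s] al(1)[of s] sS gpath_nonempty by blast+
      have bs: "\<beta> s = s # tl (\<beta> s)" using be(3)[of s] sS bne by (metis insertI2 list.exhaust_sel)
      show ?thesis
      proof (cases "tl (\<beta> s) = []")
        case True
        then have "last (\<beta> s) = s" using bs by (metis last.simps)
        then show ?thesis using True False up al(1-3)[OF s] be(2)[of s] sS by (auto simp: \<gamma>_def)
      next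
        case tne: False
        have g1: "gpath ?E UNIV (s # tl (\<beta> s))" using be(1)[of s] sS bs by simp
        then have "gpath ?E UNIV (tl (\<beta> s))" "(s, hd (tl (\<beta> s))) \<in> F" "s \<notin> set (tl (\<beta> s))"
          using gpath_Cons[OF tne, of ?E UNIV s] by auto
        moreover have "set (\<alpha> s) \<inter> set (tl (\<beta> s)) = {}"
          using meet[OF s, of s] sS calculation(3) bs by (metis disjoint_iff insertI2 list.set_intros(2))
        ultimately have "gpath ?E UNIV (\<alpha> s @ tl (\<beta> s))"
          using al(1,3)[OF s] by (intro gpath_join) auto
        moreover have "last (\<alpha> s @ tl (\<beta> s)) = last (\<beta> s)" using tne bs by (metis last_ConsR last_appendR)
        ultimately show ?thesis using up False al(2)[OF s] be(2)[of s] sS bne by (auto simp: \<gamma>_def hd_append)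
      qed
    qed
    have gdis: "set (\<gamma> s) \<inter> set (\<gamma> t) = {}" if st: "s \<in> ?P" "t \<in> ?P" "s \<noteq> t" for s t
    proof -
      have "\<sigma> s \<noteq> \<sigma> t" using st xS by (auto simp: \<sigma>_def)
      then have b: "set (\<beta> (\<sigma> s)) \<inter> set (\<beta> (\<sigma> t)) = {}" using bedis sQ st by blast
      have c: "set (\<alpha> p) \<inter> set (\<beta> (\<sigma> q)) = {}" if "p \<in> ?P" "q \<in> ?P" "p \<noteq> q" for p q
      proof (rule ccontr)
        assume "set (\<alpha> p) \<inter> set (\<beta> (\<sigma> q)) \<noteq> {}"
        then obtain z where "z \<in> set (\<alpha> p)" "z \<in> set (\<beta> (\<sigma> q))" by blast
        then have "z \<in> S \<and> z = p \<and> z = \<sigma> q" using meet that sQ by blast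
        then show False using that xS by (auto simp: \<sigma>_def split: if_splits)
      qed
      show ?thesis using gsub[of s] gsub[of t] b c[OF st] c[OF st(2,1)] st aldis[OF st] by blast
    qed
    have "inj_on \<gamma> ?P"
    proof (rule inj_onI)
      fix s t assume st: "s \<in> ?P" "t \<in> ?P" "\<gamma> s = \<gamma> t"
      have "\<gamma> s \<noteq> []" using gp[OF st(1)] gpath_nonempty by blast
      then show "s = t" using gdis[OF st(1,2)] st(3) by auto
    qed
    then have "card (\<gamma> ` ?P) = k" using cP(1) card_image[of \<gamma> ?P] by simp
    then show ?thesis using gp gdis S(1) by (intro exI[of _ "\<gamma> ` ?P"]) auto
  qed
qed

text \<open>The separator condition appears in the form that connectivity delivers. Each path is cut
  at its last vertex in \<open>A\<close> and then at its first vertex in \<open>B\<close>, so that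
  it meets these sets only at its ends.\<close>

lemma menger:
  assumes fin: "finite V" and EV: "\<And>u v. E u v \<Longrightarrow> u \<in> V \<and> v \<in> V"
    and AB: "A \<subseteq> V" "B \<subseteq> V"
    and conn: "\<And>X. X \<subseteq> V \<Longrightarrow> card X < k \<Longrightarrow> \<exists>p. gpath E (V - X) p \<and> hd p \<in> A \<and> last p \<in> B"
  obtains P where "finite P" "card P = k"
    "\<And>p. p \<in> P \<Longrightarrow> gpath E V p \<and> hd p \<in> A \<and> last p \<in> B \<and> set (tl p) \<inter> A = {} \<and> set (butlast p) \<inter> B = {}"
    "\<And>p q. p \<in> P \<Longrightarrow> q \<in> P \<Longrightarrow> p \<noteq> q \<Longrightarrow> set p \<inter> set q = {}"
proof -
  let ?F = "{(u, v). E u v}"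
  have EF: "(\<lambda>x y. (x, y) \<in> ?F) = E" by auto
  have "?F \<subseteq> V \<times> V" using EV by auto
  then have "finite ?F" using fin finite_subset by blast
  moreover have "finite A" "finite B" using AB fin finite_subset by blast+
  moreover have "k \<le> card S" if "finite S" "separates ?F A B S" for S
  proof (rule ccontr)
    assume "\<not> k \<le> card S"
    moreover have "card (S \<inter> V) \<le> card S" using that by (simp add: card_mono)
    ultimately obtain p where p: "gpath E (V - S \<inter> V) p" "hd p \<in> A" "last p \<in> B"
      using conn[of "S \<inter> V"] by auto
    then have "set p \<inter> S \<noteq> {}" using that(2) unfolding separates_def EF by (simp add: gpath_def)
    then show False using gpath_subset[OF p(1)] by auto
  qed
  ultimately obtain P where P: "finite P" "card P = k"
    "\<forall>p\<in>P. gpath E UNIV p \<and> hd p \<in> A \<and> last p \<in> B"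
    "\<forall>p\<in>P. \<forall>q\<in>P. p \<noteq> q \<longrightarrow> set p \<inter> set q = {}"
    using menger_arcs[of ?F A B k] unfolding EF by blast
  have "\<exists>p'. gpath E V p' \<and> hd p' \<in> A \<and> last p' \<in> B \<and> set (tl p') \<inter> A = {} \<and> set (butlast p') \<inter> B = {} \<and> set p' \<subseteq> set p"
    if "p \<in> P" for p
  proof -
    have p: "gpath E UNIV p" "hd p \<in> A" "last p \<in> B" using P(3) that by auto
    have "set p \<inter> A \<noteq> {}" using p gpath_nonempty by (metis disjoint_iff hd_in_set)
    then obtain q where q: "gpath E UNIV q" "last q = last p" "hd q \<in> A" "set (tl q) \<inter> A = {}" "set q \<subseteq> set p"
      using gpath_last_hit[OF p(1)] by blast
    have "set q \<inter> B \<noteq> {}" using p q gpath_nonempty by (metis disjoint_iff last_in_set)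
    then obtain r where r: "gpath E UNIV r" "hd r = hd q" "last r \<in> B" "set (butlast r) \<inter> B = {}" "set r \<subseteq> set q"
      using gpath_first_hit[OF q(1)] by blast
    have rne: "r \<noteq> []" using r gpath_nonempty by blast
    have qne: "q \<noteq> []" using q gpath_nonempty by blast
    have "set (tl r) \<subseteq> set (tl q)"
    proof
      fix v assume v: "v \<in> set (tl r)"
      have "distinct r" using r gpath_distinct by blast
      then have "v \<noteq> hd r" using v rne by (metis distinct.simps(2) list.exhaust_sel)
      moreover have "v \<in> set q" using v r(5) rne by (metis list.set_sel(2) subsetD)
      ultimately show "v \<in> set (tl q)" using r(2) qne by (metis list.exhaust_sel set_ConsD)
    qed
    then have "set (tl r) \<inter> A = {}" using q(4) by blast
    \<comment> \<open>Ends of arcs lie in \<open>V\<close>; only a path without arcs needs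
      \<open>A \<subseteq> V\<close>.\<close>
    moreover have "set r \<subseteq> V"
    proof -
      have "v \<in> V" if vr: "v \<in> set r" for v
      proof (cases "length r = 1")
        case True
        then obtain a where "r = [a]" by (auto simp: length_Suc_conv)
        then have "v = hd q" using vr r(2) by simp
        then show ?thesis using q(3) AB by blast
      next
        case False
        obtain i where i: "i < length r" "v = r ! i" using vr by (metis in_set_conv_nth)
        then have "Suc i < length r \<or> (0 < i \<and> Suc (i - 1) < length r)" using False by auto
        then show ?thesis
        proof
          assume "Suc i < length r"
          then show ?thesis using gpath_nth[OF r(1)] EV i by blast
        next
          assume "0 < i \<and> Suc (i - 1) < length r"
          then show ?thesis using gpath_nth[OF r(1), of "i - 1"] EV i by auto
        qed
      qed
      then show ?thesis by auto
    qed
    ultimately show ?thesis using r q by (intro exI[of _ r]) (auto simp: gpath_def)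
  qed
  then obtain f where f: "\<And>p. p \<in> P \<Longrightarrow> gpath E V (f p) \<and> hd (f p) \<in> A \<and> last (f p) \<in> B
      \<and> set (tl (f p)) \<inter> A = {} \<and> set (butlast (f p)) \<inter> B = {} \<and> set (f p) \<subseteq> set p"
    by metis
  have fdis: "set (f p) \<inter> set (f q) = {}" if "p \<in> P" "q \<in> P" "p \<noteq> q" for p q
    using P(4) f that by blast
  have "inj_on f P"
  proof (rule inj_onI)
    fix p q assume pq: "p \<in> P" "q \<in> P" "f p = f q"
    have "f p \<noteq> []" using f[OF pq(1)] gpath_nonempty by blast
    then show "p = q" using fdis[OF pq(1,2)] pq(3) by auto
  qed
  then have "card (f ` P) = k" using P(2) by (simp add: card_image)
  moreover have "set p \<inter> set q = {}" if "p \<in> f ` P" "q \<in> f ` P" "p \<noteq> q" for p q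
    using that fdis by blast
  moreover have "gpath E V p \<and> hd p \<in> A \<and> last p \<in> B \<and> set (tl p) \<inter> A = {} \<and> set (butlast p) \<inter> B = {}"
    if "p \<in> f ` P" for p
    using that f by blast
  ultimately show thesis using that[of "f ` P"] P(1) by blast
qed

section \<open>A longest cycle with tails\<close>

lemma longest_gap_abs:
  assumes "symp E" "longest E W C" "gpath E W Q" "set Q \<inter> set C = {}"
    and "i \<noteq> j" "i < length C" "j < length C" "E (C ! i) (hd Q)" "E (last Q) (C ! j)"
  shows "int (length Q) + 1 \<le> \<bar>int i - int j\<bar>"
    "int (length Q) + 1 \<le> int (length C) - \<bar>int i - int j\<bar>"
proof -
  have Qne: "Q \<noteq> []" using assms(3) gpath_nonempty by blast
  have "int (length Q) + 1 \<le> \<bar>int i - int j\<bar> \<and> int (length Q) + 1 \<le> int (length C) - \<bar>int i - int j\<bar>"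
  proof (cases "i < j")
    case True
    then show ?thesis using longest_gap[OF assms(1-4) True] assms by auto
  next
    case False
    then have ji: "j < i" using assms by simp
    have "gpath E W (rev Q)" using assms gpath_rev by blast
    moreover have "E (C ! j) (hd (rev Q))" "E (last (rev Q)) (C ! i)"
      using assms Qne by (auto simp: hd_rev last_rev symp_def)
    ultimately show ?thesis using longest_gap[OF assms(1,2) _ _ ji, of "rev Q"] assms by auto
  qed
  then show "int (length Q) + 1 \<le> \<bar>int i - int j\<bar>"
    "int (length Q) + 1 \<le> int (length C) - \<bar>int i - int j\<bar>" by auto
qed

section \<open>Counting attachments with prescribed gaps on a line\<close>

lemma linear_weights_id:
  fixes w :: "nat \<Rightarrow> int"
  assumes "finite A" "A \<noteq> {}"
    and "\<And>p q. p \<in> A \<Longrightarrow> q \<in> A \<Longrightarrow> p < q \<Longrightarrow> w p + w q \<le> 2 * (int q - int p)"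
    and "\<And>p. p \<in> A \<Longrightarrow> 1 \<le> w p"
  shows "2 * sum w A \<le> 2 * (int (Max A) - int (Min A)) + w (Min A) + w (Max A)"
proof -
  have "1 \<le> w (Max A)" using assms by simp
  then show ?thesis
    using linear_weights[OF assms(1,2), of "\<lambda>p. p" w] assms(3,4) by (auto split: if_splits)
qed

text \<open>
  The two kinds of attachments of a path \<open>\<tau>\<close> of \<open>k\<close> vertices to the positions
  \<open>1, 2, \<dots>\<close> of a longest cycle: \<open>S\<close> collects the neighbours of its first vertex and
  \<open>J\<close> those of its last vertex, where \<open>p i\<close> allows for attachments through another tail.
  The gap conditions say that no detour through \<open>\<tau>\<close> lengthens the cycle.
\<close>

lemma attachment_count:
  fixes p :: "nat \<Rightarrow> nat"
  assumes fin: "finite S" "finite J"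
    and p: "\<And>i. i \<in> J \<Longrightarrow> 1 \<le> p i"
    and S: "\<And>i. i \<in> S \<Longrightarrow> 2 \<le> i"
    and SS: "\<And>i j. i \<in> S \<Longrightarrow> j \<in> S \<Longrightarrow> i < j \<Longrightarrow> i + 2 \<le> j"
    and J: "\<And>i. i \<in> J \<Longrightarrow> k + p i \<le> i"
    and JJ: "\<And>i j. i \<in> J \<Longrightarrow> j \<in> J \<Longrightarrow> i < j \<Longrightarrow> i + p i + p j \<le> j"
    and SJ: "\<And>i j. i \<in> S \<Longrightarrow> j \<in> J \<Longrightarrow> i < j \<Longrightarrow> i + k + p j \<le> j"
    and JS: "\<And>i j. i \<in> J \<Longrightarrow> j \<in> S \<Longrightarrow> i < j \<Longrightarrow> i + k + p i \<le> j"
    and t: "\<And>i. i \<in> S \<union> J \<Longrightarrow> i \<le> t" and k: "1 \<le> k"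
  shows "sum p J + card S \<le> t \<and> (J \<noteq> {} \<longrightarrow> sum p J + card S + k \<le> t + 1)"
proof -
  have only_S: "2 * card S' \<le> u" if "S' \<subseteq> S" "\<And>i. i \<in> S' \<Longrightarrow> i \<le> u" for S' u
  proof (cases "S' = {}")
    case False
    have f: "finite S'" using that fin finite_subset by blast
    have m: "Min S' \<in> S'" "Max S' \<in> S'" using f False by auto
    have "4 * int (card S') \<le> 2 * (int (Max S') - int (Min S')) + 4"
    proof -
      have "2 * (\<Sum>_\<in>S'. 2) \<le> 2 * (int (Max S') - int (Min S')) + 2 + 2"
      proof (rule linear_weights_id[OF f False])
        fix p q assume "p \<in> S'" "q \<in> S'" "p < q"
        then have "p + 2 \<le> q" using SS that(1) by blast
        then show "(2::int) + 2 \<le> 2 * (int q - int p)" by simp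
      qed simp
      then show ?thesis by simp
    qed
    moreover have "2 \<le> Min S'" "Max S' \<le> u" using S m that by auto
    ultimately show ?thesis by simp
  qed simp
  have main: "sum p J + card S + k \<le> t + 1" if Jne: "J \<noteq> {}"
  proof -
    \<comment> \<open>The first element of \<open>J\<close> splits \<open>S\<close>. Below it only
      points of \<open>S\<close> occur, at mutual distance 2, and the gap \<open>k + p i\<close> in
      front of it yields the summand \<open>k\<close> of the second bound.\<close>
    define i where "i = Min J"
    have i: "i \<in> J" "\<And>j. j \<in> J \<Longrightarrow> i \<le> j" using Jne fin by (auto simp: i_def)
    define S1 where "S1 = {s \<in> S. s < i}"
    define \<Omega> where "\<Omega> = {x \<in> S \<union> J. i \<le> x}"
    \<comment> \<open>The weights used are \<open>2 * q\<close>: a point of both \<open>S\<close>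
      and \<open>J\<close> counts \<open>p x + 1\<close> in \<open>r\<close>, which is at most
      \<open>2 * q x\<close>. At the last point only half the weight is available, and
      \<open>r ?M \<le> q ?M + 1\<close> loses at most 1.\<close>
    define q where "q x = (if x \<in> J then p x else 1)" for x
    define r where "r x = (if x \<in> J then p x else 0) + (if x \<in> S then 1 else 0)" for x
    have fO: "finite \<Omega>" "\<Omega> \<noteq> {}" using fin i by (auto simp: \<Omega>_def)
    have mO: "Min \<Omega> = i" using i fO by (intro Min_eqI) (auto simp: \<Omega>_def)
    let ?M = "Max \<Omega>"
    have M: "?M \<in> \<Omega>" using fO by simp
    have qp: "1 \<le> q x" if "x \<in> \<Omega>" for x using p by (auto simp: q_def)
    have gaps: "int (2 * q x) + int (2 * q y) \<le> 2 * (int y - int x)"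
      if xy: "x \<in> \<Omega>" "y \<in> \<Omega>" "x < y" for x y
    proof -
      have "x + q x + q y \<le> y"
        using xy SS[of x y] JJ[of x y] SJ[of x y] JS[of x y] k p[of x] p[of y]
        by (auto simp: \<Omega>_def q_def)
      then show ?thesis by simp
    qed
    have lw: "2 * (\<Sum>x\<in>\<Omega>. int (2 * q x)) \<le> 2 * (int ?M - int i) + int (2 * q i) + int (2 * q ?M)"
      using linear_weights_id[OF fO gaps] qp unfolding mO by force
    then have lw: "2 * (\<Sum>x\<in>\<Omega>. q x) + i \<le> ?M + q i + q ?M"
      by (simp flip: sum_distrib_left of_nat_sum)
    have qi: "q i = p i" using i by (simp add: q_def)
    have S1: "2 * card S1 + k + p i \<le> i"
    proof (cases "S1 = {}")
      case True
      then show ?thesis using J i by simp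
    next
      case False
      have f1: "finite S1" using fin by (simp add: S1_def)
      then have m: "Max S1 \<in> S1" using False by simp
      have "2 * card S1 \<le> Max S1" using only_S[of S1 "Max S1"] f1 by (auto simp: S1_def)
      moreover have "Max S1 + k + p i \<le> i" using SJ[of "Max S1" i] m i by (auto simp: S1_def)
      ultimately show ?thesis by simp
    qed
    have "r x \<le> 2 * q x" if "x \<in> \<Omega>" for x using p[of x] that by (auto simp: r_def q_def)
    then have "sum r (\<Omega> - {?M}) \<le> (\<Sum>x\<in>\<Omega> - {?M}. 2 * q x)" by (intro sum_mono) auto
    moreover have "r ?M \<le> q ?M + 1" by (auto simp: r_def q_def)
    moreover have "sum r \<Omega> = r ?M + sum r (\<Omega> - {?M})" "sum q \<Omega> = q ?M + sum q (\<Omega> - {?M})"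
      using sum.remove[OF fO(1) M] by auto
    ultimately have r: "sum r \<Omega> + q ?M \<le> 2 * sum q \<Omega> + 1"
      by (simp flip: sum_distrib_left)
    have "sum p J + card S = card S1 + sum r \<Omega>"
    proof -
      have "sum r \<Omega> = (\<Sum>x\<in>\<Omega>. if x \<in> J then p x else 0) + (\<Sum>x\<in>\<Omega>. if x \<in> S then 1 else 0)"
        by (simp add: r_def sum.distrib)
      also have "(\<Sum>x\<in>\<Omega>. if x \<in> J then p x else 0) = sum p (\<Omega> \<inter> J)"
        using fO by (simp add: sum.inter_restrict)
      also have "\<Omega> \<inter> J = J" using i by (auto simp: \<Omega>_def)
      also have "(\<Sum>x\<in>\<Omega>. if x \<in> S then 1 else 0) = card (\<Omega> \<inter> S)"
        using fO by (simp add: sum.inter_restrict[symmetric])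
      finally have "sum r \<Omega> = sum p J + card (\<Omega> \<inter> S)" .
      moreover have "card S = card S1 + card (\<Omega> \<inter> S)"
        using fin by (subst card_Un_disjoint[symmetric]) (auto simp: S1_def \<Omega>_def intro!: arg_cong[of _ _ card])
      ultimately show ?thesis by simp
    qed
    moreover have "?M \<le> t" using M t by (auto simp: \<Omega>_def)
    ultimately show ?thesis using r S1 lw qi by simp
  qed
  show ?thesis
  proof (cases "J = {}")
    case True
    then show ?thesis using only_S[of S t] t by simp
  next
    case False
    then show ?thesis using main k by simp
  qed
qed

text \<open>The intervals of radius \<open>p i\<close> about the points of \<open>J\<close> do not
  overlap and lie between \<open>k\<close> and \<open>h - k\<close>.\<close>

lemma attachment_degree_bound:
  fixes p :: "nat \<Rightarrow> nat"
  assumes fin: "finite J" and ne: "J \<noteq> {}"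
    and p: "\<And>i. i \<in> J \<Longrightarrow> 1 \<le> p i"
    and J: "\<And>i. i \<in> J \<Longrightarrow> k + p i \<le> i \<and> i + k + p i \<le> h"
    and JJ: "\<And>i j. i \<in> J \<Longrightarrow> j \<in> J \<Longrightarrow> i < j \<Longrightarrow> i + p i + p j \<le> j"
  shows "2 * (k + sum p J) \<le> h"
proof -
  have m: "Min J \<in> J" "Max J \<in> J" using fin ne by auto
  have "2 * (\<Sum>x\<in>J. int (2 * p x)) \<le> 2 * (int (Max J) - int (Min J)) + int (2 * p (Min J)) + int (2 * p (Max J))"
  proof (rule linear_weights_id[OF fin ne])
    fix i j assume "i \<in> J" "j \<in> J" "i < j"
    then have "i + p i + p j \<le> j" using JJ by blast
    then show "int (2 * p i) + int (2 * p j) \<le> 2 * (int j - int i)" by simp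
  next
    fix i assume "i \<in> J"
    then show "1 \<le> int (2 * p i)" using p[of i] by simp
  qed
  then have "2 * sum p J + Min J \<le> Max J + p (Min J) + p (Max J)"
    by (simp flip: sum_distrib_left of_nat_sum)
  then show ?thesis using J[OF m(1)] J[OF m(2)] by simp
qed

definition segment :: "'v list \<Rightarrow> nat \<Rightarrow> nat \<Rightarrow> 'v list" where
  "segment H i j = drop i (take (Suc j) H)"

lemma segment_props:
  assumes "gpath E W H" "i \<le> j" "j < length H"
  shows "gpath E W (segment H i j)" "hd (segment H i j) = H ! i" "last (segment H i j) = H ! j"
    "length (segment H i j) = Suc j - i" "set (segment H i j) \<subseteq> set H" "segment H i j \<noteq> []"
proof -
  show "gpath E W (segment H i j)"
    unfolding segment_def using assms by (intro gpath_dropI gpath_takeI) auto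
  show "hd (segment H i j) = H ! i" using assms by (simp add: segment_def hd_drop_conv_nth)
  show "last (segment H i j) = H ! j"
    using assms by (simp add: segment_def take_Suc_conv_app_nth)
  show "length (segment H i j) = Suc j - i" using assms by (simp add: segment_def)
  then show "segment H i j \<noteq> []" using assms by auto
  show "set (segment H i j) \<subseteq> set H"
    unfolding segment_def by (meson order_trans set_drop_subset set_take_subset)
qed

lemma set_segment:
  assumes "j < length H"
  shows "set (segment H i j) = (!) H ` {i..j}"
proof -
  have "segment H i j = map ((!) H) [i..<Suc j]"
    using assms by (intro nth_equalityI) (auto simp: segment_def simp del: upt_Suc)
  then show ?thesis by (auto simp del: upt_Suc)
qed

lemma segments_disjoint:
  assumes "distinct H" "j < length H" "j' < length H" "j < i'"
  shows "set (segment H i j) \<inter> set (segment H i' j') = {}"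
  using assms by (auto simp: set_segment nth_eq_iff_index_eq)

definition nbrs :: "('v \<Rightarrow> 'v \<Rightarrow> bool) \<Rightarrow> 'v set \<Rightarrow> 'v \<Rightarrow> 'v set" where
  "nbrs E K v = {w \<in> K. E v w}"

text \<open>A tail does not contain its root, so that it may be empty; the tip of such a slot is
  then the root itself.\<close>

locale tailed_cycle =
  fixes E :: "'v \<Rightarrow> 'v \<Rightarrow> bool" and K :: "'v set" and H :: "'v list" and T :: "nat \<Rightarrow> 'v list"
  assumes sym: "symp E" and irr: "\<And>v. \<not> E v v" and finK: "finite K"
    and H: "longest E K H" and h2: "2 \<le> length H"
    and T_path: "\<And>i. i < length H \<Longrightarrow> gpath E K (H ! i # T i)"
    and T_H: "\<And>i. i < length H \<Longrightarrow> set (T i) \<inter> set H = {}"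
    and T_T: "\<And>i j. i < length H \<Longrightarrow> j < length H \<Longrightarrow> i \<noteq> j \<Longrightarrow> set (T i) \<inter> set (T j) = {}"
begin

abbreviation h :: nat where "h \<equiv> length H"

definition tip :: "nat \<Rightarrow> 'v" where "tip i = last (H ! i # T i)"

abbreviation nb :: "'v \<Rightarrow> 'v set" where "nb \<equiv> nbrs E K"

definition conn :: "nat \<Rightarrow> nat \<Rightarrow> nat \<Rightarrow> bool" where
  "conn i j m \<longleftrightarrow> (\<exists>p. gpath E K p \<and> hd p = tip i \<and> last p = tip j \<and> m \<le> length p)"

lemma E_sym: "E u v \<longleftrightarrow> E v u"
  using sym by (auto simp: symp_def)

lemma H_path: "gpath E K H" and H_closed: "E (last H) (hd H)"
  and H_max: "\<And>D. gcycle E K D \<Longrightarrow> length D \<le> h"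
  using H h2 by (auto simp: longest_def gcycle_def)

lemma H_ne: "H \<noteq> []" using h2 by auto

lemma H_distinct: "distinct H" using H_path gpath_distinct by blast

lemma H_subset: "set H \<subseteq> K" using H_path gpath_subset by blast

lemma finite_nb [simp]: "finite (nb v)" using finK by (simp add: nbrs_def)

lemma H_wrap: "E (H ! (h - 1)) (H ! 0)"
  using H_closed H_ne by (simp add: last_conv_nth hd_conv_nth)

lemma nth_in_K: "i < h \<Longrightarrow> H ! i \<in> K" using H_subset by auto

lemma T_subset: "i < h \<Longrightarrow> set (T i) \<subseteq> K" using T_path gpath_subset by fastforce

lemma T_path': "i < h \<Longrightarrow> T i \<noteq> [] \<Longrightarrow> gpath E K (T i) \<and> E (H ! i) (hd (T i))"
  using T_path[of i] by (simp add: gpath_Cons)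

lemma T_not_H: "i < h \<Longrightarrow> x \<in> set (T i) \<Longrightarrow> x \<notin> set H" using T_H by blast

lemma tip_in: "i < h \<Longrightarrow> tip i \<in> insert (H ! i) (set (T i))"
  by (simp add: tip_def)

lemma tip_K: "i < h \<Longrightarrow> tip i \<in> K"
  using tip_in[of i] nth_in_K[of i] T_subset[of i] by auto

lemma conn_sym: "conn i j m \<Longrightarrow> conn j i m"
proof -
  assume "conn i j m"
  then obtain p where p: "gpath E K p" "hd p = tip i" "last p = tip j" "m \<le> length p"
    unfolding conn_def by blast
  then show "conn j i m"
    unfolding conn_def by (intro exI[of _ "rev p"]) (simp add: gpath_rev[OF sym] hd_rev last_rev)
qed

lemma conn_mono: "conn i j m \<Longrightarrow> m' \<le> m \<Longrightarrow> conn i j m'"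
  unfolding conn_def using order_trans by blast

lemma conn_refl: "i < h \<Longrightarrow> conn i i 1"
  unfolding conn_def using tip_K by (intro exI[of _ "[tip i]"]) auto

text \<open>Only the two tails appended at the ends have to be avoided: \<open>q\<close> may run
  through other tails, as the detours found later do.\<close>

lemma conn_extend:
  assumes ij: "i < h" "j < h" "i \<noteq> j" and q: "gpath E K q" "hd q = H ! i" "last q = H ! j"
    and d: "set q \<inter> set (T i) = {}" "set q \<inter> set (T j) = {}"
  shows "conn i j (length (T i) + length (T j) + length q)"
proof -
  have d': "set (T i) \<inter> set q = {}" "set (T j) \<inter> set q = {}" using d by auto
  note p = gpath_both_tails[OF sym q T_path[OF ij(1)] d'(1) T_path[OF ij(2)] d'(2) T_T[OF ij]]
  show ?thesis unfolding conn_def tip_def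
    by (intro exI[of _ "rev (T i) @ q @ T j"] conjI p) simp
qed

lemma conn_extend_H:
  assumes "i < h" "j < h" "i \<noteq> j" "gpath E K q" "hd q = H ! i" "last q = H ! j" "set q \<subseteq> set H"
  shows "conn i j (length (T i) + length (T j) + length q)"
  by (rule conn_extend[OF assms(1-6)]) (use assms(7) T_H[OF assms(1)] T_H[OF assms(2)] in blast)+

lemma wrap_path:
  assumes "i < j" "j < h"
  shows "gpath E K (drop j H @ take (Suc i) H)" "hd (drop j H @ take (Suc i) H) = H ! j"
    "last (drop j H @ take (Suc i) H) = H ! i" "length (drop j H @ take (Suc i) H) = h - (j - i) + 1"
    "set (drop j H @ take (Suc i) H) \<subseteq> set H"
proof -
  have "E (last (drop j H)) (hd (take (Suc i) H))"
    using H_closed assms by (simp add: hd_append)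
  then show "gpath E K (drop j H @ take (Suc i) H)"
    using assms H_path set_take_drop_disjoint[OF H_distinct, of "Suc i" j]
    by (intro gpath_join gpath_dropI gpath_takeI) auto
  show "hd (drop j H @ take (Suc i) H) = H ! j" using assms by (simp add: hd_drop_conv_nth)
  show "last (drop j H @ take (Suc i) H) = H ! i" using assms by (simp add: take_Suc_conv_app_nth)
  show "length (drop j H @ take (Suc i) H) = h - (j - i) + 1" using assms by auto
  show "set (drop j H @ take (Suc i) H) \<subseteq> set H"
    using set_drop_subset[of j H] set_take_subset[of "Suc i" H] by auto
qed

lemma conn_arcs:
  assumes "i < j" "j < h"
  shows "conn i j (length (T i) + length (T j) + (j - i) + 1)"
    "conn i j (length (T i) + length (T j) + (h - (j - i)) + 1)"
proof -
  show "conn i j (length (T i) + length (T j) + (j - i) + 1)"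
    using conn_extend_H[of i j "segment H i j"] segment_props[OF H_path, of i j] assms
    by (auto elim!: conn_mono)
  show "conn i j (length (T i) + length (T j) + (h - (j - i)) + 1)"
    using conn_extend_H[of j i "drop j H @ take (Suc i) H"] wrap_path[OF assms] assms
    by (auto elim!: conn_mono intro!: conn_sym[of j i])
qed

lemma gap:
  assumes "gpath E K Q" "set Q \<inter> set H = {}" "i \<noteq> j" "i < h" "j < h"
    "E (H ! i) (hd Q)" "E (last Q) (H ! j)"
  shows "int (length Q) + 1 \<le> \<bar>int i - int j\<bar>" "int (length Q) + 1 \<le> int h - \<bar>int i - int j\<bar>"
  using longest_gap_abs[OF sym H assms] .

subsection \<open>Paths between vertices of the cycle\<close>

text \<open>A rotation in the style of Posa: from the last position down to \<open>w\<close>, the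
  first neighbour of \<open>H ! 0\<close> after \<open>y\<close>, across to \<open>H ! 0\<close> and
  up to \<open>y\<close>. No skipped position is a neighbour of \<open>H ! 0\<close>, so the path
  contains all neighbours and \<open>H ! 0\<close> itself.\<close>

lemma root_degree_path:
  assumes y: "y < h - 1"
  obtains q where "gpath E K q" "hd q = H ! (h - 1)" "last q = H ! y" "set q \<subseteq> set H"
    "card {i. i < h \<and> E (H ! 0) (H ! i)} + 1 \<le> length q"
proof -
  define w where "w = (LEAST w. y < w \<and> w < h \<and> E (H ! 0) (H ! w))"
  have ex: "y < h - 1 \<and> h - 1 < h \<and> E (H ! 0) (H ! (h - 1))" using y H_wrap E_sym by auto
  have w: "y < w" "w < h" "E (H ! 0) (H ! w)"
    using LeastI[of "\<lambda>w. y < w \<and> w < h \<and> E (H ! 0) (H ! w)", OF ex] by (auto simp: w_def)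
  have wl: "w \<le> i" if "y < i" "i < h" "E (H ! 0) (H ! i)" for i
    unfolding w_def using that by (intro Least_le) auto
  let ?q = "rev (drop w H) @ take (Suc y) H"
  have "gpath E K (rev (drop w H))" using H_path w gpath_rev[OF sym] by (simp add: gpath_dropI)
  moreover have "gpath E K (take (Suc y) H)" using H_path by (simp add: gpath_takeI)
  moreover have "E (last (rev (drop w H))) (hd (take (Suc y) H))"
    using w y E_sym H_ne by (simp add: last_rev hd_drop_conv_nth hd_conv_nth)
  ultimately have "gpath E K ?q"
    using set_take_drop_disjoint[OF H_distinct, of "Suc y" w] w by (intro gpath_join) auto
  moreover have "hd ?q = H ! (h - 1)" using w by (simp add: hd_rev hd_append last_conv_nth)
  moreover have "last ?q = H ! y" using w by (simp add: take_Suc_conv_app_nth)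
  moreover have "set ?q \<subseteq> set H" using set_drop_subset[of w H] set_take_subset[of "Suc y" H] by auto
  moreover have "card {i. i < h \<and> E (H ! 0) (H ! i)} + 1 \<le> length ?q"
  proof -
    have "{i. i < h \<and> E (H ! 0) (H ! i)} \<subseteq> {1..y} \<union> {w..<h}"
    proof
      fix i assume i: "i \<in> {i. i < h \<and> E (H ! 0) (H ! i)}"
      then have "i \<noteq> 0" using irr by (metis mem_Collect_eq)
      then show "i \<in> {1..y} \<union> {w..<h}" using wl i by (cases "y < i") auto
    qed
    then have "card {i. i < h \<and> E (H ! 0) (H ! i)} \<le> card ({1..y} \<union> {w..<h})"
      by (intro card_mono) auto
    also have "\<dots> \<le> y + (h - w)" using card_Un_le[of "{1..y}" "{w..<h}"] by simp
    finally show ?thesis using w by simp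
  qed
  ultimately show thesis using that by blast
qed

section \<open>Attachments of the tail at position 0 to the cycle\<close>

definition deep :: "nat \<Rightarrow> 'v \<Rightarrow> nat set" where
  "deep i v = {l. l \<le> length (T i) \<and> E v ((H ! i # T i) ! l)}"

text \<open>
  The attachments of the tail at position \<open>0\<close>: \<open>front\<close> for its first vertex,
  \<open>rear\<close> for its tip, the latter also through vertices of other tails, where
  \<open>depth i\<close> counts the vertices of the tail at \<open>i\<close> up to the furthest one adjacent to the tip.
\<close>

definition front :: "nat set" where
  "front = {i. 0 < i \<and> i < h \<and> E (hd (T 0)) (H ! i)}"

definition rear :: "nat set" where
  "rear = {i. 0 < i \<and> i < h \<and> deep i (tip 0) \<noteq> {}}"

definition depth :: "nat \<Rightarrow> nat" where
  "depth i = Suc (Max (deep i (tip 0)))"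

text \<open>The way from the deepest vertex of the slot \<open>i\<close> adjacent to
  \<open>tip 0\<close> down towards the root, the root excluded; empty if the root is the only such
  vertex.\<close>

definition ladder :: "nat \<Rightarrow> 'v list" where
  "ladder i = rev (take (depth i - 1) (T i))"

lemma finite_deep [simp]: "finite (deep i v)" by (simp add: deep_def)

lemma depth_props:
  assumes "i \<in> rear"
  shows "1 \<le> depth i" "depth i - 1 \<le> length (T i)" "E (tip 0) ((H ! i # T i) ! (depth i - 1))"
proof -
  have "Max (deep i (tip 0)) \<in> deep i (tip 0)" using assms by (auto simp: rear_def)
  then show "1 \<le> depth i" "depth i - 1 \<le> length (T i)" "E (tip 0) ((H ! i # T i) ! (depth i - 1))"
    by (auto simp: depth_def deep_def)
qed

lemma ladder_props:
  assumes "i \<in> rear"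
  shows "length (ladder i) = depth i - 1" "set (ladder i) \<subseteq> set (T i)"
  using depth_props[OF assms] set_take_subset[of "depth i - 1" "T i"] by (auto simp: ladder_def)

lemma climb_ladder:
  assumes i: "i \<in> rear" and R: "gpath E K R" "last R = tip 0" "set R \<inter> set (T i) = {}"
  shows "gpath E K (R @ ladder i)" "E (last (R @ ladder i)) (H ! i)"
proof -
  have ih: "i < h" using i by (simp add: rear_def)
  have Rne: "R \<noteq> []" using R gpath_nonempty by blast
  note dp = depth_props[OF i]
  have "gpath E K (R @ ladder i) \<and> E (last (R @ ladder i)) (H ! i)"
  proof (cases "depth i = 1")
    case True
    then show ?thesis using R dp Rne by (simp add: ladder_def)
  next
    case False
    then have l: "0 < depth i - 1" "depth i - 1 \<le> length (T i)" using dp by auto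
    have Tne: "T i \<noteq> []" using l by auto
    note tp = T_path'[OF ih Tne]
    have "gpath E K (take (depth i - 1) (T i))" using tp l gpath_takeI by blast
    then have 1: "gpath E K (ladder i)" using gpath_rev[OF sym] by (simp add: ladder_def)
    have "hd (ladder i) = last (take (depth i - 1) (T i))" by (simp add: ladder_def hd_rev)
    also have "\<dots> = T i ! (depth i - 2)"
      using l by (subst last_conv_nth) (auto simp: numeral_2_eq_2 min_def)
    also have "\<dots> = (H ! i # T i) ! (depth i - 1)" using l by (auto simp: nth_Cons split: nat.split) (metis Suc_eq_plus1 diff_Suc_eq_diff_pred diff_add_inverse2 numeral_2_eq_2 One_nat_def)
    finally have 2: "E (tip 0) (hd (ladder i))" using dp by simp
    have "last (ladder i) = hd (T i)" using l Tne by (simp add: ladder_def last_rev)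
    then have 3: "E (last (ladder i)) (H ! i)" using tp E_sym by simp
    have "ladder i \<noteq> []" using 1 gpath_nonempty by blast
    then show ?thesis
      using gpath_join[OF R(1) 1] R ladder_props(2)[OF i] 2 3 by auto
  qed
  then show "gpath E K (R @ ladder i)" "E (last (R @ ladder i)) (H ! i)" by auto
qed

context
  assumes T0: "T 0 \<noteq> []"
begin

lemma tail0: "gpath E K (T 0)" "E (H ! 0) (hd (T 0))" "last (T 0) = tip 0" "tip 0 \<in> set (T 0)"
  using T_path'[of 0] T0 h2 H_ne by (auto simp: tip_def)

lemma front_root_gap:
  assumes "i \<in> front"
  shows "2 \<le> i" "i + 2 \<le> h"
proof -
  have v: "hd (T 0) \<in> set (T 0)" using T0 by simp
  have "gpath E K [hd (T 0)]" using v T_subset[of 0] h2 H_ne by auto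
  moreover have "set [hd (T 0)] \<inter> set H = {}" using v T_not_H[of 0] h2 H_ne by auto
  moreover have "E (H ! 0) (hd [hd (T 0)])" using tail0 by simp
  ultimately show "2 \<le> i" "i + 2 \<le> h"
    using gap[of "[hd (T 0)]" 0 i] assms h2 H_ne by (auto simp: front_def)
qed

lemma front_front_gap:
  assumes "i \<in> front" "j \<in> front" "i < j"
  shows "i + 2 \<le> j"
proof -
  have v: "hd (T 0) \<in> set (T 0)" using T0 by simp
  have "gpath E K [hd (T 0)]" using v T_subset[of 0] h2 H_ne by auto
  moreover have "set [hd (T 0)] \<inter> set H = {}" using v T_not_H[of 0] h2 H_ne by auto
  moreover have "E (H ! i) (hd [hd (T 0)])" using assms E_sym by (simp add: front_def)
  ultimately show ?thesis
    using gap[of "[hd (T 0)]" i j] assms h2 H_ne by (auto simp: front_def)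
qed

lemma rear_disj:
  assumes "i \<in> rear"
  shows "set (T 0) \<inter> set (T i) = {}" "set (ladder i) \<inter> set H = {}"
proof -
  have i: "0 < h" "i < h" "0 \<noteq> i" using assms h2 by (auto simp: rear_def)
  show "set (T 0) \<inter> set (T i) = {}" using T_T[OF i] .
  show "set (ladder i) \<inter> set H = {}" using T_H[OF i(2)] ladder_props(2)[OF assms] by blast
qed

lemma climb0:
  assumes "i \<in> rear"
  shows "gpath E K (T 0 @ ladder i)" "E (last (T 0 @ ladder i)) (H ! i)"
    "set (T 0 @ ladder i) \<inter> set H = {}" "length (T 0 @ ladder i) + 1 = length (T 0) + depth i"
    "hd (T 0 @ ladder i) = hd (T 0)"
  using climb_ladder[OF assms tail0(1,3) rear_disj(1)[OF assms]] rear_disj(2)[OF assms] T_H[of 0] h2 H_ne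
    ladder_props(1)[OF assms] depth_props(1)[OF assms] T0
  by (auto simp: Int_Un_distrib2)

text \<open>The whole tail at 0 followed by the ladder is a detour between the two roots; it has
  \<open>length (T 0) + depth i - 1\<close> vertices.\<close>

lemma rear_root_gap:
  assumes "i \<in> rear"
  shows "length (T 0) + depth i \<le> i" "i + length (T 0) + depth i \<le> h"
proof -
  have i: "i \<noteq> 0" "i < h" using assms by (auto simp: rear_def)
  have "0 < h" using h2 H_ne by auto
  then show "length (T 0) + depth i \<le> i" "i + length (T 0) + depth i \<le> h"
    using gap[OF climb0(1,3)[OF assms] i(1)[symmetric] _ i(2) _ climb0(2)[OF assms]]
      tail0(2) climb0(4,5)[OF assms] by (auto simp: of_nat_diff)
qed

lemma front_rear_gap:
  assumes "i \<in> front" "j \<in> rear" "i \<noteq> j"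
  shows "int (length (T 0) + depth j) \<le> \<bar>int i - int j\<bar>"
proof -
  have "i < h" "j < h" using assms by (auto simp: front_def rear_def)
  moreover have "E (H ! i) (hd (T 0 @ ladder j))"
    using assms(1) E_sym T0 by (simp add: front_def)
  ultimately show ?thesis
    using gap(1)[OF climb0(1,3)[OF assms(2)] assms(3) _ _ _ climb0(2)[OF assms(2)]]
      climb0(4)[OF assms(2)] by simp
qed

text \<open>This detour climbs one ladder, touches the tail at 0 in its tip alone and descends the
  other ladder; hence \<open>length (T 0)\<close> does not enter.\<close>

lemma rear_rear_gap:
  assumes "i \<in> rear" "j \<in> rear" "i < j"
  shows "i + depth i + depth j \<le> j"
proof -
  have ij: "i < h" "j < h" using assms by (auto simp: rear_def)
  have tK: "gpath E K [tip 0]" using tip_K[of 0] h2 H_ne by simp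
  have tT: "tip 0 \<notin> set (T i)" "tip 0 \<notin> set (T j)"
    using rear_disj(1) assms tail0(4) by blast+
  have "gpath E K ([tip 0] @ ladder i)" and e1: "E (last ([tip 0] @ ladder i)) (H ! i)"
    using climb_ladder[OF assms(1) tK] tT by auto
  then have R: "gpath E K (rev ([tip 0] @ ladder i))" using gpath_rev[OF sym] by blast
  have "set (rev ([tip 0] @ ladder i)) \<inter> set (T j) = {}"
    using tT ladder_props(2)[OF assms(1)] T_T[OF ij] assms(3) by auto
  then have Q: "gpath E K (rev ([tip 0] @ ladder i) @ ladder j)"
    and e2: "E (last (rev ([tip 0] @ ladder i) @ ladder j)) (H ! j)"
    using climb_ladder[OF assms(2) R] by auto
  have "tip 0 \<notin> set H" using tail0(4) T_not_H[of 0] h2 H_ne by auto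
  then have "set (rev ([tip 0] @ ladder i) @ ladder j) \<inter> set H = {}"
    using rear_disj(2) assms by auto
  moreover have "E (H ! i) (hd (rev ([tip 0] @ ladder i) @ ladder j))"
    using e1 E_sym by (auto simp: hd_append hd_rev)
  ultimately show ?thesis
    using gap(1)[OF Q _ _ ij _ e2] assms ladder_props(1)[OF assms(1)] ladder_props(1)[OF assms(2)]
      depth_props(1)[OF assms(1)] depth_props(1)[OF assms(2)] by simp
qed

end

end

context tailed_cycle
begin

context
  assumes T0: "T 0 \<noteq> []" and tip_nb: "nb (tip 0) \<subseteq> set H \<union> (\<Union>i<h. set (T i))"
begin

lemma finite_front [simp]: "finite front" and finite_rear [simp]: "finite rear"
  by (auto simp: front_def rear_def)

text \<open>The own slot offers \<open>length (T 0)\<close> vertices besides the tip; in any other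
  slot the neighbours are among the first \<open>depth i\<close> vertices.\<close>

lemma tip_degree: "card (nb (tip 0)) \<le> length (T 0) + sum depth rear"
proof -
  let ?X = "insert (H ! 0) (set (T 0) - {tip 0})"
  let ?Y = "\<lambda>i. set (take (depth i) (H ! i # T i))"
  have h0: "0 < h" using h2 by auto
  have deep: "(H ! i # T i) ! l \<in> ?Y i \<and> i \<in> rear"
    if "0 < i" "i < h" "l \<le> length (T i)" "E (tip 0) ((H ! i # T i) ! l)" for i l
  proof -
    have l: "l \<in> deep i (tip 0)" using that by (simp add: deep_def)
    then have "l \<le> Max (deep i (tip 0))" by simp
    then have "l < depth i" by (simp add: depth_def)
    then show ?thesis using l that by (auto simp: rear_def in_set_conv_nth intro!: exI[of _ l])
  qed
  have "nb (tip 0) \<subseteq> ?X \<union> (\<Union>i\<in>rear. ?Y i)"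
  proof
    fix w assume w: "w \<in> nb (tip 0)"
    then have Ew: "E (tip 0) w" by (simp add: nbrs_def)
    have "w \<in> set H \<or> (\<exists>i<h. w \<in> set (T i))" using w tip_nb by blast
    then consider i where "i < h" "w = H ! i" | i where "i < h" "w \<in> set (T i)"
      by (metis in_set_conv_nth)
    then show "w \<in> ?X \<union> (\<Union>i\<in>rear. ?Y i)"
    proof cases
      case 1
      then show ?thesis using deep[of i 0] Ew by (cases "i = 0") auto
    next
      case 2
      then obtain m where m: "m < length (T i)" "w = T i ! m" by (auto simp: in_set_conv_nth)
      have "w \<noteq> tip 0" using Ew irr by metis
      then show ?thesis using deep[of i "Suc m"] 2 m Ew by (cases "i = 0") auto
    qed
  qed
  then have "card (nb (tip 0)) \<le> card (?X \<union> (\<Union>i\<in>rear. ?Y i))"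
    by (intro card_mono) auto
  also have "\<dots> \<le> card ?X + card (\<Union>i\<in>rear. ?Y i)" by (rule card_Un_le)
  also have "\<dots> \<le> length (T 0) + sum depth rear"
  proof (rule add_mono)
    have "card ?X \<le> Suc (card (set (T 0) - {tip 0}))" by (rule card_insert_le_m1) auto
    also have "card (set (T 0) - {tip 0}) = card (set (T 0)) - 1"
      using tail0[OF T0] by simp
    also have "Suc (card (set (T 0)) - 1) = card (set (T 0))"
      using tail0[OF T0] T0 by (metis List.finite_set Suc_diff_1 card_gt_0_iff set_empty)
    also have "\<dots> \<le> length (T 0)" by (rule card_length)
    finally show "card ?X \<le> length (T 0)" .
    have "card (\<Union>i\<in>rear. ?Y i) \<le> (\<Sum>i\<in>rear. card (?Y i))" by (rule card_UN_le) simp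
    also have "\<dots> \<le> sum depth rear"
      by (intro sum_mono order_trans[OF card_length]) auto
    finally show "card (\<Union>i\<in>rear. ?Y i) \<le> sum depth rear" .
  qed
  finally show ?thesis .
qed

lemma k1: "1 \<le> length (T 0)" using T0 by (cases "T 0") auto

text \<open>The source of the dichotomy for tips: more than \<open>h / 2\<close> neighbours are
  possible only within the own slot.\<close>

lemma rear_degree:
  assumes "rear \<noteq> {}"
  shows "2 * card (nb (tip 0)) \<le> h"
proof -
  have "2 * (length (T 0) + sum depth rear) \<le> h"
    by (rule attachment_degree_bound)
      (use assms rear_root_gap[OF T0] rear_rear_gap[OF T0] depth_props in auto)
  then show ?thesis using tip_degree by simp
qed

text \<open>Neighbours on \<open>H\<close> of a vertex off \<open>H\<close> are never consecutive;
  the root, which \<open>front\<close> excludes, accounts for the summand 1.\<close>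

lemma front_card: "2 * (card front + 1) \<le> h"
proof (cases "front = {}")
  case False
  then have M: "Max front \<in> front" by simp
  have mx: "Max (insert 0 front) = Max front" "Min (insert 0 front) = 0"
    using False by (simp_all add: max_def)
  have "2 * (\<Sum>_\<in>insert 0 front. 2) \<le>
      2 * (int (Max (insert 0 front)) - int (Min (insert 0 front))) + 2 + 2"
  proof (rule linear_weights_id)
    fix p q assume "p \<in> insert 0 front" "q \<in> insert 0 front" "p < q"
    then have "p + 2 \<le> q" using front_root_gap(1)[OF T0, of q] front_front_gap[OF T0, of p q] by auto
    then show "(2::int) + 2 \<le> 2 * (int q - int p)" by simp
  qed auto
  moreover have "card (insert 0 front) = card front + 1" by (simp add: front_def)
  ultimately have "2 * (card front + 1) \<le> Max front + 2" unfolding mx by simp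
  then show ?thesis using front_root_gap(2)[OF T0 M] by simp
qed (use h2 in simp)

lemma lower_count:
  "sum depth (rear \<inter> {..y}) + card (front \<inter> {..y}) \<le> y"
  "rear \<inter> {..y} \<noteq> {} \<Longrightarrow> sum depth (rear \<inter> {..y}) + card (front \<inter> {..y}) + length (T 0) \<le> y + 1"
proof -
  have "sum depth (rear \<inter> {..y}) + card (front \<inter> {..y}) \<le> y \<and>
    (rear \<inter> {..y} \<noteq> {} \<longrightarrow> sum depth (rear \<inter> {..y}) + card (front \<inter> {..y}) + length (T 0) \<le> y + 1)"
  proof (rule attachment_count[where k = "length (T 0)"])
    show "1 \<le> length (T 0)" by (rule k1)
    show "1 \<le> depth i" if "i \<in> rear \<inter> {..y}" for i using that depth_props(1)[of i] by simp
    show "2 \<le> i" if "i \<in> front \<inter> {..y}" for i using that front_root_gap(1)[OF T0, of i] by simp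
    show "i + 2 \<le> j" if "i \<in> front \<inter> {..y}" "j \<in> front \<inter> {..y}" "i < j" for i j
      using that front_front_gap[OF T0, of i j] by simp
    show "length (T 0) + depth i \<le> i" if "i \<in> rear \<inter> {..y}" for i
      using that rear_root_gap(1)[OF T0, of i] by simp
    show "i + depth i + depth j \<le> j" if "i \<in> rear \<inter> {..y}" "j \<in> rear \<inter> {..y}" "i < j" for i j
      using that rear_rear_gap[OF T0, of i j] by simp
    show "i + length (T 0) + depth j \<le> j" if "i \<in> front \<inter> {..y}" "j \<in> rear \<inter> {..y}" "i < j" for i j
      using that front_rear_gap[OF T0, of i j] by simp
    show "i + length (T 0) + depth i \<le> j" if "i \<in> rear \<inter> {..y}" "j \<in> front \<inter> {..y}" "i < j" for i j
      using that front_rear_gap[OF T0, of j i] by simp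
  qed auto
  then show "sum depth (rear \<inter> {..y}) + card (front \<inter> {..y}) \<le> y"
    "rear \<inter> {..y} \<noteq> {} \<Longrightarrow> sum depth (rear \<inter> {..y}) + card (front \<inter> {..y}) + length (T 0) \<le> y + 1"
    by auto
qed

text \<open>The reflection sending \<open>i\<close> to \<open>h - i\<close> reads the cycle
  backwards from the root and turns attachments above \<open>y\<close> into small positions, to
  which \<open>attachment_count\<close> applies.\<close>

lemma upper_count:
  assumes w: "w \<le> h" "\<And>i. i \<in> front \<union> rear \<Longrightarrow> y < i \<Longrightarrow> w \<le> i"
  shows "sum depth (rear \<inter> {y<..}) + card (front \<inter> {y<..}) \<le> h - w"
    "rear \<inter> {y<..} \<noteq> {} \<Longrightarrow> sum depth (rear \<inter> {y<..}) + card (front \<inter> {y<..}) + length (T 0) \<le> h - w + 1"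
proof -
  let ?r = "\<lambda>i. h - i"
  let ?S = "?r ` (front \<inter> {y<..})" and ?J = "?r ` (rear \<inter> {y<..})"
  have lt: "i < h" if "i \<in> front \<union> rear" for i using that by (auto simp: front_def rear_def)
  have inj: "inj_on ?r (front \<union> rear)"
    by (rule inj_onI) (use lt in \<open>fastforce\<close>)
  have cS: "card ?S = card (front \<inter> {y<..})"
    by (intro card_image inj_on_subset[OF inj]) auto
  have sJ: "sum (\<lambda>i. depth (h - i)) ?J = sum depth (rear \<inter> {y<..})"
  proof -
    have "sum (\<lambda>i. depth (h - i)) ?J = sum (\<lambda>i. depth (h - (h - i))) (rear \<inter> {y<..})"
      by (subst sum.reindex) (auto intro: inj_on_subset[OF inj])
    also have "\<dots> = sum depth (rear \<inter> {y<..})"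
      by (intro sum.cong refl) (use lt in force)
    finally show ?thesis .
  qed
  have rr: "h - (h - i) = i" if "i \<in> front \<union> rear" for i using lt[OF that] by simp
  have ac: "sum (\<lambda>i. depth (h - i)) ?J + card ?S \<le> h - w \<and>
    (?J \<noteq> {} \<longrightarrow> sum (\<lambda>i. depth (h - i)) ?J + card ?S + length (T 0) \<le> h - w + 1)"
  proof (rule attachment_count[where k = "length (T 0)"])
    show "finite ?S" "finite ?J" by auto
    show "1 \<le> length (T 0)" by (rule k1)
    show "1 \<le> depth (h - i)" if "i \<in> ?J" for i
      using that depth_props(1) rr by auto
    show "2 \<le> i" if "i \<in> ?S" for i using that front_root_gap(2)[OF T0] by force
    show "i + 2 \<le> j" if "i \<in> ?S" "j \<in> ?S" "i < j" for i j
      using that front_front_gap[OF T0] lt by fastforce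
    show "length (T 0) + depth (h - i) \<le> i" if ij: "i \<in> ?J" for i
    proof -
      obtain a where a: "i = h - a" "a \<in> rear" using ij by auto
      then show ?thesis using rear_root_gap(2)[OF T0, of a] rr[of a] by simp
    qed
    show "i + depth (h - i) + depth (h - j) \<le> j" if ij: "i \<in> ?J" "j \<in> ?J" "i < j" for i j
    proof -
      obtain a b where a: "i = h - a" "a \<in> rear" "j = h - b" "b \<in> rear" using ij by auto
      then have "b < a" using ij(3) lt[of a] lt[of b] by auto
      then show ?thesis using a rear_rear_gap[OF T0, of b a] rr[of a] rr[of b] lt[of a] lt[of b] ij by simp
    qed
    show "i + length (T 0) + depth (h - j) \<le> j" if ij: "i \<in> ?S" "j \<in> ?J" "i < j" for i j
    proof -
      obtain a b where a: "i = h - a" "a \<in> front" "j = h - b" "b \<in> rear" using ij by auto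
      then have "b < a" using ij(3) lt[of a] lt[of b] by auto
      then show ?thesis using a front_rear_gap[OF T0, of a b] rr[of b] lt[of a] lt[of b] ij by simp
    qed
    show "i + length (T 0) + depth (h - i) \<le> j" if ij: "i \<in> ?J" "j \<in> ?S" "i < j" for i j
    proof -
      obtain a b where a: "i = h - a" "a \<in> rear" "j = h - b" "b \<in> front" using ij by auto
      then have "b < a" using ij(3) lt[of a] lt[of b] by auto
      then show ?thesis using a front_rear_gap[OF T0, of b a] rr[of a] lt[of a] lt[of b] ij by simp
    qed
    show "i \<le> h - w" if "i \<in> ?S \<union> ?J" for i using that w lt by fastforce
  qed
  show "sum depth (rear \<inter> {y<..}) + card (front \<inter> {y<..}) \<le> h - w"
    using ac cS sJ by simp
  show "rear \<inter> {y<..} \<noteq> {} \<Longrightarrow> sum depth (rear \<inter> {y<..}) + card (front \<inter> {y<..}) + length (T 0) \<le> h - w + 1"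
    using ac cS sJ by auto
qed

lemma splice:
  assumes w: "y < w" "w < h" and R: "gpath E K R" "set R \<inter> set H = {}" "E (H ! w) (hd R)" "E (last R) (H ! 0)"
  shows "gpath E K (rev (drop w H) @ R @ take (Suc y) H)"
    "hd (rev (drop w H) @ R @ take (Suc y) H) = H ! (h - 1)"
    "last (rev (drop w H) @ R @ take (Suc y) H) = H ! y"
    "length (rev (drop w H) @ R @ take (Suc y) H) = h - w + length R + Suc y"
    "set (rev (drop w H) @ R @ take (Suc y) H) \<subseteq> set H \<union> set R"
proof -
  have Rne: "R \<noteq> []" using R gpath_nonempty by blast
  have 1: "gpath E K (rev (drop w H))" using H_path w gpath_rev[OF sym] by (simp add: gpath_dropI)
  have 2: "gpath E K (take (Suc y) H)" using H_path by (simp add: gpath_takeI)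
  have 3: "gpath E K (R @ take (Suc y) H)"
  proof (rule gpath_join[OF R(1) 2])
    show "set R \<inter> set (take (Suc y) H) = {}" using R(2) set_take_subset[of "Suc y" H] by auto
    show "E (last R) (hd (take (Suc y) H))" using R(4) H_ne by (simp add: hd_conv_nth)
  qed
  show "gpath E K (rev (drop w H) @ R @ take (Suc y) H)"
  proof (rule gpath_join[OF 1 3])
    show "set (rev (drop w H)) \<inter> set (R @ take (Suc y) H) = {}"
      using R(2) set_drop_subset[of w H] set_take_drop_disjoint[OF H_distinct, of "Suc y" w] w by auto
    show "E (last (rev (drop w H))) (hd (R @ take (Suc y) H))"
      using R(3) Rne w by (simp add: last_rev hd_drop_conv_nth)
  qed
  show "hd (rev (drop w H) @ R @ take (Suc y) H) = H ! (h - 1)"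
    using w by (simp add: hd_rev hd_append last_conv_nth)
  show "last (rev (drop w H) @ R @ take (Suc y) H) = H ! y"
    using w by (simp add: take_Suc_conv_app_nth)
  show "length (rev (drop w H) @ R @ take (Suc y) H) = h - w + length R + Suc y"
    using w by simp
  show "set (rev (drop w H) @ R @ take (Suc y) H) \<subseteq> set H \<union> set R"
    using set_drop_subset[of w H] set_take_subset[of "Suc y" H] by auto
qed

text \<open>As in \<open>root_degree_path\<close>, with the tail at 0 in the role of
  \<open>H ! 0\<close>: the path crosses at the first attachment \<open>w\<close> after
  \<open>y\<close>, by way of the tail. The hypothesis on the degree makes \<open>rear\<close>
  nonempty, so that the stronger count, which gains \<open>length (T 0)\<close>, is available on at
  least one side of \<open>y\<close>.\<close>

lemma detour_path:
  assumes d: "length (T 0) < card (nb (tip 0))" and y: "0 < y" "y < h - 1"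
  obtains q where "gpath E K q" "hd q = H ! (h - 1)" "last q = H ! y"
    "set q \<inter> (set (T (h - 1)) \<union> set (T y)) = {}"
    "card (nb (tip 0)) + card front + 1 \<le> length q"
proof -
  let ?k = "length (T 0)"
  have ne: "rear \<noteq> {}" using tip_degree d by auto
  have h1: "h - 1 < h" "0 < h" "0 \<noteq> h - 1" "y < h" "0 \<noteq> y" using y by auto
  have Hd: "set H \<inter> (set (T (h - 1)) \<union> set (T y)) = {}" using T_H h1 by blast
  have T0d: "set (T 0) \<inter> (set (T (h - 1)) \<union> set (T y)) = {}"
    using T_T[OF h1(2,1,3)] T_T[OF h1(2,4,5)] by blast
  have split: "sum depth rear = sum depth (rear \<inter> {..y}) + sum depth (rear \<inter> {y<..})"
    "card front = card (front \<inter> {..y}) + card (front \<inter> {y<..})"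
  proof -
    have r: "(rear \<inter> {..y}) \<union> (rear \<inter> {y<..}) = rear"
      and f: "(front \<inter> {..y}) \<union> (front \<inter> {y<..}) = front" by auto
    show "sum depth rear = sum depth (rear \<inter> {..y}) + sum depth (rear \<inter> {y<..})"
      using sum.union_disjoint[of "rear \<inter> {..y}" "rear \<inter> {y<..}" depth] unfolding r by fastforce
    show "card front = card (front \<inter> {..y}) + card (front \<inter> {y<..})"
      using card_Un_disjoint[of "front \<inter> {..y}" "front \<inter> {y<..}"] unfolding f by fastforce
  qed
  show thesis
  proof (cases "\<exists>i. i \<in> front \<union> rear \<and> y < i")
    case False
    \<comment> \<open>Nothing is attached above \<open>y\<close>, so the closing edge of
      \<open>H\<close> replaces the crossing.\<close>
    let ?q = "[H ! (h - 1)] @ take (Suc y) H"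
    have "H ! (h - 1) \<notin> set (take (Suc y) H)"
    proof -
      have "H ! (h - 1) \<in> set (drop (h - 1) H)"
        using h1 by (metis Cons_nth_drop_Suc list.set_intros(1))
      then show ?thesis using set_take_drop_disjoint[OF H_distinct, of "Suc y" "h - 1"] y by auto
    qed
    then have "gpath E K ?q"
      using H_path nth_in_K[of "h - 1"] h1 H_wrap H_ne by (intro gpath_join gpath_takeI) (auto simp: hd_conv_nth)
    moreover have "last ?q = H ! y" using h1 by (simp add: take_Suc_conv_app_nth)
    moreover have "set ?q \<subseteq> set H" using set_take_subset[of "Suc y" H] h1 by auto
    moreover have "card (nb (tip 0)) + card front + 1 \<le> length ?q"
    proof -
      have e: "rear \<inter> {y<..} = {}" "front \<inter> {y<..} = {}" and "rear \<inter> {..y} = rear"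
        using False by (auto simp: not_less)
      then have "sum depth (rear \<inter> {..y}) + card (front \<inter> {..y}) + ?k \<le> y + 1"
        using lower_count(2)[of y] ne by argo
      moreover have "length ?q = y + 2" using h1 by simp
      ultimately show ?thesis using tip_degree split unfolding e by simp
    qed
    ultimately show ?thesis using that[of ?q] Hd by auto
  next
    case True
    define w where "w = (LEAST i. i \<in> front \<union> rear \<and> y < i)"
    have w: "w \<in> front \<union> rear" "y < w" using LeastI_ex[OF True] by (auto simp: w_def)
    have wl: "w \<le> i" if "i \<in> front \<union> rear" "y < i" for i
      unfolding w_def using that by (intro Least_le) auto
    have wh: "w < h" using w by (auto simp: front_def rear_def)
    note up = upper_count[of w y, OF less_imp_le[OF wh] wl]
    note lo = lower_count[of y]
    show ?thesis
    proof (cases "w \<in> rear")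
      case wr: True
      note c = climb0[OF T0 wr]
      let ?R = "rev (T 0 @ ladder w)"
      have ne': "T 0 @ ladder w \<noteq> []" using T0 by simp
      have R: "gpath E K ?R" using c(1) gpath_rev[OF sym] by blast
      have "set ?R \<inter> set H = {}" using c(3) by (simp only: set_rev)
      moreover have "E (H ! w) (hd ?R)" unfolding hd_rev by (rule E_sym[THEN iffD1, OF c(2)])
      moreover have "E (last ?R) (H ! 0)"
        unfolding last_rev c(5) by (rule E_sym[THEN iffD1, OF tail0(2)[OF T0]])
      ultimately have s: "gpath E K (rev (drop w H) @ ?R @ take (Suc y) H)"
        "hd (rev (drop w H) @ ?R @ take (Suc y) H) = H ! (h - 1)"
        "last (rev (drop w H) @ ?R @ take (Suc y) H) = H ! y"
        "length (rev (drop w H) @ ?R @ take (Suc y) H) = h - w + length ?R + Suc y"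
        "set (rev (drop w H) @ ?R @ take (Suc y) H) \<subseteq> set H \<union> set ?R"
        using splice[OF w(2) wh R] by blast+
      have "w + ?k + depth w \<le> h" using rear_root_gap(2)[OF T0 wr] .
      \<comment> \<open>The ladder runs on the tail at \<open>w\<close>; it misses the two forbidden
        tails because \<open>w\<close> is neither of their positions.\<close>
      then have wd: "w \<noteq> h - 1" "w \<noteq> y" using k1 depth_props(1)[OF wr] w by auto
      have "set (T w) \<inter> (set (T (h - 1)) \<union> set (T y)) = {}"
        using T_T[OF wh h1(1) wd(1)] T_T[OF wh h1(4) wd(2)] by blast
      then have "set ?R \<inter> (set (T (h - 1)) \<union> set (T y)) = {}"
        using T0d ladder_props(2)[OF wr] by auto
      moreover have "card (nb (tip 0)) + card front + 1 \<le> h - w + length ?R + Suc y"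
        using up(1) lo(1) tip_degree split c(4) depth_props(1)[OF wr] by simp
      ultimately show ?thesis using that[OF s(1-3)] s(4,5) Hd by fastforce
    next
      case wr: False
      then have wf: "w \<in> front" using w by blast
      \<comment> \<open>Only the first vertex of the tail is usable here. The missing
        \<open>length (T 0)\<close> is recovered on whichever side of \<open>y\<close> contains an
        attachment of the tip.\<close>
      let ?R = "[hd (T 0)]"
      have v: "hd (T 0) \<in> set (T 0)" using T0 by simp
      have R: "gpath E K ?R" using v T_subset[OF h1(2)] by auto
      have "set ?R \<inter> set H = {}" using v T_not_H[OF h1(2)] by auto
      moreover have "E (H ! w) (hd ?R)" using wf E_sym by (simp add: front_def)
      moreover have "E (last ?R) (H ! 0)" using tail0(2)[OF T0] E_sym by simp
      ultimately have s: "gpath E K (rev (drop w H) @ ?R @ take (Suc y) H)"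
        "hd (rev (drop w H) @ ?R @ take (Suc y) H) = H ! (h - 1)"
        "last (rev (drop w H) @ ?R @ take (Suc y) H) = H ! y"
        "length (rev (drop w H) @ ?R @ take (Suc y) H) = h - w + length ?R + Suc y"
        "set (rev (drop w H) @ ?R @ take (Suc y) H) \<subseteq> set H \<union> set ?R"
        using splice[OF w(2) wh R] by blast+
      have "set ?R \<inter> (set (T (h - 1)) \<union> set (T y)) = {}" using T0d v by auto
      moreover have "card (nb (tip 0)) + card front + 1 \<le> h - w + length ?R + Suc y"
      proof (cases "rear \<inter> {..y} = {}")
        case True
        obtain i where i: "i \<in> rear" using ne by blast
        then have "i \<notin> {..y}" using True by blast
        then have "rear \<inter> {y<..} \<noteq> {}" using i by (metis IntI atMost_iff empty_iff greaterThan_iff not_le)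
        then show ?thesis using up(2) lo(1) tip_degree split by simp
      next
        case False
        then show ?thesis using lo(2) up(1) tip_degree split by simp
      qed
      ultimately show ?thesis using that[OF s(1-3)] s(4,5) Hd by fastforce
    qed
  qed
qed

end

end

section \<open>Rotating the cycle; long connections from one slot to all others\<close>

lemma gcycle_rotate1:
  assumes "symp E" "gcycle E W C"
  shows "gcycle E W (rotate1 C)"
proof (cases C)
  case Nil
  then show ?thesis using assms by simp
next
  case (Cons x xs)
  show ?thesis
  proof (cases "xs = []")
    case True
    then show ?thesis using assms Cons by simp
  next
    case False
    have p: "gpath E W (x # xs)" "E (last xs) x" using assms Cons False by (auto simp: gcycle_def)
    then have xs: "x \<in> W" "gpath E W xs" "x \<notin> set xs" "E x (hd xs)"
      using gpath_Cons[OF False, of E W x] by auto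
    then have "gpath E W (xs @ [x])" using p by (intro gpath_join) auto
    then show ?thesis using Cons False xs by (auto simp: gcycle_def)
  qed
qed

lemma longest_rotate:
  assumes "symp E" "longest E W C"
  shows "longest E W (rotate r C)"
proof -
  have "gcycle E W (rotate r C)"
    by (induction r) (use assms gcycle_rotate1 in \<open>auto simp: longest_def\<close>)
  then show ?thesis using assms by (simp add: longest_def)
qed

lemma card_positions:
  assumes "distinct H"
  shows "card {i. i < length H \<and> P (H ! i)} = card {w \<in> set H. P w}"
proof (rule bij_betw_same_card[of "(!) H"])
  show "bij_betw ((!) H) {i. i < length H \<and> P (H ! i)} {w \<in> set H. P w}"
    using assms by (auto simp: bij_betw_def inj_on_def nth_eq_iff_index_eq in_set_conv_nth)
qed

context tailed_cycle
begin

text \<open>The two tails are split off, since they are credited separately; \<open>b\<close> then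
  measures the number of edges between the roots.\<close>

definition spread :: "nat \<Rightarrow> nat \<Rightarrow> bool" where
  "spread x b \<longleftrightarrow> (\<forall>y<h. y \<noteq> x \<longrightarrow> conn x y (length (T x) + length (T y) + b + 1))"

abbreviation hdeg :: "'v \<Rightarrow> nat" where
  "hdeg v \<equiv> card {w \<in> set H. E v w}"

text \<open>Statements about a single tail are proved at position 0; this moves them to any
  position.\<close>

lemma rotated:
  "tailed_cycle E K (rotate r H) (\<lambda>i. T ((i + r) mod h))"
proof
  have nth: "rotate r H ! i = H ! ((i + r) mod h)" if "i < h" for i
    using nth_rotate[OF that, of r] by (simp add: add.commute)
  show "symp E" "\<And>v. \<not> E v v" "finite K" by (fact sym irr finK)+
  show "longest E K (rotate r H)" by (rule longest_rotate[OF sym H])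
  show "2 \<le> length (rotate r H)" using h2 by simp
  have m: "(i + r) mod h < h" for i using H_ne by simp
  show "gpath E K (rotate r H ! i # T ((i + r) mod h))" if "i < length (rotate r H)" for i
    using T_path[OF m] nth that by simp
  show "set (T ((i + r) mod h)) \<inter> set (rotate r H) = {}" for i
    using T_H[OF m] by simp
  show "set (T ((i + r) mod h)) \<inter> set (T ((j + r) mod h)) = {}"
    if "i < length (rotate r H)" "j < length (rotate r H)" "i \<noteq> j" for i j
  proof -
    have "(i + r) mod h \<noteq> (j + r) mod h"
    proof
      assume "(i + r) mod h = (j + r) mod h"
      then obtain a b where "i + r + h * a = j + r + h * b" by (auto simp: nat_mod_eq_iff)
      then have "i mod h = j mod h" by (auto simp: nat_mod_eq_iff)
      then show False using that by simp
    qed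
    then show ?thesis using T_T[OF m m] by blast
  qed
qed

lemma rotation_index:
  assumes "r < h" "y < h"
  shows "((y + h - r) mod h + r) mod h = y" "(y + h - r) mod h < h"
    "(y + h - r) mod h = 0 \<longleftrightarrow> y = r"
proof -
  show 1: "((y + h - r) mod h + r) mod h = y"
  proof -
    have "((y + h - r) mod h + r) mod h = (y + h - r + r) mod h" by (simp add: mod_add_left_eq)
    also have "y + h - r + r = y + h" using assms by simp
    finally show ?thesis using assms by simp
  qed
  show "(y + h - r) mod h < h" using H_ne by simp
  show "(y + h - r) mod h = 0 \<longleftrightarrow> y = r"
  proof
    assume "(y + h - r) mod h = 0"
    then show "y = r" using 1 assms by simp
  qed (use assms in simp)
qed

lemma last_index:
  assumes "x < h" "r = Suc x mod h"
  shows "(h - 1 + r) mod h = x" "r < h" "r \<noteq> x"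
proof -
  have "(h - 1 + Suc x mod h) mod h = (h - 1 + Suc x) mod h" by (simp add: mod_add_right_eq)
  also have "h - 1 + Suc x = x + h" using assms by simp
  finally show "(h - 1 + r) mod h = x" using assms by simp
  show "r < h" using assms h2 by (simp add: H_ne)
  show "r \<noteq> x" using assms h2 by (cases "Suc x = h") auto
qed

lemma last_index_iff:
  assumes "x < h" "r = Suc x mod h" "y < h" "y \<noteq> x"
  shows "(y + h - r) mod h < h - 1"
proof -
  have "(y + h - r) mod h \<noteq> h - 1"
    using rotation_index(1)[of r y] last_index[OF assms(1,2)] assms by metis
  then show ?thesis using rotation_index(2)[of r y] last_index[OF assms(1,2)] assms by simp
qed

text \<open>One of the two arcs of \<open>H\<close> between the roots has at least half of the
  edges.\<close>

lemma spread_half: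
  assumes "x < h"
  shows "spread x ((h + 1) div 2)"
  unfolding spread_def
proof (intro allI impI)
  fix y assume y: "y < h" "y \<noteq> x"
  have *: "conn i j (length (T i) + length (T j) + (h + 1) div 2 + 1)" if "i < j" "j < h" for i j
  proof (cases "(h + 1) div 2 \<le> j - i")
    case True
    then show ?thesis using conn_arcs(1)[OF that] by (auto elim!: conn_mono)
  next
    case False
    then have "(h + 1) div 2 \<le> h - (j - i)" by linarith
    then show ?thesis using conn_arcs(2)[OF that] by (auto elim!: conn_mono)
  qed
  show "conn x y (length (T x) + length (T y) + (h + 1) div 2 + 1)"
  proof (cases "x < y")
    case True
    then show ?thesis using * y by blast
  next
    case False
    then have "conn y x (length (T y) + length (T x) + (h + 1) div 2 + 1)" using * y assms by auto
    then show ?thesis using conn_sym by (simp add: add.commute add.left_commute)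
  qed
qed

lemma conn_around:
  assumes "x < h" "r = Suc x mod h"
  shows "conn x r (length (T x) + length (T r) + h)"
proof (cases "Suc x = h")
  case True
  then have r: "r = 0" "x = h - 1" "0 < x" using assms h2 by auto
  then have "conn 0 x (length (T 0) + length (T x) + h)"
    using conn_arcs(1)[of 0 x] assms by (auto elim!: conn_mono)
  then show ?thesis using conn_sym r by (simp add: add.commute add.left_commute)
next
  case False
  then have "r = Suc x" "Suc x < h" using assms by auto
  then show ?thesis using conn_arcs(2)[of x "Suc x"] by (auto elim!: conn_mono)
qed

text \<open>Rotating the successor \<open>r\<close> to position 0 makes \<open>x\<close> the last
  position, where \<open>root_degree_path\<close> starts.\<close>

lemma spread_next_degree:
  assumes x: "x < h" "r = Suc x mod h"
  shows "spread x (hdeg (H ! r))"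
  unfolding spread_def
proof (intro allI impI)
  fix y assume y: "y < h" "y \<noteq> x"
  interpret R: tailed_cycle E K "rotate r H" "\<lambda>i. T ((i + r) mod h)" by (rule rotated)
  let ?y = "(y + h - r) mod h"
  note li = last_index[OF x]
  have nth: "rotate r H ! i = H ! ((i + r) mod h)" if "i < h" for i
    using nth_rotate[OF that, of r] by (simp add: add.commute)
  have "?y < length (rotate r H) - 1" using last_index_iff[OF x y] by simp
  then obtain q where q': "gpath E K q" "hd q = rotate r H ! (length (rotate r H) - 1)"
    "last q = rotate r H ! ?y" "set q \<subseteq> set (rotate r H)"
    "card {i. i < length (rotate r H) \<and> E (rotate r H ! 0) (rotate r H ! i)} + 1 \<le> length q"
    by (rule R.root_degree_path)
  note q = q'[unfolded length_rotate set_rotate]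
  have "card {i. i < h \<and> E (rotate r H ! 0) (rotate r H ! i)} = hdeg (H ! r)"
    using card_positions[of "rotate r H" "E (rotate r H ! 0)"] H_distinct nth[of 0] li h2 by (simp add: H_ne)
  moreover have "hd q = H ! x" using q(2) nth[of "h - 1"] li(1) h2 by simp
  moreover have "last q = H ! y" using q(3) nth[of ?y] rotation_index[OF li(2) y(1)] by simp
  ultimately show "conn x y (length (T x) + length (T y) + hdeg (H ! r) + 1)"
    using conn_extend_H[OF x(1) y(1) y(2)[symmetric] q(1) _ _ q(4)] q(5) by (auto elim!: conn_mono)
qed

lemma tail_tip:
  assumes r: "r < h" and Tr: "T r \<noteq> []" and nb: "nb (tip r) \<subseteq> set H \<union> (\<Union>i<h. set (T i))"
  shows "2 * hdeg (hd (T r)) \<le> h"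
    "length (T r) < card (nb (tip r)) \<Longrightarrow> 2 * card (nb (tip r)) \<le> h"
    "h < 2 * card (nb (tip r)) \<Longrightarrow> nb (tip r) \<subseteq> insert (H ! r) (set (T r))"
    "r = Suc x mod h \<Longrightarrow> x < h \<Longrightarrow> y < h \<Longrightarrow> y \<noteq> x \<Longrightarrow> y \<noteq> r \<Longrightarrow> length (T r) < card (nb (tip r)) \<Longrightarrow>
      \<exists>q. gpath E K q \<and> hd q = H ! x \<and> last q = H ! y \<and> set q \<inter> (set (T x) \<union> set (T y)) = {} \<and>
        card (nb (tip r)) + hdeg (hd (T r)) \<le> length q"
proof -
  interpret R: tailed_cycle E K "rotate r H" "\<lambda>i. T ((i + r) mod h)" by (rule rotated)
  have nth: "rotate r H ! i = H ! ((i + r) mod h)" if "i < h" for i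
    using nth_rotate[OF that, of r] by (simp add: add.commute)
  have h0: "0 < h" using h2 by linarith
  have tip: "R.tip 0 = tip r" using nth[OF h0] r by (simp add: R.tip_def tip_def)
  have T0: "T ((0 + r) mod h) \<noteq> []" using Tr r by simp
  have U: "(\<Union>i<length (rotate r H). set (T ((i + r) mod h))) = (\<Union>i<h. set (T i))"
  proof -
    have "set (T i) \<subseteq> (\<Union>i<h. set (T ((i + r) mod h)))" if "i < h" for i
      using rotation_index(1,2)[OF r that] by (metis UN_upper lessThan_iff)
    moreover have "set (T ((i + r) mod h)) \<subseteq> (\<Union>i<h. set (T i))" for i
      using h0 by (metis UN_upper lessThan_iff mod_less_divisor)
    ultimately show ?thesis by (simp add: subset_antisym UN_subset_iff)
  qed
  have nb': "nb (R.tip 0) \<subseteq> set (rotate r H) \<union> (\<Union>i<length (rotate r H). set (T ((i + r) mod h)))"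
    using nb tip unfolding U by simp
  have front: "hdeg (hd (T r)) = card R.front + 1"
  proof -
    have Tr': "E (H ! r) (hd (T r))" using T_path'[OF r Tr] by simp
    have "hdeg (hd (T r)) = card {i. i < h \<and> E (hd (T r)) (rotate r H ! i)}"
      using card_positions[of "rotate r H" "E (hd (T r))"] H_distinct by simp
    also have "{i. i < h \<and> E (hd (T r)) (rotate r H ! i)} = insert 0 R.front"
      using Tr' E_sym nth[OF h0] r h0 by (auto simp: R.front_def)
    also have "card (insert 0 R.front) = card R.front + 1"
      using R.finite_front[OF T0 nb'] by (simp add: R.front_def)
    finally show ?thesis .
  qed
  show "2 * hdeg (hd (T r)) \<le> h" using R.front_card[OF T0 nb'] front by simp
  show "2 * card (nb (tip r)) \<le> h" if d: "length (T r) < card (nb (tip r))"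
  proof -
    have "R.rear \<noteq> {}" using R.tip_degree[OF T0 nb'] d tip r by auto
    then show ?thesis using R.rear_degree[OF T0 nb'] tip by simp
  qed
  show "nb (tip r) \<subseteq> insert (H ! r) (set (T r))" if d: "h < 2 * card (nb (tip r))"
  proof -
    have e: "R.rear = {}" using R.rear_degree[OF T0 nb'] d tip by (metis length_rotate not_le)
    show ?thesis
    proof
      fix w assume w: "w \<in> nb (tip r)"
      have no: "i = 0" if "i < h" "l \<le> length (T ((i + r) mod h))"
        "w = (rotate r H ! i # T ((i + r) mod h)) ! l" for i l
        using e that w tip by (auto simp: R.rear_def R.deep_def nbrs_def)
      have "w \<in> set (rotate r H) \<or> (\<exists>i<h. w \<in> set (T ((i + r) mod h)))"
        using w nb' unfolding tip length_rotate by blast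
      then consider i where "i < h" "w = rotate r H ! i" | i where "i < h" "w \<in> set (T ((i + r) mod h))"
        by (metis in_set_conv_nth length_rotate)
      then show "w \<in> insert (H ! r) (set (T r))"
      proof cases
        case 1
        then show ?thesis using no[of i 0] nth[OF h0] r by auto
      next
        case 2
        then obtain m where "m < length (T ((i + r) mod h))" "w = T ((i + r) mod h) ! m"
          by (auto simp: in_set_conv_nth)
        then have "i = 0" using no[of i "Suc m"] 2 by simp
        then show ?thesis using 2 r by simp
      qed
    qed
  qed
  show "\<exists>q. gpath E K q \<and> hd q = H ! x \<and> last q = H ! y \<and> set q \<inter> (set (T x) \<union> set (T y)) = {} \<and>
      card (nb (tip r)) + hdeg (hd (T r)) \<le> length q"
    if x: "r = Suc x mod h" "x < h" and y: "y < h" "y \<noteq> x" "y \<noteq> r" and d: "length (T r) < card (nb (tip r))"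
  proof -
    let ?y = "(y + h - r) mod h"
    note li = last_index[OF x(2,1)] and ri = rotation_index[OF r y(1)]
    have y': "0 < ?y" "?y < length (rotate r H) - 1"
      using ri(3) y(3) last_index_iff[OF x(2,1) y(1,2)] by auto
    have d': "length (T ((0 + r) mod h)) < card (nb (R.tip 0))" using d tip r by simp
    obtain q where "gpath E K q" "hd q = rotate r H ! (h - 1)" "last q = rotate r H ! ?y"
      "set q \<inter> (set (T ((h - 1 + r) mod h)) \<union> set (T ((?y + r) mod h))) = {}"
      "card (nb (R.tip 0)) + card R.front + 1 \<le> length q"
      using R.detour_path[OF T0 nb' d' y'] by (metis length_rotate)
    then show ?thesis
      using nth[of "h - 1"] nth[of ?y] li(1) ri(1,2) h0 front tip by (intro exI[of _ q]) simp
  qed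
qed

lemma spread_next_tail:
  assumes x: "x < h" "r = Suc x mod h" and Tr: "T r \<noteq> []"
    and nb: "nb (tip r) \<subseteq> set H \<union> (\<Union>i<h. set (T i))"
    and d: "length (T r) < card (nb (tip r))"
  shows "spread x (card (nb (tip r)) + hdeg (hd (T r)) - 1)"
  unfolding spread_def
proof (intro allI impI)
  fix y assume y: "y < h" "y \<noteq> x"
  note li = last_index[OF x]
  note tt = tail_tip[OF li(2) Tr nb]
  show "conn x y (length (T x) + length (T y) + (card (nb (tip r)) + hdeg (hd (T r)) - 1) + 1)"
  proof (cases "y = r")
    case True
    \<comment> \<open>The detour uses up the tail at \<open>r\<close>, so this tip is reached around
      \<open>H\<close> instead; that suffices because both degrees involved are at most
      \<open>h / 2\<close>.\<close>
    then show ?thesis using conn_around[OF x] tt(1) tt(2)[OF d] h2 by (auto elim!: conn_mono)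
  next
    case False
    then obtain q where q: "gpath E K q" "hd q = H ! x" "last q = H ! y"
      "set q \<inter> (set (T x) \<union> set (T y)) = {}" "card (nb (tip r)) + hdeg (hd (T r)) \<le> length q"
      using tt(4)[OF x(2,1) y False d] by blast
    then show ?thesis
      using conn_extend[OF x(1) y(1) y(2)[symmetric] q(1-3)] d by (auto simp: Int_Un_distrib elim!: conn_mono)
  qed
qed

text \<open>A bare successor \<open>r\<close> that is adjacent to the first vertex of the tail at
  \<open>j\<close> can borrow this tail: moving it to \<open>r\<close> gives a tailed cycle with the
  same tail vertices, in which \<open>tip j\<close> is the tip of \<open>r\<close>. Then the
  argument of \<open>spread_next_tail\<close> applies.\<close>

lemma spread_next_shared_tail:
  assumes x: "x < h" "r = Suc x mod h" and Tr: "T r = []"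
    and j: "j < h" "T j \<noteq> []" "E (H ! r) (hd (T j))"
    and nb: "nb (tip j) \<subseteq> set H \<union> (\<Union>i<h. set (T i))"
    and d: "length (T j) < card (nb (tip j))"
  shows "spread x (card (nb (tip j)) + hdeg (hd (T j)) - 1)"
proof -
  note li = last_index[OF x]
  let ?T = "T(r := T j, j := [])"
  have rj: "r \<noteq> j" using Tr j by auto
  have Tj: "gpath E K (T j)" "E (H ! j) (hd (T j))" using T_path'[OF j(1,2)] by auto
  have v: "hd (T j) \<in> set (T j)" using j by simp
  interpret S: tailed_cycle E K H ?T
  proof
    show "symp E" "\<And>v. \<not> E v v" "finite K" "longest E K H" "2 \<le> h" by (fact sym irr finK H h2)+
    show "gpath E K (H ! i # ?T i)" if "i < h" for i
    proof (cases "i = r")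
      case True
      have "H ! r \<notin> set (T j)" using T_H[OF j(1)] li(2) by (meson disjoint_iff nth_mem)
      then have "gpath E K (H ! r # T j)"
        using gpath_Cons[OF j(2), of E K "H ! r"] Tj j(3) nth_in_K[OF li(2)] by simp
      then show ?thesis using True rj by simp
    next
      case False
      then show ?thesis using T_path[OF that] nth_in_K[OF that] by (cases "i = j") auto
    qed
    show "set (?T i) \<inter> set H = {}" if "i < h" for i
      using T_H[OF that] T_H[OF j(1)] by simp
    show "set (?T i) \<inter> set (?T i') = {}" if "i < h" "i' < h" "i \<noteq> i'" for i i'
      using T_T[OF that] T_T[OF j(1) that(2)] T_T[OF that(1) j(1)] that(3) by auto
  qed
  have tip: "S.tip r = tip j" using j rj by (simp add: S.tip_def tip_def)
  have sub: "(\<Union>i<h. set (T i)) \<subseteq> (\<Union>i<h. set (?T i))"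
  proof
    fix w assume "w \<in> (\<Union>i<h. set (T i))"
    then obtain i where i: "i < h" "w \<in> set (T i)" by blast
    show "w \<in> (\<Union>i<h. set (?T i))"
    proof (cases "i = j")
      case True
      then have "w \<in> set (?T r)" using i rj by simp
      then show ?thesis using li(2) by blast
    next
      case False
      then have "w \<in> set (?T i)" using i Tr by (cases "i = r") auto
      then show ?thesis using i by blast
    qed
  qed
  have nb': "nb (S.tip r) \<subseteq> set H \<union> (\<Union>i<h. set (?T i))"
    unfolding tip by (rule order_trans[OF nb Un_mono[OF order_refl sub]])
  have Tr': "?T r \<noteq> []" "?T r = T j" using j rj by auto
  have d': "length (?T r) < card (nb (S.tip r))" using d tip Tr' by simp
  \<comment> \<open>\<open>hd (T j)\<close> is adjacent to \<open>H ! r\<close> and to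
    \<open>H ! j\<close>; these cannot be consecutive on a longest cycle.\<close>
  have xj: "x \<noteq> j"
  proof
    assume xj: "x = j"
    have "gpath E K [hd (T j)]" using v T_subset[OF j(1)] by auto
    moreover have "set [hd (T j)] \<inter> set H = {}" using v T_not_H[OF j(1)] by auto
    ultimately have "2 \<le> \<bar>int r - int j\<bar>" "2 \<le> int h - \<bar>int r - int j\<bar>"
      using gap[of "[hd (T j)]" r j] rj li(2) j Tj E_sym by auto
    then show False using xj x j by (cases "Suc x = h") auto
  qed
  note tt = S.tail_tip[OF li(2) Tr'(1) nb']
  show ?thesis
    unfolding spread_def
  proof (intro allI impI)
    fix y assume y: "y < h" "y \<noteq> x"
    have b: "card (nb (tip j)) + hdeg (hd (T j)) \<le> h"
      using tt(1) tt(2)[OF d'] Tr' tip by simp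
    show "conn x y (length (T x) + length (T y) + (card (nb (tip j)) + hdeg (hd (T j)) - 1) + 1)"
    proof (cases "y = r")
      case True
      then show ?thesis using conn_around[OF x] b h2 by (auto elim!: conn_mono)
    next
      case yr: False
      show ?thesis
      proof (cases "y = j")
        case True
        have "S.tip x = tip x" using xj li(3) by (simp add: S.tip_def tip_def)
        moreover have "S.conn x r (length (?T x) + length (?T r) + h)" by (rule S.conn_around[OF x])
        ultimately have "conn x j (length (?T x) + length (?T r) + h)"
          unfolding S.conn_def conn_def tip by simp
        then show ?thesis using True b h2 xj li(3) rj by (auto elim!: conn_mono)
      next
        case False
        have "\<exists>q. gpath E K q \<and> hd q = H ! x \<and> last q = H ! y \<and> set q \<inter> (set (T x) \<union> set (T y)) = {} \<and>
          card (nb (tip j)) + hdeg (hd (T j)) \<le> length q"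
          using tt(4)[OF x(2,1) y yr d'] False yr xj li(3) rj tip Tr' by simp
        then obtain q where q: "gpath E K q" "hd q = H ! x" "last q = H ! y"
          "set q \<inter> (set (T x) \<union> set (T y)) = {}" "card (nb (tip j)) + hdeg (hd (T j)) \<le> length q"
          by blast
        then show ?thesis
          using conn_extend[OF x(1) y(1) y(2)[symmetric] q(1-3)] d by (auto simp: Int_Un_distrib elim!: conn_mono)
      qed
    qed
  qed
qed

end

section \<open>Optimal tails\<close>

text \<open>The first condition covers every ordering of the vertices of a tail as a path from its
  root: such reorderings compete in the optimisation and are needed for the rotations of a heavy
  tail.\<close>

locale optimal_tails = tailed_cycle +
  assumes max_tip: "\<And>i p. i < length H \<Longrightarrow> T i \<noteq> [] \<Longrightarrow> gpath E K (H ! i # p) \<Longrightarrow> set p = set (T i) \<Longrightarrow>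
      nbrs E K (last p) \<subseteq> set H \<union> (\<Union>i<length H. set (T i)) \<and>
      card (nbrs E K (last (H ! i # T i))) \<le> card (nbrs E K (last p))"
    and bare_nb: "\<And>i. i < length H \<Longrightarrow> T i = [] \<Longrightarrow>
      nbrs E K (H ! i) \<subseteq> set H \<union> {hd (T j) | j. j < length H \<and> T j \<noteq> []}"

text \<open>The extra 1 for a nonempty tail rewards cutting a tail in two and hanging the second
  piece on a bare vertex, although no vertex is gained.\<close>

definition tail_score :: "nat \<Rightarrow> (nat \<Rightarrow> 'v list) \<Rightarrow> nat" where
  "tail_score n T = (\<Sum>i<n. length (T i) + (if T i = [] then 0 else 1))"

lemma tail_score_upd:
  fixes T :: "nat \<Rightarrow> 'v list"
  assumes "i < n"
  shows "tail_score n (T(i := p)) + length (T i) + (if T i = [] then 0 else 1)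
    = tail_score n T + length p + (if p = [] then 0 else 1)"
proof -
  have *: "tail_score n T' = length (T' i) + (if T' i = [] then 0 else 1) +
    (\<Sum>j\<in>{..<n} - {i}. length (T' j) + (if T' j = [] then 0 else 1))" for T' :: "nat \<Rightarrow> 'v list"
    unfolding tail_score_def using assms by (subst sum.remove[of _ i]) auto
  have "(\<Sum>j\<in>{..<n} - {i}. length ((T(i := p)) j) + (if (T(i := p)) j = [] then 0 else 1)) =
    (\<Sum>j\<in>{..<n} - {i}. length (T j) + (if T j = [] then 0 else 1))"
    by (rule sum.cong) auto
  then show ?thesis using *[of T] *[of "T(i := p)"] by simp
qed

section \<open>Exchanging and cutting tails\<close>

context tailed_cycle
begin

lemma replace_tail:
  assumes i: "i < h" and p: "gpath E K (H ! i # p)" "set p \<inter> set H = {}"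
    "\<And>j. j < h \<Longrightarrow> j \<noteq> i \<Longrightarrow> set p \<inter> set (T j) = {}"
  shows "tailed_cycle E K H (T(i := p))"
proof
  show "symp E" "\<And>v. \<not> E v v" "finite K" "longest E K H" "2 \<le> h" by (fact sym irr finK H h2)+
  show "gpath E K (H ! j # (T(i := p)) j)" if "j < h" for j
    using T_path[OF that] p by simp
  show "set ((T(i := p)) j) \<inter> set H = {}" if "j < h" for j
    using T_H[OF that] p by simp
  show "set ((T(i := p)) j) \<inter> set ((T(i := p)) j') = {}" if "j < h" "j' < h" "j \<noteq> j'" for j j'
    using T_T[OF that] p(3)[of j] p(3)[of j'] that by auto
qed

lemma tail_score_le: "tail_score h T \<le> 2 * card K"
proof -
  have d: "distinct (T i)" if "i < h" for i using T_path[OF that] gpath_distinct by fastforce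
  have "tail_score h T \<le> (\<Sum>i<h. 2 * card (set (T i)))"
    unfolding tail_score_def
  proof (rule sum_mono)
    fix i assume "i \<in> {..<h}"
    then have "length (T i) = card (set (T i))" using d distinct_card by force
    then show "length (T i) + (if T i = [] then 0 else 1) \<le> 2 * card (set (T i))"
      by (cases "T i") auto
  qed
  also have "\<dots> = 2 * card (\<Union>i<h. set (T i))"
    by (subst card_UN_disjoint) (auto simp: sum_distrib_left dest: T_T)
  also have "\<dots> \<le> 2 * card K"
    using T_subset finK by (auto intro!: card_mono)
  finally show ?thesis .
qed

text \<open>Because of \<open>0 < m\<close> the donor keeps a nonempty tail. For the same reason
  optimality cannot exclude adjacency of bare vertices to the first vertices of tails.\<close>

lemma steal_tail:
  assumes ij: "i < h" "j < h" "T i = []" and m: "0 < m" "m < length (T j)" and e: "E (H ! i) (T j ! m)"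
  shows "tailed_cycle E K H (T(j := take m (T j), i := drop m (T j)))"
    "tail_score h (T(j := take m (T j), i := drop m (T j))) = Suc (tail_score h T)"
proof -
  have Tj: "T j \<noteq> []" and neq: "i \<noteq> j" using m ij by auto
  note tp = T_path'[OF ij(2) Tj]
  have dj: "distinct (T j)" using tp gpath_distinct by blast
  have tk: "take m (T j) \<noteq> []" "hd (take m (T j)) = hd (T j)" using m Tj by auto
  have "gpath E K (H ! j # take m (T j))"
    using gpath_takeI[OF T_path[OF ij(2)], of "Suc m"] by simp
  then have "tailed_cycle E K H (T(j := take m (T j)))"
  proof (rule replace_tail[OF ij(2)])
    show "set (take m (T j)) \<inter> set H = {}" using T_H[OF ij(2)] set_take_subset[of m "T j"] by auto
    show "set (take m (T j)) \<inter> set (T l) = {}" if "l < h" "l \<noteq> j" for l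
      using T_T[OF ij(2) that(1)] that(2) set_take_subset[of m "T j"] by auto
  qed
  then interpret S: tailed_cycle E K H "T(j := take m (T j))" .
  have "hd (drop m (T j)) = T j ! m" using m by (simp add: hd_drop_conv_nth)
  moreover have "gpath E K (drop m (T j))" using tp m gpath_dropI by blast
  moreover have "H ! i \<notin> set (drop m (T j))"
    using T_H[OF ij(2)] ij(1) set_drop_subset[of m "T j"] by (meson disjoint_iff nth_mem subsetD)
  ultimately have "gpath E K (H ! i # drop m (T j))"
    using gpath_Cons[of "drop m (T j)" E K "H ! i"] m e nth_in_K[OF ij(1)] by auto
  then show "tailed_cycle E K H (T(j := take m (T j), i := drop m (T j)))"
  proof (rule S.replace_tail[OF ij(1)])
    show "set (drop m (T j)) \<inter> set H = {}" using T_H[OF ij(2)] set_drop_subset[of m "T j"] by auto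
    show "set (drop m (T j)) \<inter> set ((T(j := take m (T j))) l) = {}" if "l < h" "l \<noteq> i" for l
      using T_T[OF ij(2) that(1)] set_drop_subset[of m "T j"] set_take_drop_disjoint[OF dj, of m m]
      by (auto simp: Int_commute)
  qed
  show "tail_score h (T(j := take m (T j), i := drop m (T j))) = Suc (tail_score h T)"
    using tail_score_upd[OF ij(1), of "T(j := take m (T j))" "drop m (T j)"]
      tail_score_upd[OF ij(2), of T "take m (T j)"] neq ij(3) m Tj by simp
qed

end

text \<open>
  Maximality of \<open>tail_score\<close> confines the neighbours of the tips; among the maximal choices, the
  sum of the tip degrees is minimised.
\<close>

lemma optimal_tails_exist:
  assumes T0: "tailed_cycle E K H T0" and q: "\<And>i. i \<in> q \<Longrightarrow> i < length H \<and> T0 i \<noteq> []"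
  obtains T where "optimal_tails E K H T" "\<And>i. i \<in> q \<Longrightarrow> T i \<noteq> []"
proof -
  let ?h = "length H"
  \<comment> \<open>The slots in \<open>q\<close> have to stay tailed: in \<open>fan_tails\<close>
    they are those whose Menger path has inner vertices, so that their root may have no neighbour on
    \<open>C\<close>.\<close>
  define valid where "valid T \<longleftrightarrow> tailed_cycle E K H T \<and> (\<forall>i\<in>q. T i \<noteq> [])" for T
  have "valid T0" using T0 q by (auto simp: valid_def)
  moreover have "\<forall>T. valid T \<longrightarrow> tail_score ?h T < 2 * card K + 1"
    using tailed_cycle.tail_score_le by (fastforce simp: valid_def less_Suc_eq_le)
  ultimately obtain T1 where T1: "valid T1" "\<And>T. valid T \<Longrightarrow> tail_score ?h T \<le> tail_score ?h T1"
    using ex_has_greatest_nat[of valid T0 "tail_score ?h"] by metis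
  define best where "best T \<longleftrightarrow> valid T \<and> tail_score ?h T = tail_score ?h T1" for T
  let ?deg = "\<lambda>T. \<Sum>i<?h. card (nbrs E K (last (H ! i # T i)))"
  have "best T1" using T1 by (simp add: best_def)
  then obtain T where T: "best T" "\<And>T'. best T' \<Longrightarrow> ?deg T \<le> ?deg T'"
    using ex_has_least_nat[of best T1 ?deg] by blast
  have max: "tail_score ?h T' \<le> tail_score ?h T" if "valid T'" for T'
    using T(1) T1(2)[OF that] by (simp add: best_def)
  have vT: "valid T" using T(1) by (simp add: best_def)
  interpret tailed_cycle E K H T using vT by (simp add: valid_def)
  have Tq: "T i \<noteq> []" if "i \<in> q" for i using vT that by (simp add: valid_def)
  have ham: "tailed_cycle E K H (T(i := p))" "length p = length (T i)" "p \<noteq> []"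
    if i: "i < h" "T i \<noteq> []" and p: "gpath E K (H ! i # p)" "set p = set (T i)" for i p
  proof -
    show "tailed_cycle E K H (T(i := p))"
      using replace_tail[OF i(1) p(1)] p(2) T_H[OF i(1)] T_T[OF i(1)] by auto
    have "distinct p" "distinct (T i)"
      using p(1) T_path[OF i(1)] gpath_distinct by fastforce+
    then show "length p = length (T i)" using p(2) distinct_card by metis
    show "p \<noteq> []" using p i by auto
  qed
  have "optimal_tails E K H T"
  proof unfold_locales
    fix i p assume i: "i < h" "T i \<noteq> []" and p: "gpath E K (H ! i # p)" "set p = set (T i)"
    note hm = ham[OF i p]
    show "nbrs E K (last p) \<subseteq> set H \<union> (\<Union>i<h. set (T i)) \<and>
      card (nbrs E K (last (H ! i # T i))) \<le> card (nbrs E K (last p))"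
    proof
      show "nbrs E K (last p) \<subseteq> set H \<union> (\<Union>i<h. set (T i))"
      proof (rule ccontr)
        assume "\<not> ?thesis"
        then obtain w where w: "w \<in> K" "E (last p) w" "w \<notin> set H" "\<And>i. i < h \<Longrightarrow> w \<notin> set (T i)"
          by (auto simp: nbrs_def)
        have "H ! i \<noteq> w" using w(3) i(1) by auto
        then have "gpath E K ((H ! i # p) @ [w])"
          using p hm(3) w i by (intro gpath_join) auto
        then have "tailed_cycle E K H (T(i := p @ [w]))"
          using replace_tail[of i "p @ [w]"] i p(2) w(3,4) T_H[OF i(1)] T_T[OF i(1)] by auto
        then have "valid (T(i := p @ [w]))" using Tq by (simp add: valid_def)
        then show False using max tail_score_upd[OF i(1), of T "p @ [w]"] hm i by fastforce
      qed
      have "valid (T(i := p))" using hm Tq by (simp add: valid_def)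
      moreover have "tail_score h (T(i := p)) = tail_score h T"
        using tail_score_upd[OF i(1), of T p] hm i by simp
      ultimately have "best (T(i := p))" using T(1) by (simp add: best_def)
      then have "?deg T \<le> ?deg (T(i := p))" by (rule T(2))
      moreover have "?deg T = card (nbrs E K (last (H ! i # T i))) +
          (\<Sum>j\<in>{..<h} - {i}. card (nbrs E K (last (H ! j # T j))))"
        using i(1) by (subst sum.remove[of _ i]) auto
      moreover have "?deg (T(i := p)) = card (nbrs E K (last p)) +
          (\<Sum>j\<in>{..<h} - {i}. card (nbrs E K (last (H ! j # T j))))"
        using i(1) hm(3) by (subst sum.remove[of _ i]) (auto intro!: sum.cong)
      ultimately show "card (nbrs E K (last (H ! i # T i))) \<le> card (nbrs E K (last p))" by simp
    qed
  next
    fix i assume i: "i < h" "T i = []"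
    show "nbrs E K (H ! i) \<subseteq> set H \<union> {hd (T j) | j. j < h \<and> T j \<noteq> []}"
    proof (rule ccontr)
      assume "\<not> ?thesis"
      then obtain w where w: "w \<in> K" "E (H ! i) w" "w \<notin> set H"
        "\<And>j. j < h \<Longrightarrow> T j \<noteq> [] \<Longrightarrow> w \<noteq> hd (T j)" by (auto simp: nbrs_def)
      show False
      proof (cases "\<exists>j<h. w \<in> set (T j)")
        case True
        then obtain j m where j: "j < h" "m < length (T j)" "w = T j ! m" by (auto simp: in_set_conv_nth)
        then have m: "0 < m" using w(4)[of j] by (cases m) (auto simp: hd_conv_nth)
        have e: "E (H ! i) (T j ! m)" using w j by simp
        note st = steal_tail[OF i(1) j(1) i(2) m j(2) e]
        have "valid (T(j := take m (T j), i := drop m (T j)))"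
          using st(1) Tq m j(2) i(2) by (auto simp: valid_def)
        then show False using max st(2) by fastforce
      next
        case False
        have "H ! i \<noteq> w" using w(3) i(1) by auto
        then have "tailed_cycle E K H (T(i := [w]))"
          using w False i nth_in_K[OF i(1)] by (intro replace_tail) (auto simp: gpath_Cons)
        then have "valid (T(i := [w]))" using Tq i by (auto simp: valid_def)
        then show False using max tail_score_upd[OF i(1), of T "[w]"] i by fastforce
      qed
    qed
  qed
  then show thesis using that Tq by blast
qed

context optimal_tails
begin

lemma tip_nb: "i < h \<Longrightarrow> T i \<noteq> [] \<Longrightarrow> nb (tip i) \<subseteq> set H \<union> (\<Union>i<h. set (T i))"
  using max_tip[of i "T i"] T_path[of i] by (simp add: tip_def)

abbreviation tailed :: "nat set" where "tailed \<equiv> {i. i < h \<and> T i \<noteq> []}"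
abbreviation bare :: "nat set" where "bare \<equiv> {i. i < h \<and> T i = []}"

definition taps :: "nat \<Rightarrow> nat set" where
  "taps u = {j \<in> tailed. E (H ! u) (hd (T j))}"

lemma tip_bare: "T i = [] \<Longrightarrow> tip i = H ! i" by (simp add: tip_def)

lemma hdeg_less: "u < h \<Longrightarrow> hdeg (H ! u) + 1 \<le> h"
proof -
  assume u: "u < h"
  have "{w \<in> set H. E (H ! u) w} \<subseteq> set H - {H ! u}" using irr by auto
  then have "hdeg (H ! u) \<le> card (set H - {H ! u})" by (intro card_mono) auto
  also have "\<dots> = h - 1" using u H_distinct by (simp add: distinct_card)
  finally show ?thesis using u by simp
qed

lemma bare_degree:
  assumes "u \<in> bare"
  shows "card (nb (tip u)) \<le> hdeg (H ! u) + card (taps u)"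
proof -
  have "nb (H ! u) \<subseteq> {w \<in> set H. E (H ! u) w} \<union> (\<lambda>j. hd (T j)) ` taps u"
    using bare_nb[of u] assms by (auto simp: nbrs_def taps_def)
  then have "card (nb (H ! u)) \<le> card ({w \<in> set H. E (H ! u) w} \<union> (\<lambda>j. hd (T j)) ` taps u)"
    by (intro card_mono) (auto simp: taps_def)
  also have "\<dots> \<le> hdeg (H ! u) + card ((\<lambda>j. hd (T j)) ` taps u)" by (rule card_Un_le)
  also have "\<dots> \<le> hdeg (H ! u) + card (taps u)" by (simp add: card_image_le taps_def)
  finally show ?thesis using assms by (simp add: tip_bare)
qed

lemma taps_double_count:
  assumes "U \<subseteq> bare"
  shows "(\<Sum>u\<in>U. card (taps u)) = (\<Sum>j\<in>tailed. card {u \<in> U. E (H ! u) (hd (T j))})"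
proof -
  have fU: "finite U" using assms finite_subset by fastforce
  have "(\<Sum>u\<in>U. card (taps u)) = (\<Sum>u\<in>U. \<Sum>j\<in>tailed. if E (H ! u) (hd (T j)) then 1 else 0)"
    by (intro sum.cong refl) (simp add: taps_def sum.inter_filter[symmetric])
  also have "\<dots> = (\<Sum>j\<in>tailed. \<Sum>u\<in>U. if E (H ! u) (hd (T j)) then 1 else 0)"
    by (rule sum.swap)
  also have "\<dots> = (\<Sum>j\<in>tailed. card {u \<in> U. E (H ! u) (hd (T j))})"
    using fU by (intro sum.cong refl) (simp add: sum.inter_filter[symmetric])
  finally show ?thesis .
qed

text \<open>The root \<open>H ! j\<close> is one more neighbour of \<open>hd (T j)\<close> on
  \<open>H\<close>, and it is not bare.\<close>

lemma tapped_count: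
  assumes "U \<subseteq> bare" "j \<in> tailed"
  shows "card {u \<in> U. E (H ! u) (hd (T j))} + 1 \<le> hdeg (hd (T j))"
proof -
  let ?A = "{u \<in> U. E (H ! u) (hd (T j))}"
  have fA: "finite ?A" using assms finite_subset[of ?A bare] by auto
  have jA: "j \<notin> ?A" using assms by auto
  have "insert j ?A \<subseteq> {i. i < h \<and> E (hd (T j)) (H ! i)}"
    using assms T_path'[of j] E_sym by auto
  then have "card (insert j ?A) \<le> card {i. i < h \<and> E (hd (T j)) (H ! i)}" by (intro card_mono) auto
  then show ?thesis using fA jA card_positions[OF H_distinct, of "E (hd (T j))"] by simp
qed

lemma tailed_degree:
  assumes "j \<in> tailed"
  shows "2 * hdeg (hd (T j)) \<le> h"
    "length (T j) < card (nb (tip j)) \<Longrightarrow> 2 * card (nb (tip j)) \<le> h"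
    "h < 2 * card (nb (tip j)) \<Longrightarrow> nb (tip j) \<subseteq> insert (H ! j) (set (T j))"
  using tail_tip(1-3)[of j] tip_nb[of j] assms by auto

end

section \<open>Sets with long paths between any two vertices\<close>

definition ham_path :: "('v \<Rightarrow> 'v \<Rightarrow> bool) \<Rightarrow> 'v set \<Rightarrow> 'v \<Rightarrow> 'v list \<Rightarrow> bool" where
  "ham_path E B r p \<longleftrightarrow> gpath E B p \<and> set p = B \<and> last p = r"

text \<open>Abstracts a slot whose tip has all its neighbours in the slot, with \<open>r\<close> for
  the root. The condition is imposed on the free ends of all Hamiltonian paths of \<open>B\<close>
  that end in \<open>r\<close>, so that it survives rotations.\<close>

definition end_closed :: "('v \<Rightarrow> 'v \<Rightarrow> bool) \<Rightarrow> 'v set \<Rightarrow> nat \<Rightarrow> 'v set \<Rightarrow> 'v \<Rightarrow> bool" where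
  "end_closed E K m B r \<longleftrightarrow> (\<exists>p. ham_path E B r p) \<and>
     (\<forall>p. ham_path E B r p \<longrightarrow> nbrs E K (hd p) \<subseteq> B \<and> m \<le> card (nbrs E K (hd p)))"

text \<open>\<open>B\<close> is chosen minimal. For given \<open>x\<close> and \<open>y\<close> take
  a Hamiltonian path that does not start in one of them and reaches the first of them as early as
  possible, at position \<open>i\<close>. Minimality of \<open>B\<close> provides, after a
  reordering below \<open>i\<close>, a neighbour of the start beyond \<open>i\<close>. Minimality of
  \<open>i\<close> keeps the neighbours beyond \<open>i\<close> away from certain intervals, so that
  paths jumping through them omit little.\<close>

lemma end_closed_paths:
  assumes sym: "symp E" and irr: "\<And>v. \<not> E v v" and finK: "finite K"
    and cl: "end_closed E K m B0 r0" and m: "3 \<le> m"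
  obtains B where "B \<subseteq> B0" "m + 1 \<le> card B"
    "\<And>x y. x \<in> B \<Longrightarrow> y \<in> B \<Longrightarrow> x \<noteq> y \<Longrightarrow> \<exists>q. gpath E B q \<and> hd q = x \<and> last q = y \<and> m \<le> length q"
proof -
  define P where "P B \<longleftrightarrow> B \<subseteq> B0 \<and> (\<exists>r. end_closed E K m B r)" for B
  have "P B0" using cl by (auto simp: P_def)
  then obtain B where B: "P B" "\<And>B'. P B' \<Longrightarrow> card B \<le> card B'"
    using ex_has_least_nat[of P B0 card] by blast
  obtain r where r: "end_closed E K m B r" using B(1) by (auto simp: P_def)
  have sub: "B \<subseteq> B0" using B(1) by (simp add: P_def)
  let ?N = "nbrs E K"
  have E_sym: "E u v \<longleftrightarrow> E v u" for u v using sym by (auto simp: symp_def)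
  have hp: "gpath E B p" "set p = B" "last p = r" "p \<noteq> []" "distinct p"
    "?N (hd p) \<subseteq> B" "m \<le> card (?N (hd p))" "length p = card B" if "ham_path E B r p" for p
    using that r by (auto simp: ham_path_def end_closed_def gpath_def distinct_card[symmetric])
  obtain p0 where p0: "ham_path E B r p0" using r by (auto simp: end_closed_def)
  have finB: "finite B" using hp(2)[OF p0] by (metis List.finite_set)
  define nbi where "nbi p = {n. n < length p \<and> E (p ! 0) (p ! n)}" for p
  have nbi_card: "m \<le> card (nbi p)" if p: "ham_path E B r p" for p
  proof -
    have "?N (hd p) \<subseteq> (!) p ` nbi p"
    proof
      fix w assume w: "w \<in> ?N (hd p)"
      then obtain n where "n < length p" "w = p ! n" using hp(2,6)[OF p] by (metis in_set_conv_nth subsetD)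
      then show "w \<in> (!) p ` nbi p" using w hp(4)[OF p] by (auto simp: nbi_def nbrs_def hd_conv_nth)
    qed
    then have "card (?N (hd p)) \<le> card ((!) p ` nbi p)" by (intro card_mono) (auto simp: nbi_def)
    also have "\<dots> \<le> card (nbi p)" by (intro card_image_le) (simp add: nbi_def)
    finally show ?thesis using hp(7)[OF p] by simp
  qed
  have nbi_pos: "0 < n" if "n \<in> nbi p" for n p using that irr by (cases n) (auto simp: nbi_def)
  have finN: "finite (nbi p)" for p by (simp add: nbi_def)
  have rot: "ham_path E B r (rev (take n p) @ drop n p)" if p: "ham_path E B r p" and n: "n \<in> nbi p" for p n
  proof -
    have n': "0 < n" "n < length p" "E (p ! 0) (p ! n)" using n nbi_pos by (auto simp: nbi_def)
    have "gpath E B (rev (take n p))" using hp(1)[OF p] n' gpath_rev[OF sym] gpath_takeI by metis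
    moreover have "gpath E B (drop n p)" using hp(1)[OF p] n' gpath_dropI by blast
    moreover have "E (last (rev (take n p))) (hd (drop n p))"
      using n' hp(4)[OF p] by (simp add: last_rev hd_drop_conv_nth hd_conv_nth)
    ultimately have "gpath E B (rev (take n p) @ drop n p)"
      using set_take_drop_disjoint[OF hp(5)[OF p], of n n] by (intro gpath_join) auto
    moreover have "set (rev (take n p) @ drop n p) = B"
      using hp(2)[OF p] by (metis append_take_drop_id set_append set_rev)
    ultimately show ?thesis using hp(3)[OF p] n' by (simp add: ham_path_def)
  qed
  have cardB: "m + 1 \<le> card B"
  proof -
    have "?N (hd p0) \<subseteq> B - {hd p0}" using hp(6)[OF p0] irr by (auto simp: nbrs_def)
    then have "card (?N (hd p0)) \<le> card (B - {hd p0})" using finB by (intro card_mono) auto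
    also have "\<dots> = card B - 1" using hp(2,4)[OF p0] finB by (metis card_Diff_singleton hd_in_set)
    finally show ?thesis using hp(7)[OF p0] m by simp
  qed
  have "\<exists>q. gpath E B q \<and> hd q = x \<and> last q = y \<and> m \<le> length q"
    if x: "x \<in> B" and y: "y \<in> B" and xy: "x \<noteq> y" for x y
  proof -
    define first where "first i p \<longleftrightarrow> ham_path E B r p \<and> 0 < i \<and> i < length p \<and> p ! i \<in> {x, y} \<and>
      (\<forall>l<i. p ! l \<notin> {x, y})" for i p
    have get_first: "\<exists>i. first i p" if p: "ham_path E B r p" and h: "p ! 0 \<notin> {x, y}" for p
    proof -
      have "\<exists>i. i < length p \<and> p ! i \<in> {x, y}" using x hp(2)[OF p] by (metis in_set_conv_nth insertI1)
      then obtain i where "i < length p \<and> p ! i \<in> {x, y}" "\<forall>l<i. \<not> (l < length p \<and> p ! l \<in> {x, y})"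
        using exists_least_iff[of "\<lambda>i. i < length p \<and> p ! i \<in> {x, y}"] by blast
      then have "first i p" using p h by (cases i) (auto simp: first_def)
      then show ?thesis by blast
    qed
    have "\<exists>i p. first i p"
    proof (cases "p0 ! 0 \<in> {x, y}")
      case False
      then show ?thesis using get_first p0 by blast
    next
      case True
      \<comment> \<open>Rotation at position 1 changes nothing, and rotation just behind the other
        vertex of \<open>{x, y}\<close> makes that vertex the start. These are at most two
        positions, whereas \<open>m\<close> is at least 3.\<close>
      let ?bad = "{1} \<union> Suc ` {l. l < length p0 \<and> p0 ! l \<in> {x, y} - {p0 ! 0}}"
      have "{l. l < length p0 \<and> p0 ! l \<in> {x, y} - {p0 ! 0}} \<subseteq> {l. l < length p0 \<and> p0 ! l = (if p0 ! 0 = x then y else x)}"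
        using True by auto
      then have "card {l. l < length p0 \<and> p0 ! l \<in> {x, y} - {p0 ! 0}} \<le> card {w \<in> set p0. w = (if p0 ! 0 = x then y else x)}"
        unfolding card_positions[OF hp(5)[OF p0], symmetric] by (intro card_mono) auto
      also have "\<dots> \<le> card {if p0 ! 0 = x then y else x}" by (intro card_mono) auto
      finally have "card (Suc ` {l. l < length p0 \<and> p0 ! l \<in> {x, y} - {p0 ! 0}}) \<le> 1"
        by (simp add: card_image)
      then have "card ?bad \<le> 2" using card_Un_le[of "{1}" "Suc ` {l. l < length p0 \<and> p0 ! l \<in> {x, y} - {p0 ! 0}}"] by simp
      then have "\<not> nbi p0 \<subseteq> ?bad" using nbi_card[OF p0] m card_mono[of ?bad "nbi p0"] by auto
      then obtain n where n: "n \<in> nbi p0" "n \<notin> ?bad" by blast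
      then have n2: "2 \<le> n" "n < length p0" using nbi_pos[OF n(1)] by (auto simp: nbi_def)
      have "p0 ! (n - 1) \<noteq> p0 ! 0" using hp(5)[OF p0] n2 by (subst nth_eq_iff_index_eq) auto
      have "p0 ! (n - 1) \<notin> {x, y}"
      proof
        assume "p0 ! (n - 1) \<in> {x, y}"
        then have "n - 1 \<in> {l. l < length p0 \<and> p0 ! l \<in> {x, y} - {p0 ! 0}}"
          using \<open>p0 ! (n - 1) \<noteq> p0 ! 0\<close> n2 by simp
        then have "Suc (n - 1) \<in> ?bad" by blast
        then show False using n(2) n2 by simp
      qed
      moreover have "(rev (take n p0) @ drop n p0) ! 0 = p0 ! (n - 1)"
        using n2 by (simp add: nth_append rev_nth)
      ultimately show ?thesis using get_first[OF rot[OF p0 n(1)]] by auto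
    qed
    then obtain i p1 where i: "first i p1" "\<And>i' p. first i' p \<Longrightarrow> i \<le> i'"
      using exists_least_iff[of "\<lambda>i. \<exists>p. first i p"] by (metis not_le)
    note f1 = i(1)[unfolded first_def]
    define a where "a = p1 ! i"
    define b where "b = (if a = x then y else x)"
    have ab: "{a, b} = {x, y}" "a \<noteq> b" using f1 xy by (auto simp: a_def b_def)
    have p1: "ham_path E B r p1" and i0: "0 < i" "i < length p1" using f1 by auto
    have "b \<in> set p1" using ab hp(2)[OF p1] x y by auto
    then obtain j where j: "j < length p1" "p1 ! j = b" by (metis in_set_conv_nth)
    have ij: "i < j"
    proof -
      have "j \<noteq> i" using j ab by (auto simp: a_def)
      moreover have "\<not> j < i" using f1 j ab by auto
      ultimately show ?thesis by simp
    qed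
    define p where "p = (SOME p. ham_path E B r p \<and> drop i p = drop i p1 \<and> (\<exists>n\<in>nbi p. i < n))"
    have ex: "\<exists>p. ham_path E B r p \<and> drop i p = drop i p1 \<and> (\<exists>n\<in>nbi p. i < n)"
    proof -
      let ?B = "set (take (Suc i) p1)"
      have "gpath E ?B (take (Suc i) p1)"
        using gpath_takeI[OF hp(1)[OF p1], of "Suc i"] by (simp add: gpath_def)
      moreover have "last (take (Suc i) p1) = a" using i0 by (simp add: a_def take_Suc_conv_app_nth)
      ultimately have h1: "ham_path E ?B a (take (Suc i) p1)" by (simp add: ham_path_def)
      have "card ?B = Suc i" using i0 hp(5)[OF p1] by (simp add: distinct_card)
      then have "card ?B < card B" using ij j hp(8)[OF p1] by simp
      moreover have "?B \<subseteq> B0" using set_take_subset[of "Suc i" p1] hp(2)[OF p1] sub by auto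
      \<comment> \<open>The prefix up to \<open>a\<close> is smaller than \<open>B\<close>, since
        \<open>b\<close> comes later. Ends of Hamiltonian paths of \<open>B\<close> have
        \<open>m\<close> neighbours anyway, so the only thing that can fail for the prefix is that
        all neighbours of an end lie in it.\<close>
      ultimately have "\<not> end_closed E K m ?B a" using B(2)[of ?B] by (auto simp: P_def)
      then obtain p' where p': "ham_path E ?B a p'" "\<not> (?N (hd p') \<subseteq> ?B \<and> m \<le> card (?N (hd p')))"
        using h1 by (auto simp: end_closed_def)
      have g': "gpath E ?B p'" "set p' = ?B" "last p' = a" "p' \<noteq> []"
        using p'(1) by (auto simp: ham_path_def gpath_def)
      have l': "length p' = Suc i" using g' \<open>card ?B = Suc i\<close> by (metis distinct_card gpath_distinct)
      let ?p = "p' @ drop (Suc i) p1"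
      have dne: "drop (Suc i) p1 \<noteq> []" using ij j by auto
      have "gpath E B ?p"
      proof (rule gpath_join)
        show "gpath E B p'" using g'(1) set_take_subset[of "Suc i" p1] hp(2)[OF p1] by (blast intro: gpath_mono)
        show "gpath E B (drop (Suc i) p1)" using hp(1)[OF p1] ij j by (intro gpath_dropI) auto
        show "set p' \<inter> set (drop (Suc i) p1) = {}"
          using g'(2) set_take_drop_disjoint[OF hp(5)[OF p1], of "Suc i" "Suc i"] by simp
        show "E (last p') (hd (drop (Suc i) p1))"
          using g'(3) gpath_nth[OF hp(1)[OF p1], of i] ij j by (simp add: a_def hd_drop_conv_nth)
      qed
      moreover have "set ?p = B" using g'(2) hp(2)[OF p1] by (metis append_take_drop_id set_append)
      moreover have "last ?p = r" using dne hp(3)[OF p1] by simp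
      ultimately have hp': "ham_path E B r ?p" by (simp add: ham_path_def)
      have d: "drop i ?p = drop i p1"
      proof -
        have "drop i p' = [a]"
          using l' g'(3) by (metis Cons_nth_drop_Suc drop_all last_snoc le_refl lessI append_take_drop_id)
        then show ?thesis using l' i0 by (simp add: a_def Cons_nth_drop_Suc)
      qed
      have "hd ?p = hd p'" using g' by simp
      then have "\<not> ?N (hd p') \<subseteq> ?B" using p'(2) hp(7)[OF hp'] by simp
      then obtain w where w: "w \<in> ?N (hd ?p)" "w \<notin> ?B" using \<open>hd ?p = hd p'\<close> by auto
      then have "w \<in> set ?p" using hp(2,6)[OF hp'] by auto
      then obtain n where n: "n < length ?p" "w = ?p ! n" by (metis in_set_conv_nth)
      have "i < n"
      proof (rule ccontr)
        assume "\<not> i < n"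
        then have "w \<in> set p'" using n l' by (simp add: nth_append)
        then show False using w(2) g'(2) by simp
      qed
      moreover have "n \<in> nbi ?p" using n w(1) hp(4)[OF hp'] by (simp add: nbi_def nbrs_def hd_conv_nth)
      ultimately show ?thesis using hp' d by blast
    qed
    have p: "ham_path E B r p" "drop i p = drop i p1" "\<exists>n\<in>nbi p. i < n"
      using someI_ex[OF ex] by (auto simp: p_def)
    have lp: "length p = length p1" using hp(8)[OF p(1)] hp(8)[OF p1] by simp
    have pa: "p ! i = a" "p ! j = b"
    proof -
      show "p ! i = a" using p(2) i0 lp by (metis a_def hd_drop_conv_nth)
      have "drop i p ! (j - i) = drop i p1 ! (j - i)" using p(2) by simp
      then show "p ! j = b" using ij j lp by simp
    qed
    have jl: "j < length p" using j lp by simp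
    have idx: "l = i" if "p ! l = a" "l < length p" for l
      using that pa(1) hp(5)[OF p(1)] i0 lp by (metis nth_eq_iff_index_eq)
    have idx': "l = j" if "p ! l = b" "l < length p" for l
      using that pa(2) hp(5)[OF p(1)] jl by (metis nth_eq_iff_index_eq)
    have rot_min: "i \<le> l" if n: "n \<in> nbi p" "n \<noteq> Suc i" "n \<noteq> Suc j" and l: "l < n" "p ! (n - 1 - l) \<in> {a, b}" for n l
    proof -
      have n': "0 < n" "n < length p" using n nbi_pos by (auto simp: nbi_def)
      let ?p = "rev (take n p) @ drop n p"
      have nt: "?p ! l = p ! (n - 1 - l)" if "l < n" for l
        using that n' by (simp add: nth_append rev_nth)
      have "p ! (n - 1) \<notin> {a, b}" using idx[of "n - 1"] idx'[of "n - 1"] n n' by auto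
      then have h: "?p ! 0 \<notin> {x, y}" using nt[of 0] n' ab by simp
      obtain i' where i': "first i' ?p" using get_first[OF rot[OF p(1) n(1)] h] by blast
      have "i' \<le> l"
      proof (rule ccontr)
        assume "\<not> i' \<le> l"
        then have "?p ! l \<notin> {x, y}" using i' by (auto simp: first_def)
        then show False using nt[OF l(1)] l(2) ab by simp
      qed
      then show ?thesis using i(2)[OF i'] by simp
    qed
    \<comment> \<open>Rotation at \<open>n\<close> moves \<open>a\<close> to position
      \<open>n - 1 - i\<close> and, if \<open>j < n\<close>, \<open>b\<close> to
      \<open>n - 1 - j\<close>; neither may come before \<open>i\<close>. For
      \<open>n = Suc i\<close> or \<open>n = Suc j\<close> the new start is \<open>a\<close> or
      \<open>b\<close> itself, which is why these are excluded.\<close>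
    have mid: "2 * i + 1 \<le> n" if "n \<in> nbi p" "i < n" "n \<le> j" "n \<noteq> Suc i" for n
      using rot_min[of n "n - 1 - i"] that pa by auto
    have far: "i + j + 1 \<le> n" if "n \<in> nbi p" "j < n" "n \<noteq> Suc j" for n
      using rot_min[of n "n - 1 - j"] that pa ij by auto
    define Z1 where "Z1 = nbi p \<inter> {1..i}"
    define Z2 where "Z2 = nbi p \<inter> {i<..<j}"
    define Z3 where "Z3 = nbi p \<inter> {j<..}"
    have fin: "finite Z1" "finite Z2" "finite Z3" using finN by (auto simp: Z1_def Z2_def Z3_def)
    have cZ: "m \<le> card Z1 + card Z2 + card Z3 + (if j \<in> nbi p then 1 else 0)"
    proof -
      have "nbi p \<subseteq> Z1 \<union> Z2 \<union> Z3 \<union> (if j \<in> nbi p then {j} else {})"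
      proof
        fix l assume l: "l \<in> nbi p"
        then have "0 < l" by (rule nbi_pos)
        then show "l \<in> Z1 \<union> Z2 \<union> Z3 \<union> (if j \<in> nbi p then {j} else {})"
          using l by (cases l j rule: linorder_cases) (auto simp: Z1_def Z2_def Z3_def)
      qed
      then have "card (nbi p) \<le> card (Z1 \<union> Z2 \<union> Z3 \<union> (if j \<in> nbi p then {j} else {}))"
        using fin by (intro card_mono) auto
      also have "\<dots> \<le> card Z1 + card Z2 + card Z3 + card (if j \<in> nbi p then {j} else {})"
        by (meson card_Un_le add_mono order_trans order_refl)
      finally show ?thesis using nbi_card[OF p(1)] by (auto split: if_splits)
    qed
    have Z1: "card Z1 \<le> i"
    proof -
      have "card Z1 \<le> card {1..i}" by (intro card_mono) (auto simp: Z1_def)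
      then show ?thesis by simp
    qed
    note gp = hp(1)[OF p(1)]
    have il: "i < length p" using i0 lp by simp
    have down_path: "gpath E B (rev (segment p 0 i)) \<and> hd (rev (segment p 0 i)) = a \<and> last (rev (segment p 0 i)) = p ! 0 \<and> length (rev (segment p 0 i)) = Suc i"
      using segment_props[OF gp, of 0 i] il pa gpath_rev[OF sym, of B "segment p 0 i"] by (auto simp: hd_rev last_rev)
    have disj: "set (segment p s t) \<inter> set (segment p s' t') = {}" if "t < s'" "t < length p" "t' < length p" for s t s' t'
      using segments_disjoint[OF hp(5)[OF p(1)]] that by blast
    have pathA: "\<exists>q. gpath E B q \<and> hd q = a \<and> last q = b \<and> length q = i + 1 + (j + 1 - n)"
      if n: "n \<in> nbi p" "i < n" "n \<le> j" for n
    proof -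
      note s = segment_props[OF gp n(3) jl]
      have "gpath E B (rev (segment p 0 i) @ segment p n j)"
        using down_path s n disj[OF n(2) il jl] by (intro gpath_join) (auto simp: nbi_def)
      then show ?thesis
        using down_path s pa n by (intro exI[of _ "rev (segment p 0 i) @ segment p n j"]) (auto simp: hd_append)
    qed
    have pathB: "\<exists>q. gpath E B q \<and> hd q = a \<and> last q = b \<and> length q = i + 1 + (n + 1 - j)"
      if n: "n \<in> nbi p" "j < n" for n
    proof -
      have nl: "n < length p" using n by (simp add: nbi_def)
      note s = segment_props[OF gp less_imp_le[OF n(2)] nl]
      have "gpath E B (rev (segment p 0 i) @ rev (segment p j n))"
        using down_path s n disj[OF ij il nl] gpath_rev[OF sym, of B "segment p j n"]
        by (intro gpath_join) (auto simp: nbi_def hd_rev)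
      then show ?thesis
        using down_path s pa n by (intro exI[of _ "rev (segment p 0 i) @ rev (segment p j n)"]) (auto simp: hd_append last_rev)
    qed
    have pathD: "\<exists>q. gpath E B q \<and> hd q = a \<and> last q = b \<and> length q = (n2 + 1 - i) + 1 + (n + 1 - j)"
      if n: "n2 \<in> nbi p" "i < n2" "n2 < j" "n \<in> nbi p" "j < n" for n2 n
    proof -
      have nl: "n < length p" "n2 < length p" using n by (auto simp: nbi_def)
      note s = segment_props[OF gp less_imp_le[OF n(2)] nl(2)]
      note t = segment_props[OF gp less_imp_le[OF n(5)] nl(1)]
      have h0: "p ! 0 \<in> B" using hp(2)[OF p(1)] il by (metis gr_zeroI less_nat_zero_code nth_mem)
      have z: "p ! 0 \<notin> set (segment p l u)" if "0 < l" "u < length p" for l u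
        using disj[of 0 l u 0] that segment_props(2,6)[OF gp, of 0 0] by (metis disjoint_iff hd_in_set le0 gr_implies_not_zero not_gr_zero)
      have t': "gpath E B (rev (segment p j n))" "hd (rev (segment p j n)) = p ! n" "last (rev (segment p j n)) = b"
        "rev (segment p j n) \<noteq> []" "length (rev (segment p j n)) = n + 1 - j"
        using t gpath_rev[OF sym, of B "segment p j n"] pa by (auto simp: hd_rev last_rev)
      have "gpath E B (p ! 0 # rev (segment p j n))"
        using gpath_Cons[OF t'(4), of E B "p ! 0"] t' h0 z[of j n] ij nl n by (auto simp: nbi_def)
      then have "gpath E B (segment p i n2 @ p ! 0 # rev (segment p j n))"
        using s disj[of n2 j n i] n nl z[of i n2] i0 E_sym by (intro gpath_join) (auto simp: nbi_def)
      then show ?thesis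
        using s t' pa by (intro exI[of _ "segment p i n2 @ p ! 0 # rev (segment p j n)"]) (auto simp: hd_append)
    qed
    have cov: "card Z \<le> u + 1 - l" if "Z \<subseteq> {l..u}" for Z l u
      using card_mono[OF _ that] by simp
    \<comment> \<open>Without neighbours beyond \<open>j\<close> the path descends from
      \<open>a\<close> to the start and jumps to the first neighbour after \<open>i\<close>.
      Otherwise it jumps to the last neighbour \<open>n\<close>. If there are also neighbours
      between \<open>i\<close> and \<open>j\<close>, it reaches the start through the last of them,
      and \<open>mid\<close> or \<open>far\<close> compensates for the \<open>i - 1\<close> vertices
      omitted below \<open>a\<close>.\<close>
    have "\<exists>q. gpath E B q \<and> hd q = a \<and> last q = b \<and> m \<le> length q"
    proof (cases "Z3 = {}")
      case True
      define Y where "Y = nbi p \<inter> {i<..j}"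
      have "Y \<noteq> {}" using p(3) True by (fastforce simp: Y_def Z3_def not_le)
      moreover have finY: "finite Y" using finN by (simp add: Y_def)
      ultimately have n: "Min Y \<in> Y" by simp
      have Ym: "Y \<subseteq> {Min Y..j}"
      proof
        fix l assume l: "l \<in> Y"
        then show "l \<in> {Min Y..j}" using Min_le[OF finY l] by (simp add: Y_def)
      qed
      obtain q where q: "gpath E B q" "hd q = a" "last q = b" "length q = i + 1 + (j + 1 - Min Y)"
        using pathA[of "Min Y"] n by (auto simp: Y_def)
      have "card Z2 + (if j \<in> nbi p then 1 else 0) \<le> card Y"
      proof -
        have "(if j \<in> nbi p then insert j Z2 else Z2) \<subseteq> Y" using ij by (auto simp: Y_def Z2_def)
        then have "card (if j \<in> nbi p then insert j Z2 else Z2) \<le> card Y"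
          using finN by (intro card_mono) (auto simp: Y_def)
        then show ?thesis using fin by (auto simp: Z2_def split: if_splits)
      qed
      then have "m \<le> length q" using cZ True Z1 cov[OF Ym] q(4) by simp
      then show ?thesis using q by blast
    next
      case Z3ne: False
      define n where "n = Max Z3"
      have n: "n \<in> Z3" and nM: "\<And>l. l \<in> Z3 \<Longrightarrow> l \<le> n" using Z3ne fin by (auto simp: n_def)
      have nn: "n \<in> nbi p" "j < n" using n by (auto simp: Z3_def)
      have c3: "if n = Suc j then card Z3 \<le> 1 else card Z3 + i + j \<le> n + 1"
      proof (cases "n = Suc j")
        case True
        then have "Z3 \<subseteq> {n..n}" using nM by (force simp: Z3_def)
        then show ?thesis using cov[of Z3 n n] True by simp
      next
        case False
        have s3: "Z3 \<subseteq> insert (Suc j) {i + j + 1..n}"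
        proof
          fix l assume l: "l \<in> Z3"
          then show "l \<in> insert (Suc j) {i + j + 1..n}"
            using far[of l] nM[OF l] by (cases "l = Suc j") (auto simp: Z3_def)
        qed
        have nf: "i + j + 1 \<le> n" using far nn False by blast
        have "card Z3 + i + j \<le> n + 1"
        proof -
          have "card Z3 \<le> card (insert (Suc j) {i + j + 1..n})" by (intro card_mono s3) auto
          also have "\<dots> \<le> Suc (card {i + j + 1..n})" by (rule card_insert_le_m1) auto
          finally show ?thesis using nf by simp
        qed
        then show ?thesis using False by simp
      qed
      show ?thesis
      proof (cases "Z2 = {}")
        case True
        obtain q where q: "gpath E B q" "hd q = a" "last q = b" "length q = i + 1 + (n + 1 - j)"
          using pathB[OF nn] by blast
        have "m \<le> length q"
          using cZ True Z1 c3 q(4) nn i0 by (auto split: if_splits)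
        then show ?thesis using q by blast
      next
        case False
        define n2 where "n2 = Max Z2"
        have n2: "n2 \<in> Z2" and nM2: "\<And>l. l \<in> Z2 \<Longrightarrow> l \<le> n2" using False fin by (auto simp: n2_def)
        have nn2: "n2 \<in> nbi p" "i < n2" "n2 < j" using n2 by (auto simp: Z2_def)
        have c2: "if n2 = Suc i then card Z2 \<le> 1 else card Z2 + 2 * i \<le> n2 + 1"
        proof (cases "n2 = Suc i")
          case True
          then have "Z2 \<subseteq> {n2..n2}" using nM2 by (force simp: Z2_def)
          then show ?thesis using cov[of Z2 n2 n2] True by simp
        next
          case F: False
          have s2: "Z2 \<subseteq> insert (Suc i) {2 * i + 1..n2}"
          proof
            fix l assume l: "l \<in> Z2"
            then show "l \<in> insert (Suc i) {2 * i + 1..n2}"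
              using mid[of l] nM2[OF l] by (cases "l = Suc i") (auto simp: Z2_def)
          qed
          have nf: "2 * i + 1 \<le> n2" using mid nn2 F by auto
          have "card Z2 + 2 * i \<le> n2 + 1"
          proof -
            have "card Z2 \<le> card (insert (Suc i) {2 * i + 1..n2})" by (intro card_mono s2) auto
            also have "\<dots> \<le> Suc (card {2 * i + 1..n2})" by (rule card_insert_le_m1) auto
            finally show ?thesis using nf by simp
          qed
          then show ?thesis using F by simp
        qed
        obtain q where q: "gpath E B q" "hd q = a" "last q = b" "length q = (n2 + 1 - i) + 1 + (n + 1 - j)"
          using pathD[OF nn2 nn] by blast
        show ?thesis
        proof (cases "n2 = Suc i \<and> n = Suc j")
          case False
          then have "m \<le> length q"
            using cZ Z1 c2 c3 q(4) nn nn2 i0 by (auto split: if_splits)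
          then show ?thesis using q by blast
        next
          case True
          \<comment> \<open>Neither \<open>mid\<close> nor \<open>far\<close> helps here, but
            \<open>Z2\<close> and \<open>Z3\<close> have at most one element each, and the path to
            \<open>n2 = Suc i\<close> runs through all positions up to \<open>j\<close>.\<close>
          obtain q' where q': "gpath E B q'" "hd q' = a" "last q' = b" "length q' = i + 1 + (j + 1 - n2)"
            using pathA[OF nn2(1,2)] nn2 by auto
          have "m \<le> length q'"
            using cZ Z1 c2 c3 q'(4) nn2 True by (auto split: if_splits)
          then show ?thesis using q' by blast
        qed
      qed
    qed
    then obtain q where q: "gpath E B q" "hd q = a" "last q = b" "m \<le> length q" by blast
    show ?thesis
    proof (cases "a = x")
      case True
      then show ?thesis using q ab by (auto simp: b_def)
    next
      case False
      then have "hd (rev q) = x" "last (rev q) = y" using q ab by (auto simp: hd_rev last_rev b_def)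
      then show ?thesis using q gpath_rev[OF sym, of B q] by (metis length_rev)
    qed
  qed
  then show thesis using that[OF sub cardB] by blast
qed

section \<open>Degrees of tips and of consecutive bare vertices\<close>

context tailed_cycle
begin

text \<open>With more than \<open>h / 2\<close> neighbours, all of them in the own slot, joining the
  tip to the first of them closes a cycle through the tip and all its neighbours, and this is not
  longer than \<open>H\<close>.\<close>

lemma tip_degree_less:
  assumes r: "r < h" and Tr: "T r \<noteq> []" and nb: "nb (tip r) \<subseteq> set H \<union> (\<Union>i<h. set (T i))"
  shows "card (nb (tip r)) + 1 \<le> h"
proof (cases "h < 2 * card (nb (tip r))")
  case False
  then show ?thesis using h2 by linarith
next
  case True
  let ?P = "H ! r # T r"
  have sub: "nb (tip r) \<subseteq> set ?P" using tail_tip(3)[OF r Tr nb True] by simp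
  have ne: "nb (tip r) \<noteq> {}" using True by (intro notI) simp
  define I where "I = {s. s < length ?P \<and> E (tip r) (?P ! s)}"
  have finI: "finite I" by (simp add: I_def)
  have "I \<noteq> {}"
  proof -
    obtain w where w: "w \<in> nb (tip r)" using ne by blast
    then obtain s where "s < length ?P" "?P ! s = w" using sub by (metis in_set_conv_nth subsetD)
    then show ?thesis using w by (auto simp: I_def nbrs_def)
  qed
  then have s: "Min I \<in> I" using finI by simp
  let ?D = "drop (Min I) ?P"
  have sl: "Min I < length ?P" using s by (simp add: I_def)
  have D: "gpath E K ?D" using T_path[OF r] sl by (rule gpath_dropI)
  have "last ?D = tip r" "hd ?D = ?P ! Min I" using sl by (simp_all add: tip_def hd_drop_conv_nth del: drop_Suc_Cons)
  then have "gcycle E K ?D" using D s by (simp add: gcycle_def I_def)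
  then have len: "length ?D \<le> h" by (rule H_max)
  have "nb (tip r) \<subseteq> set ?D - {tip r}"
  proof
    fix w assume w: "w \<in> nb (tip r)"
    then obtain s' where s': "s' < length ?P" "?P ! s' = w" using sub by (metis in_set_conv_nth subsetD)
    then have "s' \<in> I" using w by (auto simp: I_def nbrs_def)
    then have "Min I \<le> s'" using finI by simp
    then have "w = ?D ! (s' - Min I)" "s' - Min I < length ?D" using s' by auto
    then have "w \<in> set ?D" using nth_mem by metis
    moreover have "w \<noteq> tip r" using w irr by (auto simp: nbrs_def)
    ultimately show "w \<in> set ?D - {tip r}" by simp
  qed
  then have "card (nb (tip r)) \<le> card (set ?D - {tip r})" by (intro card_mono) auto
  also have "\<dots> = card (set ?D) - 1"
    using \<open>last ?D = tip r\<close> D gpath_nonempty by (metis card_Diff_singleton last_in_set)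
  also have "card (set ?D) = length ?D" using D gpath_distinct distinct_card by blast
  finally have "card (nb (tip r)) \<le> length ?D - 1" .
  moreover have "0 < length ?D" using sl by simp
  ultimately show ?thesis using len by linarith
qed

text \<open>Crossing chords: \<open>v\<close>, then \<open>H ! j\<close> down to
  \<open>H ! 1\<close>, then \<open>H ! (j + 1)\<close> up to the last vertex, then
  \<open>H ! 0\<close> would be a cycle with one vertex more than \<open>H\<close>.\<close>

lemma crossing_after:
  assumes v: "v \<in> K" "v \<notin> set H" "E v (H ! 0)" "E v (H ! j)" and j: "0 < j" "j < h"
  shows "2 \<le> j" "j + 2 \<le> h" "\<not> E (H ! 1) (H ! (j + 1))"
proof -
  have "gpath E K [v]" "set [v] \<inter> set H = {}" using v by auto
  then have "1 + 1 \<le> \<bar>int 0 - int j\<bar>" "1 + 1 \<le> int h - \<bar>int 0 - int j\<bar>"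
    using gap[of "[v]" 0 j] v j E_sym H_ne by auto
  then show j2: "2 \<le> j" and jh: "j + 2 \<le> h" by auto
  show "\<not> E (H ! 1) (H ! (j + 1))"
  proof
    assume e: "E (H ! 1) (H ! (j + 1))"
    have ord: "1 \<le> j" "j + 1 \<le> h - 1" "h - 1 < h" "0 < h" using j jh by auto
    note s = segment_props[OF H_path ord(1) j(2)]
    note t = segment_props[OF H_path ord(2,3)]
    note z = segment_props[OF H_path order_refl ord(4)]
    have X1: "gpath E K (segment H (j + 1) (h - 1) @ segment H 0 0)"
      using t z H_wrap segments_disjoint[OF H_distinct, of 0 "h - 1" "j + 1"] ord
      by (intro gpath_join) auto
    have X2: "gpath E K (rev (segment H 1 j) @ segment H (j + 1) (h - 1) @ segment H 0 0)"
    proof (rule gpath_join[OF _ X1])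
      show "gpath E K (rev (segment H 1 j))" using s gpath_rev[OF sym] by blast
      show "set (rev (segment H 1 j)) \<inter> set (segment H (j + 1) (h - 1) @ segment H 0 0) = {}"
        using segments_disjoint[OF H_distinct, of j "h - 1" "j + 1"]
          segments_disjoint[OF H_distinct, of 0 j 1] ord j by auto
      show "E (last (rev (segment H 1 j))) (hd (segment H (j + 1) (h - 1) @ segment H 0 0))"
        using s t e by (simp add: last_rev)
    qed
    have "gpath E K ([v] @ rev (segment H 1 j) @ segment H (j + 1) (h - 1) @ segment H 0 0)"
      by (rule gpath_join[OF _ X2]) (use v s t z in \<open>auto simp: hd_rev\<close>)
    then have "gcycle E K ([v] @ rev (segment H 1 j) @ segment H (j + 1) (h - 1) @ segment H 0 0)"
      using z v(3) E_sym by (simp add: gcycle_def)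
    from H_max[OF this] show False using s t z jh by simp
  qed
qed

lemma crossing_before:
  assumes v: "v \<in> K" "v \<notin> set H" "E v (H ! 1)" "E v (H ! j)" and j: "j \<noteq> 1" "j < h"
  shows "3 \<le> j" "\<not> E (H ! 0) (H ! (j - 1))"
proof -
  have "gpath E K [v]" "set [v] \<inter> set H = {}" using v by auto
  then have "1 + 1 \<le> \<bar>int 1 - int j\<bar>"
    using gap[of "[v]" 1 j] v j E_sym h2 by auto
  then show j3: "3 \<le> j" using j by auto
  show "\<not> E (H ! 0) (H ! (j - 1))"
  proof
    assume e: "E (H ! 0) (H ! (j - 1))"
    have ord: "1 \<le> j - 1" "j - 1 < h" "j \<le> h - 1" "h - 1 < h" "0 < h" using j j3 by auto
    note s = segment_props[OF H_path ord(1,2)]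
    note t = segment_props[OF H_path ord(3,4)]
    note z = segment_props[OF H_path order_refl ord(5)]
    have X1: "gpath E K (segment H 0 0 @ rev (segment H 1 (j - 1)))"
      using s z e gpath_rev[OF sym, of K "segment H 1 (j - 1)"]
        segments_disjoint[OF H_distinct, of 0 "j - 1" 1] ord
      by (intro gpath_join) (auto simp: hd_rev)
    have X2: "gpath E K (segment H j (h - 1) @ segment H 0 0 @ rev (segment H 1 (j - 1)))"
    proof (rule gpath_join[OF t(1) X1])
      show "set (segment H j (h - 1)) \<inter> set (segment H 0 0 @ rev (segment H 1 (j - 1))) = {}"
        using segments_disjoint[OF H_distinct, of "j - 1" "h - 1" j]
          segments_disjoint[OF H_distinct, of 0 "h - 1" j] ord j3 by auto
      show "E (last (segment H j (h - 1))) (hd (segment H 0 0 @ rev (segment H 1 (j - 1))))"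
        using t z H_wrap by simp
    qed
    have "gpath E K ([v] @ segment H j (h - 1) @ segment H 0 0 @ rev (segment H 1 (j - 1)))"
      by (rule gpath_join[OF _ X2]) (use v s t z in auto)
    then have "gcycle E K ([v] @ segment H j (h - 1) @ segment H 0 0 @ rev (segment H 1 (j - 1)))"
      using s z v(3) E_sym by (auto simp: gcycle_def last_rev)
    from H_max[OF this] show False using s t z j3 ord by simp
  qed
qed

text \<open>Each tail tapped by one of the two vertices forbids the other one a neighbour on
  \<open>H\<close>, namely the vertex after, respectively before, the root of that tail. Different
  tails forbid different vertices, and the summand 1 is the other vertex itself.\<close>

lemma consecutive_bare:
  assumes x: "x < h" "r = Suc x mod h"
  shows "T x = [] \<Longrightarrow> hdeg (H ! r) + card {j. j < h \<and> T j \<noteq> [] \<and> E (H ! x) (hd (T j))} + 1 \<le> h"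
    "T r = [] \<Longrightarrow> hdeg (H ! x) + card {j. j < h \<and> T j \<noteq> [] \<and> E (H ! r) (hd (T j))} + 1 \<le> h"
proof -
  interpret R: tailed_cycle E K "rotate x H" "\<lambda>i. T ((i + x) mod h)" by (rule rotated)
  have nth: "rotate x H ! i = H ! ((i + x) mod h)" if "i < h" for i
    using nth_rotate[OF that, of x] by (simp add: add.commute)
  have ri: "rotate x H ! 1 = H ! r" "rotate x H ! 0 = H ! x"
    using nth[of 1] nth[of 0] x h2 H_ne by auto
  let ?s = "\<lambda>j. (j + h - x) mod h"
  have bk: "rotate x H ! ?s j = H ! j" "?s j < h" "?s j = 0 \<longleftrightarrow> j = x" if "j < h" for j
    using rotation_index[OF x(1) that] nth[of "?s j"] by auto
  have s_inj: "inj_on ?s {..<h}"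
    by (rule inj_onI) (metis lessThan_iff rotation_index(1)[OF x(1)])
  have s1: "?s j = 1 \<longleftrightarrow> j = r" if "j < h" for j
  proof
    assume "?s j = 1"
    then have "(1 + x) mod h = j" using rotation_index(1)[OF x(1) that] by simp
    then show "j = r" using x by simp
  next
    assume "j = r"
    then have "rotate x H ! ?s j = rotate x H ! 1" using bk(1)[OF that] ri by simp
    moreover have l: "?s j < length (rotate x H)" "1 < length (rotate x H)"
      using bk(2)[OF that] h2 by auto
    ultimately show "?s j = 1" using nth_eq_iff_index_eq[OF R.H_distinct l] by simp
  qed
  have tap: "hd (T j) \<in> K" "hd (T j) \<notin> set (rotate x H)" "E (hd (T j)) (rotate x H ! ?s j)"
    if "j < h" "T j \<noteq> []" for j
  proof -
    have "hd (T j) \<in> set (T j)" using that by simp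
    then show "hd (T j) \<in> K" "hd (T j) \<notin> set (rotate x H)"
      using T_subset[OF that(1)] T_not_H[OF that(1)] by auto
    show "E (hd (T j)) (rotate x H ! ?s j)"
      using T_path'[OF that] bk(1)[OF that(1)] E_sym by simp
  qed
  have count: "hdeg w + card J + 1 \<le> h"
    if w: "w \<in> set H" and g: "inj_on g J" "\<And>j. j \<in> J \<Longrightarrow> g j \<in> set H \<and> g j \<noteq> w \<and> \<not> E w (g j)" for w J and g :: "nat \<Rightarrow> 'v"
  proof -
    have "card {y \<in> set H. E w y} + card (g ` J) = card ({y \<in> set H. E w y} \<union> g ` J)"
    proof (rule card_Un_disjoint[symmetric])
      show "finite (g ` J)" by (rule finite_subset[of _ "set H"]) (use g in auto)
    qed (use g in auto)
    also have "\<dots> \<le> card (set H - {w})" by (rule card_mono) (use g irr in auto)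
    also have "\<dots> = h - 1" using w H_distinct by (simp add: distinct_card)
    finally show ?thesis using g(1) h2 by (simp add: card_image)
  qed
  have r: "r < h" using last_index[OF x] by blast
  show "hdeg (H ! r) + card {j. j < h \<and> T j \<noteq> [] \<and> E (H ! x) (hd (T j))} + 1 \<le> h" if Tx: "T x = []"
  proof (rule count[of _ "\<lambda>j. rotate x H ! (?s j + 1)"])
    let ?J = "{j. j < h \<and> T j \<noteq> [] \<and> E (H ! x) (hd (T j))}"
    have c: "2 \<le> ?s j" "?s j + 2 \<le> h" "\<not> E (H ! r) (rotate x H ! (?s j + 1))" if "j \<in> ?J" for j
    proof -
      have "0 < ?s j" using that Tx bk(3)[of j] by (metis (mono_tags, lifting) gr0I mem_Collect_eq)
      then show "2 \<le> ?s j" "?s j + 2 \<le> h" "\<not> E (H ! r) (rotate x H ! (?s j + 1))"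
        using R.crossing_after[of "hd (T j)" "?s j"] tap[of j] that bk(2)[of j] ri E_sym by auto
    qed
    show "H ! r \<in> set H" using r by simp
    show "inj_on (\<lambda>j. rotate x H ! (?s j + 1)) ?J"
    proof (rule inj_onI)
      fix j j' assume jj: "j \<in> ?J" "j' \<in> ?J" "rotate x H ! (?s j + 1) = rotate x H ! (?s j' + 1)"
      then have "?s j + 1 = ?s j' + 1"
        using R.H_distinct c(2)[OF jj(1)] c(2)[OF jj(2)] by (subst (asm) nth_eq_iff_index_eq) auto
      then show "j = j'" using s_inj jj by (auto dest: inj_onD)
    qed
    fix j assume j: "j \<in> ?J"
    have l: "?s j + 1 < length (rotate x H)" "1 < length (rotate x H)" using c(2)[OF j] h2 by auto
    have "rotate x H ! (?s j + 1) \<in> set (rotate x H)" using l by (intro nth_mem)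
    moreover have "rotate x H ! (?s j + 1) \<noteq> rotate x H ! 1"
      using R.H_distinct l c(1)[OF j] by (subst nth_eq_iff_index_eq) auto
    ultimately show "rotate x H ! (?s j + 1) \<in> set H \<and> rotate x H ! (?s j + 1) \<noteq> H ! r \<and> \<not> E (H ! r) (rotate x H ! (?s j + 1))"
      using c(3)[OF j] ri by simp
  qed
  show "hdeg (H ! x) + card {j. j < h \<and> T j \<noteq> [] \<and> E (H ! r) (hd (T j))} + 1 \<le> h" if Tr: "T r = []"
  proof (rule count[of _ "\<lambda>j. rotate x H ! (?s j - 1)"])
    let ?J = "{j. j < h \<and> T j \<noteq> [] \<and> E (H ! r) (hd (T j))}"
    have c: "3 \<le> ?s j" "\<not> E (H ! x) (rotate x H ! (?s j - 1))" if "j \<in> ?J" for j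
    proof -
      have "?s j \<noteq> 1" using that Tr s1[of j] by auto
      then show "3 \<le> ?s j" "\<not> E (H ! x) (rotate x H ! (?s j - 1))"
        using R.crossing_before[of "hd (T j)" "?s j"] tap[of j] that bk(2)[of j] ri E_sym by auto
    qed
    show "H ! x \<in> set H" using x by simp
    show "inj_on (\<lambda>j. rotate x H ! (?s j - 1)) ?J"
    proof (rule inj_onI)
      fix j j' assume jj: "j \<in> ?J" "j' \<in> ?J" "rotate x H ! (?s j - 1) = rotate x H ! (?s j' - 1)"
      have l: "?s j - 1 < length (rotate x H)" "?s j' - 1 < length (rotate x H)"
        using bk(2)[of j] bk(2)[of j'] jj by auto
      have "?s j - 1 = ?s j' - 1"
        using nth_eq_iff_index_eq[OF R.H_distinct l] jj(3) by blast
      then have "?s j = ?s j'" using c(1)[OF jj(1)] c(1)[OF jj(2)] by simp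
      then show "j = j'" using s_inj jj by (auto dest: inj_onD)
    qed
    fix j assume j: "j \<in> ?J"
    have l: "?s j - 1 < length (rotate x H)" "0 < length (rotate x H)" using bk(2)[of j] j h2 by auto
    have "rotate x H ! (?s j - 1) \<in> set (rotate x H)" using l by (intro nth_mem)
    moreover have "rotate x H ! (?s j - 1) \<noteq> rotate x H ! 0"
      using nth_eq_iff_index_eq[OF R.H_distinct l] c(1)[OF j] by auto
    ultimately show "rotate x H ! (?s j - 1) \<in> set H \<and> rotate x H ! (?s j - 1) \<noteq> H ! x \<and> \<not> E (H ! x) (rotate x H ! (?s j - 1))"
      using c(2)[OF j] ri by simp
  qed
qed

end

context optimal_tails
begin

text \<open>Two consecutive bare vertices cannot both have \<open>h\<close> or more neighbours off the long cycle.\<close>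

lemma heavy_bare_card: "2 * card {u \<in> bare. h \<le> card (nb (tip u))} \<le> h"
proof -
  let ?F = "{u \<in> bare. h \<le> card (nb (tip u))}"
  let ?s = "\<lambda>u. Suc u mod h"
  have no: "?s u \<notin> ?F" if "u \<in> ?F" for u
  proof
    assume r: "?s u \<in> ?F"
    have u: "u < h" "T u = []" using that by auto
    have t: "{j. j < h \<and> T j \<noteq> [] \<and> E (H ! w) (hd (T j))} = taps w" for w by (auto simp: taps_def)
    note cb = consecutive_bare[OF u(1) refl, unfolded t]
    have "hdeg (H ! ?s u) + card (taps u) + 1 \<le> h" using cb(1) u by simp
    moreover have "hdeg (H ! u) + card (taps (?s u)) + 1 \<le> h" using cb(2) r by simp
    moreover have "h \<le> hdeg (H ! u) + card (taps u)" "h \<le> hdeg (H ! ?s u) + card (taps (?s u))"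
      using bare_degree[of u] bare_degree[of "?s u"] that r by auto
    ultimately show False by linarith
  qed
  have inj: "inj_on ?s {..<h}"
  proof (rule inj_onI)
    fix u v assume "u \<in> {..<h}" "v \<in> {..<h}" "?s u = ?s v"
    then show "u = v" using last_index(1)[of u "?s u"] last_index(1)[of v "?s v"] by auto
  qed
  have "card (?F \<union> ?s ` ?F) = card ?F + card (?s ` ?F)"
    using no by (intro card_Un_disjoint) auto
  moreover have "card (?s ` ?F) = card ?F" by (intro card_image inj_on_subset[OF inj]) auto
  moreover have "card (?F \<union> ?s ` ?F) \<le> card {..<h}"
    using H_ne by (intro card_mono) auto
  ultimately show ?thesis by simp
qed

end

lemma set_take_Un_drop: "set (take n xs) \<union> set (drop n xs) = set xs"
  by (metis append_take_drop_id set_append)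

text \<open>Meant for intervals from \<open>a\<close> to \<open>b\<close> and from \<open>c\<close>
  to \<open>d\<close>: the distances from \<open>a\<close> to \<open>d\<close> and from
  \<open>b\<close> to \<open>c\<close> together are at least the two lengths, so one of them is at
  least half of that.\<close>

lemma larger_half:
  fixes x y :: int
  assumes "x \<le> b - a + 1" "y \<le> d - c + 1" "b - a + (d - c) \<le> u + v"
  shows "x + y + 2 \<le> 2 * (u + 2) \<or> x + y + 2 \<le> 2 * (v + 2)"
  using assms by presburger

section \<open>Attachments to the longest cycle\<close>

locale cycle_in_graph =
  fixes V :: "'v set" and E :: "'v \<Rightarrow> 'v \<Rightarrow> bool" and C :: "'v list"
  assumes finV: "finite V" and sym: "symp E" and irr: "\<And>v. \<not> E v v"
    and EV: "\<And>u v. E u v \<Longrightarrow> u \<in> V \<and> v \<in> V"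
    and C: "longest E V C"
begin

abbreviation K :: "'v set" where "K \<equiv> V - set C"
abbreviation n :: nat where "n \<equiv> length C"

definition att :: "'v \<Rightarrow> nat set" where
  "att v = {p. p < n \<and> E v (C ! p)}"

lemma E_sym: "E u v \<longleftrightarrow> E v u" using sym by (auto simp: symp_def)

lemma finK: "finite K" using finV by simp

lemma C_path: "gpath E V C" using C by (simp add: longest_def gcycle_def)

lemma C_distinct: "distinct C" using C_path gpath_distinct by blast

lemma C_subset: "set C \<subseteq> V" using C_path gpath_subset by blast

lemma finite_att [simp]: "finite (att v)" by (simp add: att_def)

lemma att_less: "att v \<subseteq> {..<n}" by (auto simp: att_def)

lemma degree_split:
  "card (nbrs E V v) = card (nbrs E K v) + card (att v)"
proof -
  have "nbrs E V v = nbrs E K v \<union> {w \<in> set C. E v w}" using C_subset by (auto simp: nbrs_def)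
  moreover have "card (nbrs E K v \<union> {w \<in> set C. E v w}) = card (nbrs E K v) + card {w \<in> set C. E v w}"
    using finV by (intro card_Un_disjoint) (auto simp: nbrs_def)
  ultimately show ?thesis
    using card_positions[OF C_distinct, of "E v"] by (simp add: att_def)
qed

lemma detour:
  assumes "gpath E K R" "p \<in> att (hd R)" "q \<in> att (last R)" "p \<noteq> q"
  shows "int (length R) + 1 \<le> \<bar>int p - int q\<bar>" "int (length R) + 1 \<le> int n - \<bar>int p - int q\<bar>"
proof -
  have "gpath E V R" using assms(1) by (rule gpath_mono) auto
  moreover have "set R \<inter> set C = {}" using assms(1) gpath_subset by fastforce
  ultimately show "int (length R) + 1 \<le> \<bar>int p - int q\<bar>" "int (length R) + 1 \<le> int n - \<bar>int p - int q\<bar>"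
    using longest_gap_abs[OF sym C, of R p q] assms E_sym by (auto simp: att_def)
qed

lemma strong_positions:
  assumes A: "A \<subseteq> {..<n}" "2 \<le> card A"
    and path: "\<And>p q. p \<in> A \<Longrightarrow> q \<in> A \<Longrightarrow> p < q \<Longrightarrow>
      \<exists>R. gpath E K R \<and> p \<in> att (hd R) \<and> q \<in> att (last R) \<and> m \<le> length R"
  shows "card A * (m + 1) \<le> n"
proof -
  have "sum (\<lambda>_. int (m + 1)) ((\<lambda>p. p) ` A) + int (card A) - int (card ((\<lambda>p. p) ` A)) \<le> int n"
  proof (rule cyclic_weights[OF A(1)])
    fix p q assume pq: "p \<in> A" "q \<in> A" "p < q"
    then obtain R where R: "gpath E K R" "p \<in> att (hd R)" "q \<in> att (last R)" "m \<le> length R"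
      using path by blast
    show "int (m + 1) + int (m + 1) \<le> 2 * (int q - int p) \<and>
        int (m + 1) + int (m + 1) \<le> 2 * (int n - (int q - int p))"
      using detour[OF R(1-3)] R(4) pq(3) by auto
  qed (use A in auto)
  then have "int (card A * (m + 1)) \<le> int n" by (simp add: algebra_simps)
  then show ?thesis by (simp only: of_nat_le_iff)
qed

text \<open>A position on \<open>C\<close> gets the weight 1 plus the number of slots attached to
  it; double counting turns the total into the left-hand side. For two positions an extreme slot of
  the one and an opposite extreme slot of the other are far enough apart on \<open>Q\<close>, by
  \<open>larger_half\<close>.\<close>

lemma slot_sum:
  assumes Q: "gpath E K Q" and S: "S \<subseteq> {..<length Q}"
    and T: "\<And>i. i \<in> S \<Longrightarrow> gpath E K (Q ! i # T i)" "\<And>i. i \<in> S \<Longrightarrow> set (T i) \<inter> set Q = {}"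
      "\<And>i j. i \<in> S \<Longrightarrow> j \<in> S \<Longrightarrow> i \<noteq> j \<Longrightarrow> set (T i) \<inter> set (T j) = {}"
    and two: "2 \<le> card (\<Union>i\<in>S. att (last (Q ! i # T i)))"
  shows "(\<Sum>i\<in>S. card (att (last (Q ! i # T i)))) + card (\<Union>i\<in>S. att (last (Q ! i # T i))) \<le> n"
proof -
  let ?tip = "\<lambda>i. last (Q ! i # T i)"
  let ?Z = "\<lambda>i. att (?tip i)"
  define A where "A = (\<Union>i\<in>S. ?Z i)"
  define I where "I p = {i \<in> S. p \<in> ?Z i}" for p
  have finS: "finite S" using S finite_subset by blast
  have finI: "finite (I p)" for p using finS by (simp add: I_def)
  have path: "\<exists>R. gpath E K R \<and> hd R = ?tip i \<and> last R = ?tip j \<and> \<bar>int i - int j\<bar> + 1 \<le> int (length R)"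
    if ij: "i \<in> S" "j \<in> S" for i j
  proof -
    have *: "\<exists>R. gpath E K R \<and> hd R = ?tip i \<and> last R = ?tip j \<and> j - i + 1 \<le> length R"
      if ij: "i \<in> S" "j \<in> S" "i < j" for i j
    proof -
      have jl: "j < length Q" using ij S by auto
      note s = segment_props[OF Q less_imp_le[OF ij(3)] jl]
      have d: "set (T i) \<inter> set (segment Q i j) = {}" "set (T j) \<inter> set (segment Q i j) = {}"
        using s(5) T(2)[OF ij(1)] T(2)[OF ij(2)] by auto
      note p = gpath_both_tails[OF sym s(1-3) T(1)[OF ij(1)] d(1) T(1)[OF ij(2)] d(2) T(3)[OF ij(1,2) less_imp_neq[OF ij(3)]]]
      show ?thesis
        by (intro exI[of _ "rev (T i) @ segment Q i j @ T j"] conjI p) (use s(4) ij(3) in simp)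
    qed
    consider "i < j" | "j < i" | "i = j" by linarith
    then show ?thesis
    proof cases
      case 1
      then obtain R where "gpath E K R" "hd R = ?tip i" "last R = ?tip j" "j - i + 1 \<le> length R"
        using *[OF ij] by blast
      then show ?thesis using 1 by (intro exI[of _ R]) auto
    next
      case 2
      then obtain R where "gpath E K R" "hd R = ?tip j" "last R = ?tip i" "i - j + 1 \<le> length R"
        using *[OF ij(2,1)] by blast
      then show ?thesis using 2 gpath_rev[OF sym, of K R] by (intro exI[of _ "rev R"]) (auto simp: hd_rev last_rev)
    next
      case 3
      have "?tip i \<in> K" using T(1)[OF ij(1)] gpath_subset gpath_nonempty by (metis last_in_set subsetD)
      then show ?thesis using 3 by (intro exI[of _ "[?tip i]"]) simp
    qed
  qed
  have "sum (\<lambda>p. int (card (I p)) + 1) ((\<lambda>p. p) ` A) + int (card A) - int (card ((\<lambda>p. p) ` A)) \<le> int n"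
  proof (rule cyclic_weights)
    show "A \<subseteq> {..<n}" using att_less by (auto simp: A_def)
    show "2 \<le> card ((\<lambda>p. p) ` A)" using two by (simp add: A_def)
    fix p q assume pq: "p \<in> A" "q \<in> A" "p < q"
    have ne: "I p \<noteq> {}" "I q \<noteq> {}" using pq by (auto simp: A_def I_def)
    define a b c d where "a = Min (I p)" "b = Max (I p)" "c = Min (I q)" "d = Max (I q)"
    have m: "a \<in> I p" "b \<in> I p" "c \<in> I q" "d \<in> I q" using finI ne by (auto simp: a_b_c_d_def)
    have "I p \<subseteq> {a..b}" "I q \<subseteq> {c..d}" using finI by (auto simp: a_b_c_d_def)
    then have "card (I p) \<le> card {a..b}" "card (I q) \<le> card {c..d}"
      by (metis card_mono finite_atLeastAtMost)+
    moreover have "a \<le> b" "c \<le> d" using finI m by (auto simp: a_b_c_d_def)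
    ultimately have cd: "int (card (I p)) \<le> int b - int a + 1" "int (card (I q)) \<le> int d - int c + 1"
      by (simp_all add: card_atLeastAtMost)
    have two_paths: "int (card (I p)) + int (card (I q)) + 2 \<le> 2 * (\<bar>int i - int j\<bar> + 2) \<Longrightarrow>
        int (card (I p)) + 1 + (int (card (I q)) + 1) \<le> 2 * (int q - int p) \<and>
        int (card (I p)) + 1 + (int (card (I q)) + 1) \<le> 2 * (int n - (int q - int p))"
      if "i \<in> I p" "j \<in> I q" for i j
    proof -
      obtain R where R: "gpath E K R" "hd R = ?tip i" "last R = ?tip j" "\<bar>int i - int j\<bar> + 1 \<le> int (length R)"
        using path[of i j] \<open>i \<in> I p\<close> \<open>j \<in> I q\<close> by (auto simp: I_def)
      show "int (card (I p)) + 1 + (int (card (I q)) + 1) \<le> 2 * (int q - int p) \<and>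
        int (card (I p)) + 1 + (int (card (I q)) + 1) \<le> 2 * (int n - (int q - int p))"
        if "int (card (I p)) + int (card (I q)) + 2 \<le> 2 * (\<bar>int i - int j\<bar> + 2)"
        using detour[OF R(1), of p q] R pq(3) \<open>i \<in> I p\<close> \<open>j \<in> I q\<close> that by (auto simp: I_def)
    qed
    have "int b - int a + (int d - int c) \<le> \<bar>int a - int d\<bar> + \<bar>int b - int c\<bar>" by linarith
    then have "int (card (I p)) + int (card (I q)) + 2 \<le> 2 * (\<bar>int a - int d\<bar> + 2) \<or>
        int (card (I p)) + int (card (I q)) + 2 \<le> 2 * (\<bar>int b - int c\<bar> + 2)"
      by (rule larger_half[OF cd])
    then consider "int (card (I p)) + int (card (I q)) + 2 \<le> 2 * (\<bar>int a - int d\<bar> + 2)"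
      | "int (card (I p)) + int (card (I q)) + 2 \<le> 2 * (\<bar>int b - int c\<bar> + 2)"
      by blast
    then show "int (card (I p)) + 1 + (int (card (I q)) + 1) \<le> 2 * (int q - int p) \<and>
        int (card (I p)) + 1 + (int (card (I q)) + 1) \<le> 2 * (int n - (int q - int p))"
      using two_paths[OF m(1,4)] two_paths[OF m(2,3)] by cases blast+
  qed auto
  then have "(\<Sum>p\<in>A. int (card (I p)) + 1) \<le> int n" by simp
  then have "(\<Sum>p\<in>A. card (I p)) + card A \<le> n"
    by (simp add: sum.distrib flip: of_nat_sum of_nat_add)
  moreover have "(\<Sum>p\<in>A. card (I p)) = (\<Sum>i\<in>S. card (?Z i))"
  proof -
    have finA: "finite A" using finS by (simp add: A_def)
    have "(\<Sum>p\<in>A. card (I p)) = (\<Sum>p\<in>A. \<Sum>i\<in>S. if p \<in> ?Z i then 1 else 0)"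
      using finS by (intro sum.cong refl) (simp add: I_def sum.inter_filter[symmetric])
    also have "\<dots> = (\<Sum>i\<in>S. \<Sum>p\<in>A. if p \<in> ?Z i then 1 else 0)" by (rule sum.swap)
    also have "\<dots> = (\<Sum>i\<in>S. card (?Z i))"
    proof (rule sum.cong[OF refl])
      fix i assume i: "i \<in> S"
      have "(\<Sum>p\<in>A. if p \<in> ?Z i then 1 else 0) = card {p \<in> A. p \<in> ?Z i}"
        using finA by (simp add: sum.inter_filter[symmetric])
      also have "{p \<in> A. p \<in> ?Z i} = ?Z i" using i by (auto simp: A_def)
      finally show "(\<Sum>p\<in>A. if p \<in> ?Z i then 1 else 0) = card (?Z i)" .
    qed
    finally show ?thesis .
  qed
  ultimately show ?thesis by (simp add: A_def)
qed

text \<open>The union of the attachments in \<open>slot_sum\<close> contributes one further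
  \<open>z\<close>: this is how \<open>h\<close> becomes \<open>h + 1\<close>.\<close>

lemma slot_bound:
  assumes Q: "gpath E K Q" and S: "S \<subseteq> {..<length Q}"
    and T: "\<And>i. i \<in> S \<Longrightarrow> gpath E K (Q ! i # T i)" "\<And>i. i \<in> S \<Longrightarrow> set (T i) \<inter> set Q = {}"
      "\<And>i j. i \<in> S \<Longrightarrow> j \<in> S \<Longrightarrow> i \<noteq> j \<Longrightarrow> set (T i) \<inter> set (T j) = {}"
    and one: "i \<in> S" "z \<le> card (att (last (Q ! i # T i)))" and z: "2 \<le> z"
    and sum: "h * z \<le> (\<Sum>i\<in>S. card (att (last (Q ! i # T i))))"
  shows "(h + 1) * z \<le> n"
proof -
  have finS: "finite S" using S finite_subset by blast
  have "card (att (last (Q ! i # T i))) \<le> card (\<Union>i\<in>S. att (last (Q ! i # T i)))"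
    using one(1) finS by (intro card_mono) auto
  then have c: "z \<le> card (\<Union>i\<in>S. att (last (Q ! i # T i)))" using one(2) by simp
  then have "(\<Sum>i\<in>S. card (att (last (Q ! i # T i)))) + card (\<Union>i\<in>S. att (last (Q ! i # T i))) \<le> n"
    using z by (intro slot_sum[OF Q S T]) auto
  then show ?thesis using c sum by simp
qed

text \<open>
  If all tips have at most \<open>h / 2\<close> neighbours outside \<open>C\<close>, the excess degrees of the bare
  vertices of \<open>H\<close> are charged to the tips. Otherwise some tip has more than \<open>h / 2\<close>
  neighbours, all on its own tail; then the rotations of that tail supply the missing tips.
\<close>

lemma longest_outside_cycle_bound:
  assumes H: "longest E K H" and hd: "length H + 1 \<le> \<delta>"
    and deg: "\<And>v. v \<in> V \<Longrightarrow> \<delta> \<le> card (nbrs E V v)"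
  shows "(length H + 1) * (\<delta> + 1 - length H) \<le> n"
proof -
  let ?h = "length H" and ?z = "\<delta> + 1 - length H"
  have Hp: "gpath E K H" using H by (simp add: longest_def gcycle_def)
  have HK: "set H \<subseteq> K" and Hne: "H \<noteq> []" using gpath_subset[OF Hp] gpath_nonempty[OF Hp] by auto
  have z2: "2 \<le> ?z" using hd by simp
  have degK: "\<delta> \<le> card (nbrs E K v) + card (att v)" if "v \<in> K" for v
    using deg[of v] degree_split[of v] that by simp
  have zdeg: "?z \<le> card (att v)" if "v \<in> K" "card (nbrs E K v) + 1 \<le> ?h" for v
    using degK[OF that(1)] that(2) by simp
  show ?thesis
  proof (cases "?h = 1")
    case True
    have h0: "H ! 0 \<in> K" using HK Hne by (simp add: subset_iff)
    have "nbrs E K (H ! 0) = {}"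
    proof (rule ccontr)
      assume "nbrs E K (H ! 0) \<noteq> {}"
      then obtain w where w: "w \<in> K" "E (H ! 0) w" by (auto simp: nbrs_def)
      then have "H ! 0 \<noteq> w" using irr by metis
      then have "gcycle E K [H ! 0, w]" using w h0 E_sym by (auto simp: gcycle_def gpath_Cons)
      then have "length [H ! 0, w] \<le> ?h" using H by (auto simp: longest_def)
      then show False using True by simp
    qed
    then have "?z \<le> card (att (H ! 0))" using zdeg[OF h0] True by simp
    then show ?thesis using slot_bound[OF Hp, of "{0}" "\<lambda>_. []" 0 ?z ?h] True z2 h0 Hne by simp
  next
    case False
    then have h2: "2 \<le> ?h" using Hne by (cases H) (auto simp: Suc_le_eq)
    have "tailed_cycle E K H (\<lambda>_. [])"
      using sym irr finK H h2 subsetD[OF HK nth_mem] by unfold_locales (auto simp: gpath_single)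
    then obtain T where "optimal_tails E K H T"
      using optimal_tails_exist[of E K H "\<lambda>_. []" "{}"] by blast
    then interpret optimal_tails E K H T .
    have tip_z: "?z \<le> card (att (tip i))" if "i < ?h" "card (nb (tip i)) + 1 \<le> ?h" for i
      using zdeg[OF tip_K[OF that(1)] that(2)] .
    show ?thesis
    proof (cases "\<exists>j\<in>tailed. ?h < 2 * card (nb (tip j))")
      case False
      \<comment> \<open>On average a tip has at most \<open>h - 1\<close> neighbours outside
        \<open>C\<close>. The taps by which a bare vertex exceeds this are charged to the tapped
        tails; they have room, as the degree of the tip and the number of neighbours of
        \<open>hd (T j)\<close> on \<open>H\<close> are at most \<open>h / 2\<close> each.\<close>
      have "(\<Sum>i<?h. card (nb (tip i))) \<le> ?h * (?h - 1)"
      proof -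
        have un: "{..<?h} = bare \<union> tailed" "bare \<inter> tailed = {}" by auto
        have "(\<Sum>u\<in>bare. card (nb (tip u))) \<le> (\<Sum>u\<in>bare. (?h - 1) + card (taps u))"
        proof (rule sum_mono)
          fix u assume u: "u \<in> bare"
          then show "card (nb (tip u)) \<le> (?h - 1) + card (taps u)"
            using bare_degree[OF u] hdeg_less[of u] by simp
        qed
        also have "\<dots> = (\<Sum>u\<in>bare. ?h - 1) + (\<Sum>u\<in>bare. card (taps u))" by (rule sum.distrib)
        also have "(\<Sum>u\<in>bare. card (taps u)) = (\<Sum>j\<in>tailed. card {u \<in> bare. E (H ! u) (hd (T j))})"
          by (rule taps_double_count) simp
        finally have 1: "(\<Sum>u\<in>bare. card (nb (tip u))) \<le>
          (\<Sum>u\<in>bare. ?h - 1) + (\<Sum>j\<in>tailed. card {u \<in> bare. E (H ! u) (hd (T j))})" .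
        have 2: "(\<Sum>j\<in>tailed. card {u \<in> bare. E (H ! u) (hd (T j))}) + (\<Sum>j\<in>tailed. card (nb (tip j))) \<le> (\<Sum>j\<in>tailed. ?h - 1)"
          unfolding sum.distrib[symmetric]
        proof (rule sum_mono)
          fix j assume j: "j \<in> tailed"
          have "card {u \<in> bare. E (H ! u) (hd (T j))} + 1 \<le> hdeg (hd (T j))"
            by (rule tapped_count[OF _ j]) simp
          moreover have "2 * hdeg (hd (T j)) \<le> ?h" by (rule tailed_degree(1)[OF j])
          moreover have "2 * card (nb (tip j)) \<le> ?h" using False j by auto
          ultimately show "card {u \<in> bare. E (H ! u) (hd (T j))} + card (nb (tip j)) \<le> ?h - 1" by linarith
        qed
        have "(\<Sum>i<?h. card (nb (tip i))) = (\<Sum>u\<in>bare. card (nb (tip u))) + (\<Sum>j\<in>tailed. card (nb (tip j)))"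
          unfolding un(1) by (rule sum.union_disjoint) auto
        also have "\<dots> \<le> (\<Sum>u\<in>bare. ?h - 1) + (\<Sum>j\<in>tailed. ?h - 1)" using 1 2 by linarith
        also have "\<dots> = (\<Sum>i<?h. ?h - 1)"
          unfolding un(1) by (rule sum.union_disjoint[symmetric]) auto
        finally show ?thesis by simp
      qed
      moreover have "?h * \<delta> \<le> (\<Sum>i<?h. card (nb (tip i))) + (\<Sum>i<?h. card (att (tip i)))"
      proof -
        have "(\<Sum>i<?h. \<delta>) \<le> (\<Sum>i<?h. card (nb (tip i)) + card (att (tip i)))"
          by (rule sum_mono) (use degK tip_K in auto)
        then show ?thesis by (simp add: sum.distrib)
      qed
      moreover have "?h * ?z + ?h * (?h - 1) = ?h * \<delta>"
      proof -
        have "?z + (?h - 1) = \<delta>" using hd h2 by simp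
        then show ?thesis by (metis add_mult_distrib2)
      qed
      ultimately have sum: "?h * ?z \<le> (\<Sum>i<?h. card (att (tip i)))" by linarith
      have "\<exists>i<?h. ?z \<le> card (att (tip i))"
      proof (rule ccontr)
        assume "\<not> ?thesis"
        then have "(\<Sum>i<?h. card (att (tip i))) < (\<Sum>i<?h. ?z)"
          using Hne by (intro sum_strict_mono) (auto simp: not_le)
        then show False using sum by simp
      qed
      then obtain i where "i < ?h" "?z \<le> card (att (tip i))" by blast
      then show ?thesis
        using slot_bound[OF Hp, of "{..<?h}" T i ?z ?h] T_path T_H T_T z2 sum by (simp add: tip_def)
    next
      case True
      then obtain j where j: "j < ?h" "T j \<noteq> []" and big: "?h < 2 * card (nb (tip j))" by auto
      have jt: "j \<in> tailed" using j by simp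
      have own: "nb (tip j) \<subseteq> set (H ! j # T j)" using tailed_degree(3)[OF jt big] by simp
      \<comment> \<open>\<open>H\<close> is opened behind \<open>H ! j\<close>, so that the heavy
        tail prolongs it to one path \<open>?Q\<close>.\<close>
      let ?H = "rotate (Suc j) H" and ?o = "\<lambda>i. (i + Suc j) mod ?h"
      have nth: "?H ! i = H ! ?o i" if "i < ?h" for i
        using nth_rotate[OF that, of "Suc j"] by (simp add: add.commute)
      have om: "?o i < ?h" for i using Hne by simp
      have o_inj: "inj_on ?o {..<?h}"
      proof (rule inj_onI)
        fix a b assume ab: "a \<in> {..<?h}" "b \<in> {..<?h}" "?o a = ?o b"
        then obtain s t where "a + Suc j + ?h * s = b + Suc j + ?h * t" by (auto simp: nat_mod_eq_iff)
        then have "a + ?h * s = b + ?h * t" by simp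
        then have "a mod ?h = b mod ?h" by (auto simp: nat_mod_eq_iff)
        then show "a = b" using ab by simp
      qed
      have oj: "?o (?h - 1) = j"
      proof -
        have "?h - 1 + Suc j = j + ?h" using h2 by simp
        then show ?thesis using j(1) by simp
      qed
      have oj': "?o i \<noteq> j" if "i < ?h - 1" for i
      proof
        assume "?o i = j"
        then have "?o i = ?o (?h - 1)" using oj by metis
        then have "i = ?h - 1" by (rule inj_onD[OF o_inj]) (use that h2 in auto)
        then show False using that by simp
      qed
      let ?Q = "?H @ T j"
      let ?T = "\<lambda>i. if i < ?h - 1 then T (?o i) else []"
      have HpR: "gpath E K ?H" using longest_rotate[OF sym H, of "Suc j"] by (simp add: longest_def gcycle_def)
      have lastH: "last ?H = H ! j" using nth[of "?h - 1"] oj Hne by (simp add: last_conv_nth)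
      have Q: "gpath E K ?Q"
        using T_path'[OF j] T_H[OF j(1)] lastH by (intro gpath_join[OF HpR]) auto
      \<comment> \<open>These bare vertices may have too few neighbours on \<open>C\<close> and are
        dropped. They number at most \<open>h / 2\<close> and are outnumbered by the slots gained on
        the heavy tail, which also replace the slot \<open>j\<close>.\<close>
      define F where "F = {u \<in> bare. ?h \<le> card (nb (tip u))}"
      have F: "2 * card F \<le> ?h" unfolding F_def by (rule heavy_bare_card)
      have finF: "finite F" by (simp add: F_def)
      define S1 where "S1 = {i. i < ?h - 1 \<and> ?o i \<notin> F}"
      \<comment> \<open>Entry \<open>l\<close> of \<open>H ! j # T j\<close> is the predecessor of
        \<open>T j ! l\<close>. If \<open>tip j\<close> is adjacent to it, reversing the rest of the
        tail makes \<open>T j ! l\<close> a tip without changing the set of tail vertices.\<close>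
      define L where "L = {l. l < length (T j) \<and> E (tip j) ((H ! j # T j) ! l)}"
      define S2 where "S2 = (\<lambda>l. ?h + l) ` L"
      have cS1: "?h - 1 \<le> card S1 + card F"
      proof -
        have "{..<?h - 1} \<subseteq> S1 \<union> {i. i < ?h - 1 \<and> ?o i \<in> F}" by (auto simp: S1_def)
        then have "card {..<?h - 1} \<le> card (S1 \<union> {i. i < ?h - 1 \<and> ?o i \<in> F})"
          by (intro card_mono) (auto simp: S1_def)
        also have "\<dots> \<le> card S1 + card {i. i < ?h - 1 \<and> ?o i \<in> F}" by (rule card_Un_le)
        also have "card {i. i < ?h - 1 \<and> ?o i \<in> F} \<le> card F"
        proof (rule card_inj_on_le)
          show "inj_on ?o {i. i < ?h - 1 \<and> ?o i \<in> F}" by (rule inj_on_subset[OF o_inj]) auto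
        qed (use finF in auto)
        finally show ?thesis by simp
      qed
      have cL: "card (nb (tip j)) \<le> card L"
      proof -
        have "nb (tip j) \<subseteq> (!) (H ! j # T j) ` L"
        proof
          fix w assume w: "w \<in> nb (tip j)"
          then obtain l where l: "l < length (H ! j # T j)" "(H ! j # T j) ! l = w"
            using own by (metis in_set_conv_nth subsetD)
          have "l \<noteq> length (T j)"
          proof
            assume "l = length (T j)"
            then have "w = tip j" using l by (metis last_conv_nth length_Cons diff_Suc_1 list.discI tip_def)
            then show False using w irr by (auto simp: nbrs_def)
          qed
          then show "w \<in> (!) (H ! j # T j) ` L" using l w by (auto simp: L_def nbrs_def)
        qed
        then have "card (nb (tip j)) \<le> card ((!) (H ! j # T j) ` L)"
          by (intro card_mono) (auto simp: L_def)
        also have "\<dots> \<le> card L" by (rule card_image_le) (simp add: L_def)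
        finally show ?thesis .
      qed
      have cS2: "card S2 = card L" unfolding S2_def by (rule card_image) simp
      have dis: "S1 \<inter> S2 = {}" by (auto simp: S1_def S2_def)
      have finS: "finite S1" "finite S2" by (auto simp: S1_def S2_def L_def)
      have S: "S1 \<union> S2 \<subseteq> {..<length ?Q}" by (auto simp: S1_def S2_def L_def)
      have cS: "?h \<le> card (S1 \<union> S2)"
        using card_Un_disjoint[OF finS dis] cS1 cS2 cL big F by linarith
      have tip1: "last (?Q ! i # ?T i) = tip (?o i)" if "i \<in> S1" for i
      proof -
        have "i < ?h" "i < ?h - 1" using that by (auto simp: S1_def)
        then show ?thesis using nth[of i] by (simp add: nth_append tip_def)
      qed
      have tip2: "last (?Q ! i # ?T i) = T j ! (i - ?h)" if "i \<in> S2" for i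
        using that by (auto simp: S2_def nth_append)
      have z1: "?z \<le> card (att (last (?Q ! i # ?T i)))" if i: "i \<in> S1" for i
      proof -
        have "card (nb (tip (?o i))) + 1 \<le> ?h"
        proof (cases "T (?o i) = []")
          case True
          then show ?thesis using i om[of i] by (auto simp: S1_def F_def not_le)
        next
          case False
          then show ?thesis using tip_degree_less[OF om False tip_nb[OF om False]] by simp
        qed
        then show ?thesis using tip_z[OF om] tip1[OF i] by simp
      qed
      have z2': "?z \<le> card (att (last (?Q ! i # ?T i)))" if i: "i \<in> S2" for i
      proof -
        obtain l where l: "l \<in> L" "i = ?h + l" using i by (auto simp: S2_def)
        then have ll: "l < length (T j)" "E (tip j) ((H ! j # T j) ! l)" by (auto simp: L_def)
        let ?p = "take l (T j) @ rev (drop l (T j))"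
        have rp: "gpath E K (rev (drop l (T j)))"
          using T_path'[OF j] ll gpath_rev[OF sym] gpath_dropI by blast
        have hr: "hd (rev (drop l (T j))) = tip j" using ll j by (simp add: hd_rev tip_def)
        have tk: "gpath E K (H ! j # take l (T j))"
          using gpath_takeI[OF T_path[OF j(1)], of "Suc l"] by simp
        have lt: "last (H ! j # take l (T j)) = (H ! j # T j) ! l"
        proof (cases l)
          case (Suc l')
          then show ?thesis using ll by (simp add: take_Suc_conv_app_nth)
        qed simp
        have dj: "distinct (H ! j # T j)" using T_path[OF j(1)] gpath_distinct by blast
        have "gpath E K ((H ! j # take l (T j)) @ rev (drop l (T j)))"
          using tk rp hr lt ll E_sym dj set_take_drop_disjoint[of "T j" l l] set_drop_subset[of l "T j"]
          by (intro gpath_join) auto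
        then have P: "gpath E K (H ! j # ?p)" by simp
        have setp: "set ?p = set (T j)" using set_take_Un_drop[of l "T j"] by simp
        have pne: "?p \<noteq> []" "last ?p = T j ! l" using ll by (auto simp: last_rev hd_drop_conv_nth)
        have rt: "tailed_cycle E K H (T(j := ?p))"
          using P setp T_H[OF j(1)] T_T[OF j(1)] by (intro replace_tail[OF j(1)]) auto
        interpret R: tailed_cycle E K H "T(j := ?p)" by (rule rt)
        have Rt: "R.tip j = T j ! l"
          unfolding R.tip_def fun_upd_same last_ConsR[OF pne(1)] by (rule pne(2))
        have "(\<Union>i<?h. set ((T(j := ?p)) i)) = (\<Union>i<?h. set (T i))"
          using setp by (intro SUP_cong) auto
        then have "nb (R.tip j) \<subseteq> set H \<union> (\<Union>i<?h. set ((T(j := ?p)) i))"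
          using max_tip[OF j P setp] pne Rt by simp
        then have "card (nb (T j ! l)) + 1 \<le> ?h"
          using R.tip_degree_less[OF j(1)] pne Rt by simp
        moreover have "T j ! l \<in> K" by (rule subsetD[OF T_subset[OF j(1)] nth_mem[OF ll(1)]])
        ultimately show ?thesis using zdeg tip2[OF i] l by simp
      qed
      have "?h * ?z \<le> card (S1 \<union> S2) * ?z" using cS by (rule mult_le_mono1)
      also have "\<dots> = (\<Sum>i\<in>S1 \<union> S2. ?z)" by simp
      also have "\<dots> \<le> (\<Sum>i\<in>S1 \<union> S2. card (att (last (?Q ! i # ?T i))))"
        by (rule sum_mono) (use z1 z2' in blast)
      finally have sum: "?h * ?z \<le> (\<Sum>i\<in>S1 \<union> S2. card (att (last (?Q ! i # ?T i))))" .
      have "S1 \<union> S2 \<noteq> {}" using cS h2 by auto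
      then obtain i where i: "i \<in> S1 \<union> S2" by blast
      show ?thesis
      proof (rule slot_bound[OF Q S, of ?T i ?z ?h])
        show "gpath E K (?Q ! i # ?T i)" if i: "i \<in> S1 \<union> S2" for i
        proof (cases "i < ?h - 1")
          case True
          then have "i < ?h" by simp
          then show ?thesis using T_path[OF om, of i] nth[of i] True by (simp add: nth_append)
        next
          case False
          then have "?Q ! i \<in> K" using gpath_subset[OF Q] i S by (meson lessThan_iff nth_mem subsetD)
          then show ?thesis using False by simp
        qed
        show "set (?T i) \<inter> set ?Q = {}" for i
        proof (cases "i < ?h - 1")
          case True
          then show ?thesis using T_H[OF om, of i] T_T[OF om j(1) oj'[OF True]] by auto
        qed auto
        show "set (?T i) \<inter> set (?T i') = {}" if "i \<noteq> i'" for i i'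
        proof (cases "i < ?h - 1 \<and> i' < ?h - 1")
          case True
          then have "i \<in> {..<?h}" "i' \<in> {..<?h}" by auto
          then have "?o i \<noteq> ?o i'" using inj_onD[OF o_inj, of i i'] that by metis
          then show ?thesis using T_T[OF om om, of i i'] True by simp
        qed auto
        show "i \<in> S1 \<union> S2" by (rule i)
        show "?z \<le> card (att (last (?Q ! i # ?T i)))" using i z1 z2' by blast
        show "2 \<le> ?z" by (rule z2)
        show "?h * ?z \<le> (\<Sum>i\<in>S1 \<union> S2. card (att (last (?Q ! i # ?T i))))" by (rule sum)
      qed
    qed
  qed
qed

end

section \<open>Connectivity\<close>

definition path_connected_after :: "('v \<Rightarrow> 'v \<Rightarrow> bool) \<Rightarrow> 'v set \<Rightarrow> nat \<Rightarrow> bool" where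
  "path_connected_after E V k \<longleftrightarrow> (\<forall>X \<subseteq> V. card X < k \<longrightarrow>
     (\<forall>u \<in> V - X. \<forall>v \<in> V - X. \<exists>p. gpath E (V - X) p \<and> hd p = u \<and> last p = v))"

text \<open>No set can be exhausted by \<open>F\<close> and the representatives chosen
  before.\<close>

lemma greedy_transversal:
  assumes "finite J" "finite F" "\<And>j. j \<in> J \<Longrightarrow> finite (Z j) \<and> card F + card J \<le> card (Z j)"
  shows "\<exists>s. inj_on s J \<and> (\<forall>j\<in>J. s j \<in> Z j - F)"
  using assms(1,3)
proof (induction J)
  case (insert x J)
  have "\<exists>s. inj_on s J \<and> (\<forall>j\<in>J. s j \<in> Z j - F)"
  proof (rule insert.IH)
    show "finite (Z j) \<and> card F + card J \<le> card (Z j)" if "j \<in> J" for j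
      using insert.prems[of j] insert.hyps that by auto
  qed
  then obtain s where s: "inj_on s J" "\<forall>j\<in>J. s j \<in> Z j - F" by blast
  have "card (F \<union> s ` J) < card (Z x)"
  proof -
    have "card (F \<union> s ` J) \<le> card F + card (s ` J)" by (rule card_Un_le)
    also have "\<dots> \<le> card F + card J" using card_image_le[OF insert.hyps(1), of s] by simp
    also have "\<dots> < card (Z x)" using insert.prems[of x] insert.hyps by simp
    finally show ?thesis .
  qed
  then have "\<not> Z x \<subseteq> F \<union> s ` J"
    using card_mono[of "F \<union> s ` J" "Z x"] assms(2) insert.hyps(1) by auto
  then obtain z where z: "z \<in> Z x" "z \<notin> F" "z \<notin> s ` J" by blast
  have "inj_on (s(x := z)) (insert x J)"
    using s(1) z(3) insert.hyps(2) by (auto simp: inj_on_def)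
  moreover have "\<forall>j\<in>insert x J. (s(x := z)) j \<in> Z j - F" using s(2) z by auto
  ultimately show ?case by blast
qed simp

context cycle_in_graph
begin

lemma outside_length_le:
  assumes "longest E K H"
  shows "length H \<le> n"
proof -
  have "gcycle E V H" using assms gpath_mono[of E K H V] by (auto simp: longest_def gcycle_def)
  then show ?thesis using C by (auto simp: longest_def)
qed

text \<open>Each path is taken apart into its start \<open>x\<close>, its inner vertices
  \<open>I x\<close>, all off \<open>C\<close>, and the position \<open>a x\<close> of its end on
  \<open>C\<close>.\<close>

lemma menger_fan:
  assumes kc: "path_connected_after E V k" and B: "B \<subseteq> K" "k \<le> card B" and kn: "k \<le> n"
  obtains X I a where "X \<subseteq> B" "card X = k" "\<And>x. x \<in> X \<Longrightarrow> gpath E K (x # I x)"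
    "\<And>x. x \<in> X \<Longrightarrow> set (I x) \<inter> B = {}" "\<And>x. x \<in> X \<Longrightarrow> a x \<in> att (last (x # I x))"
    "\<And>x y. x \<in> X \<Longrightarrow> y \<in> X \<Longrightarrow> x \<noteq> y \<Longrightarrow> set (I x) \<inter> set (I y) = {}" "inj_on a X"
proof -
  have BV: "B \<subseteq> V" using B(1) by auto
  have conn: "\<exists>p. gpath E (V - X) p \<and> hd p \<in> B \<and> last p \<in> set C" if X: "X \<subseteq> V" "card X < k" for X
  proof -
    have finX: "finite X" using X(1) finV finite_subset by blast
    have "\<not> B \<subseteq> X" using card_mono[OF finX, of B] B(2) X(2) by auto
    then obtain u where u: "u \<in> B" "u \<notin> X" by blast
    have "\<not> set C \<subseteq> X" using card_mono[OF finX, of "set C"] kn X(2) distinct_card[OF C_distinct] by auto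
    then obtain v where v: "v \<in> set C" "v \<notin> X" by blast
    have "\<exists>p. gpath E (V - X) p \<and> hd p = u \<and> last p = v"
      using kc X u v BV C_subset unfolding path_connected_after_def by blast
    then show ?thesis using u v by blast
  qed
  obtain P where P: "finite P" "card P = k"
      "\<And>p. p \<in> P \<Longrightarrow> gpath E V p \<and> hd p \<in> B \<and> last p \<in> set C \<and> set (tl p) \<inter> B = {} \<and> set (butlast p) \<inter> set C = {}"
      "\<And>p q. p \<in> P \<Longrightarrow> q \<in> P \<Longrightarrow> p \<noteq> q \<Longrightarrow> set p \<inter> set q = {}"
    by (rule menger[where E = E and k = k, OF finV EV BV C_subset conn]) blast+
  have pne: "p \<noteq> []" if "p \<in> P" for p using P(3)[OF that] gpath_nonempty by blast
  have hd_inj: "p = q" if "p \<in> P" "q \<in> P" "hd p = hd q" for p q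
    using P(4)[OF that(1,2)] pne that by (metis IntI empty_iff list.set_sel(1))
  have last_inj: "p = q" if "p \<in> P" "q \<in> P" "last p = last q" for p q
    using P(4)[OF that(1,2)] pne that by (metis IntI empty_iff last_in_set)
  have key: "gpath E K (hd p # tl (butlast p)) \<and> set (tl (butlast p)) \<inter> B = {} \<and>
      set (tl (butlast p)) \<subseteq> set p \<and> (\<exists>i. i \<in> att (last (hd p # tl (butlast p))) \<and> C ! i = last p)"
    if p: "p \<in> P" for p
  proof -
    have hl: "hd p \<noteq> last p" using P(3)[OF p] B(1) by auto
    obtain x r where xr: "p = x # r" using pne[OF p] by (cases p) auto
    obtain q c where qc: "r = q @ [c]" using hl xr by (cases r rule: rev_cases) auto
    have pp: "p = (x # q) @ [c]" using xr qc by simp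
    have bt: "butlast p = x # q" "tl (butlast p) = q" "hd p = x" "last p = c" using pp by (simp_all add: butlast_append)
    have "gpath E V ((x # q) @ [c])" using P(3)[OF p] pp by simp
    then have g: "gpath E V (x # q)" "E (last (x # q)) c"
      using gpath_append[of "x # q" "[c]" E V] by simp_all
    have "gpath E K (x # q)" using g(1) P(3)[OF p] bt by (auto simp: gpath_def)
    moreover have "set q \<inter> B = {}" using P(3)[OF p] xr qc by auto
    moreover obtain i where "i < n" "C ! i = c" using P(3)[OF p] bt(4) by (metis in_set_conv_nth)
    ultimately show ?thesis using g(2) bt xr qc by (auto simp: att_def)
  qed
  then obtain c where c: "\<And>p. p \<in> P \<Longrightarrow> c p \<in> att (last (hd p # tl (butlast p))) \<and> C ! c p = last p"
    by metis
  define pp where "pp = inv_into P hd"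
  define I where "I x = tl (butlast (pp x))" for x
  have pp: "pp x \<in> P" "hd (pp x) = x" if "x \<in> hd ` P" for x
    using that by (simp_all add: pp_def inv_into_into f_inv_into_f)
  show ?thesis
  proof (rule that[of "hd ` P" I "\<lambda>x. c (pp x)"])
    show "hd ` P \<subseteq> B" using P(3) by auto
    show "card (hd ` P) = k" using P(2) hd_inj by (subst card_image) (auto simp: inj_on_def)
    show "gpath E K (x # I x)" if "x \<in> hd ` P" for x using key[OF pp(1)[OF that]] pp(2)[OF that] by (simp add: I_def)
    show "set (I x) \<inter> B = {}" if "x \<in> hd ` P" for x using key[OF pp(1)[OF that]] by (simp add: I_def)
    show "c (pp x) \<in> att (last (x # I x))" if "x \<in> hd ` P" for x
      using c[OF pp(1)[OF that]] pp(2)[OF that] by (simp add: I_def)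
    show "set (I x) \<inter> set (I y) = {}" if xy: "x \<in> hd ` P" "y \<in> hd ` P" "x \<noteq> y" for x y
    proof -
      have "set (pp x) \<inter> set (pp y) = {}" using P(4)[OF pp(1)[OF xy(1)] pp(1)[OF xy(2)]] pp(2) xy by metis
      then show ?thesis using key[OF pp(1)[OF xy(1)]] key[OF pp(1)[OF xy(2)]] by (auto simp: I_def)
    qed
    show "inj_on (\<lambda>x. c (pp x)) (hd ` P)"
    proof (rule inj_onI)
      fix x y assume xy: "x \<in> hd ` P" "y \<in> hd ` P" "c (pp x) = c (pp y)"
      have "last (pp x) = last (pp y)" using c[OF pp(1)[OF xy(1)]] c[OF pp(1)[OF xy(2)]] xy(3) by simp
      then have "pp x = pp y" using last_inj pp(1) xy by blast
      then show "x = y" using pp(2) xy by metis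
    qed
  qed
qed

text \<open>Two fan paths and a path inside \<open>B\<close>, which their inner vertices avoid, form
  a detour; hence the ends of the fan are at distance at least \<open>m + 1\<close> on
  \<open>C\<close>.\<close>

lemma linked_set_bound:
  assumes kc: "path_connected_after E V k" and B: "B \<subseteq> K" "k \<le> card B" and kn: "k \<le> n" "2 \<le> k"
    and linked: "\<And>x y. x \<in> B \<Longrightarrow> y \<in> B \<Longrightarrow> x \<noteq> y \<Longrightarrow>
      \<exists>q. gpath E B q \<and> hd q = x \<and> last q = y \<and> m \<le> length q"
  shows "k * (m + 1) \<le> n"
proof -
  obtain X I a where X: "X \<subseteq> B" "card X = k" "\<And>x. x \<in> X \<Longrightarrow> gpath E K (x # I x)"
    "\<And>x. x \<in> X \<Longrightarrow> set (I x) \<inter> B = {}" "\<And>x. x \<in> X \<Longrightarrow> a x \<in> att (last (x # I x))"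
    "\<And>x y. x \<in> X \<Longrightarrow> y \<in> X \<Longrightarrow> x \<noteq> y \<Longrightarrow> set (I x) \<inter> set (I y) = {}" "inj_on a X"
    by (rule menger_fan[OF kc B kn(1)]) blast
  have ca: "card (a ` X) = k" using X(2,7) by (simp add: card_image)
  have "card (a ` X) * (m + 1) \<le> n"
  proof (rule strong_positions)
    show "a ` X \<subseteq> {..<n}" using X(5) att_less by blast
    show "2 \<le> card (a ` X)" using ca kn(2) by simp
    fix p q assume pq: "p \<in> a ` X" "q \<in> a ` X" "p < q"
    then obtain x y where xy: "x \<in> X" "y \<in> X" "p = a x" "q = a y" by blast
    then have ne: "x \<noteq> y" using pq(3) by auto
    then obtain Q where Q: "gpath E B Q" "hd Q = x" "last Q = y" "m \<le> length Q"
      using linked[of x y] xy X(1) by blast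
    have QB: "set Q \<subseteq> B" using Q(1) gpath_subset by blast
    have QK: "gpath E K Q" using Q(1) B(1) gpath_mono by blast
    have d: "set (I x) \<inter> set Q = {}" "set (I y) \<inter> set Q = {}" using QB X(4)[OF xy(1)] X(4)[OF xy(2)] by auto
    note R = gpath_both_tails[OF sym QK Q(2,3) X(3)[OF xy(1)] d(1) X(3)[OF xy(2)] d(2) X(6)[OF xy(1,2) ne]]
    show "\<exists>R. gpath E K R \<and> p \<in> att (hd R) \<and> q \<in> att (last R) \<and> m \<le> length R"
      using R X(5)[OF xy(1)] X(5)[OF xy(2)] xy(3,4) Q(4)
      by (intro exI[of _ "rev (I x) @ Q @ I y"]) (simp del: last_append hd_append)
  qed
  then show ?thesis by (simp add: ca)
qed

text \<open>Here \<open>H\<close> is so long that the longer of its arcs between two vertices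
  already has \<open>d + 1\<close> vertices.\<close>

lemma long_outside_cycle_bound:
  assumes kc: "path_connected_after E V k" and k: "2 \<le> k" "k \<le> length H"
    and HL: "longest E K H" and d: "2 * d \<le> length H"
  shows "k * (d + 2) \<le> n"
proof -
  have Hp: "gpath E K H" using HL by (simp add: longest_def gcycle_def)
  have HK: "set H \<subseteq> K" using gpath_subset[OF Hp] .
  have lH: "longest E (set H) H"
    using HL HK gpath_mono[of E "set H" _ K] by (auto simp: longest_def gcycle_def gpath_def)
  \<comment> \<open>With \<open>set H\<close> as ambient set the connections stay inside
    \<open>H\<close>, as \<open>linked_set_bound\<close> demands.\<close>
  interpret tailed_cycle E "set H" H "\<lambda>_. []"
    using sym irr lH k by unfold_locales auto
  have "k * ((d + 1) + 1) \<le> n"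
  proof (rule linked_set_bound[OF kc HK _ _ k(1)])
    show "k \<le> card (set H)" using k(2) distinct_card[OF H_distinct] by simp
    show "k \<le> n" using k(2) outside_length_le[OF HL] by simp
    fix x y assume xy: "x \<in> set H" "y \<in> set H" "x \<noteq> y"
    then obtain i j where ij: "i < h" "H ! i = x" "j < h" "H ! j = y" by (auto simp: in_set_conv_nth)
    then have "j \<noteq> i" using xy(3) by auto
    then have "conn i j ((h + 1) div 2 + 1)" using spread_half[OF ij(1)] ij(3) by (simp add: spread_def)
    then obtain q where q: "gpath E (set H) q" "hd q = x" "last q = y" "(h + 1) div 2 + 1 \<le> length q"
      using ij by (auto simp: conn_def tip_def)
    have "d \<le> (h + 1) div 2" using d by linarith
    then show "\<exists>q. gpath E (set H) q \<and> hd q = x \<and> last q = y \<and> d + 1 \<le> length q" using q by auto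
  qed
  then show ?thesis by simp
qed

text \<open>Only the first inner vertex of a fan path is kept as initial tail; that protects the
  slot from becoming bare. So a slot of \<open>X\<close> that ends up bare had a fan path without
  inner vertices, and its root is adjacent to \<open>C\<close> at the chosen position.\<close>

lemma fan_tails:
  assumes kc: "path_connected_after E V k" and k: "2 \<le> k" "k \<le> length H" and H: "longest E K H"
  obtains T X a where "optimal_tails E K H T" "X \<subseteq> {..<length H}" "card X = k" "inj_on a X"
    "\<And>i. i \<in> X \<Longrightarrow> T i = [] \<Longrightarrow> a i \<in> att (H ! i)"
proof -
  have Hp: "gpath E K H" using H by (simp add: longest_def gcycle_def)
  have HK: "set H \<subseteq> K" and Hd: "distinct H" using gpath_subset[OF Hp] gpath_distinct[OF Hp] by auto
  have kB: "k \<le> card (set H)" using k(2) distinct_card[OF Hd] by simp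
  have kn: "k \<le> n" using k(2) outside_length_le[OF H] by simp
  obtain X I a where X: "X \<subseteq> set H" "card X = k" "\<And>x. x \<in> X \<Longrightarrow> gpath E K (x # I x)"
    "\<And>x. x \<in> X \<Longrightarrow> set (I x) \<inter> set H = {}" "\<And>x. x \<in> X \<Longrightarrow> a x \<in> att (last (x # I x))"
    "\<And>x y. x \<in> X \<Longrightarrow> y \<in> X \<Longrightarrow> x \<noteq> y \<Longrightarrow> set (I x) \<inter> set (I y) = {}" "inj_on a X"
    by (rule menger_fan[OF kc HK kB kn]) blast
  define X' where "X' = {i. i < length H \<and> H ! i \<in> X}"
  define T where "T i = (if H ! i \<in> X then take 1 (I (H ! i)) else [])" for i
  have Tsub: "set (T i) \<subseteq> set (I (H ! i))" for i by (auto simp: T_def dest: in_set_takeD)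
  have tc: "tailed_cycle E K H T"
  proof
    show "symp E" by (rule sym)
    show "\<not> E v v" for v by (rule irr)
    show "finite K" by (rule finK)
    show "longest E K H" by (rule H)
    show "2 \<le> length H" using k by simp
    show "gpath E K (H ! i # T i)" if "i < length H" for i
    proof (cases "H ! i \<in> X")
      case True
      then show ?thesis using gpath_takeI[OF X(3)[OF True], of 2] by (simp add: T_def numeral_2_eq_2)
    next
      case False
      then show ?thesis using subsetD[OF HK nth_mem[OF that]] by (simp add: T_def)
    qed
    show "set (T i) \<inter> set H = {}" if "i < length H" for i
      using Tsub[of i] X(4)[of "H ! i"] by (cases "H ! i \<in> X") (auto simp: T_def)
    show "set (T i) \<inter> set (T j) = {}" if "i < length H" "j < length H" "i \<noteq> j" for i j
    proof (cases "H ! i \<in> X \<and> H ! j \<in> X")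
      case True
      have "H ! i \<noteq> H ! j" using that Hd nth_eq_iff_index_eq by blast
      then show ?thesis using Tsub[of i] Tsub[of j] X(6)[of "H ! i" "H ! j"] True by auto
    qed (auto simp: T_def)
  qed
  define q where "q = {i \<in> X'. I (H ! i) \<noteq> []}"
  have q: "i < length H \<and> T i \<noteq> []" if "i \<in> q" for i
    using that by (auto simp: q_def X'_def T_def)
  have "\<exists>T'. optimal_tails E K H T' \<and> (\<forall>i\<in>q. T' i \<noteq> [])"
  proof (rule optimal_tails_exist[where q = q, OF tc q])
    fix T' assume "optimal_tails E K H T'" "\<And>i. i \<in> q \<Longrightarrow> T' i \<noteq> []"
    then show ?thesis by (intro exI[of _ T']) simp
  qed
  then obtain T' where T': "optimal_tails E K H T'" "\<And>i. i \<in> q \<Longrightarrow> T' i \<noteq> []" by blast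
  have img: "X = (!) H ` X'" using X(1) by (auto simp: X'_def in_set_conv_nth subset_iff image_iff)
  have inj: "inj_on ((!) H) X'" using Hd by (auto simp: X'_def inj_on_def nth_eq_iff_index_eq)
  show ?thesis
  proof (rule that[OF T'(1), of X' "a \<circ> (!) H"])
    show "X' \<subseteq> {..<length H}" by (auto simp: X'_def)
    show "card X' = k" using X(2) inj img card_image by metis
    show "inj_on (a \<circ> (!) H) X'" using inj X(7) img by (intro comp_inj_on) auto
    show "(a \<circ> (!) H) i \<in> att (H ! i)" if i: "i \<in> X'" "T' i = []" for i
    proof -
      have "I (H ! i) = []" using T'(2)[of i] i by (auto simp: q_def)
      then show ?thesis using X(5)[of "H ! i"] i by (simp add: X'_def)
    qed
  qed
qed

end

section \<open>Tips and their attachments to the long cycle\<close>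

locale tails_off_cycle = cycle: cycle_in_graph V E C + optimal_tails E "V - set C" H T
  for V :: "'v set" and E :: "'v \<Rightarrow> 'v \<Rightarrow> bool" and C :: "'v list" and H :: "'v list" and T :: "nat \<Rightarrow> 'v list"
begin

abbreviation Z :: "nat \<Rightarrow> nat set" where "Z i \<equiv> cycle.att (tip i)"
abbreviation dg :: "nat \<Rightarrow> nat" where "dg i \<equiv> card (nb (tip i))"

text \<open>A Hamiltonian path of the slot \<open>j\<close> ending in its root is a reordered tail
  read backwards. By the minimal choice of tip degrees its free end has more than \<open>d\<close>
  neighbours outside \<open>C\<close>, and because of \<open>h < 2 * d\<close> they all lie in the
  slot. So the slot is end-closed and contains a linked set of at least \<open>d + 2\<close>
  vertices.\<close>

lemma heavy_tail_bound:
  assumes kc: "path_connected_after E V k" and k: "2 \<le> k" "k \<le> h" "k \<le> d + 2"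
    and j: "j < h" "T j \<noteq> []" and d: "d < dg j" "h < 2 * d"
  shows "k * (d + 2) \<le> length C"
proof -
  let ?B = "insert (H ! j) (set (T j))"
  have BK: "?B \<subseteq> cycle.K" using nth_in_K[OF j(1)] T_subset[OF j(1)] by auto
  have Hj: "H ! j \<notin> set (T j)" using T_H[OF j(1)] j(1) by (auto dest: nth_mem)
  have "ham_path E ?B (H ! j) (rev (H ! j # T j))"
  proof -
    have "gpath E ?B (H ! j # T j)" using T_path[OF j(1)] by (auto simp: gpath_def)
    then have "gpath E ?B (rev (H ! j # T j))" using gpath_rev[OF sym] by blast
    then show ?thesis by (simp add: ham_path_def)
  qed
  moreover have "nb (hd p) \<subseteq> ?B \<and> d + 1 \<le> card (nb (hd p))" if p: "ham_path E ?B (H ! j) p" for p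
  proof -
    define p' where "p' = tl (rev p)"
    have g: "gpath E ?B p" "set p = ?B" "last p = H ! j" using p by (auto simp: ham_path_def)
    have pne: "p \<noteq> []" using g(1) by (rule gpath_nonempty)
    have rp: "rev p = H ! j # p'" using g(3) pne by (metis p'_def hd_rev list.collapse rev_is_Nil_conv)
    have gr: "gpath E ?B (H ! j # p')" using g(1) gpath_rev[OF sym, of ?B p] rp by simp
    have P: "gpath E cycle.K (H ! j # p')" using gr BK by (rule gpath_mono)
    have "insert (H ! j) (set p') = ?B" using g(2) rp by (metis list.simps(15) set_rev)
    moreover have "H ! j \<notin> set p'" using gpath_distinct[OF gr] by simp
    ultimately have setp: "set p' = set (T j)" using Hj by (metis insert_ident)
    have pne': "p' \<noteq> []" using setp j(2) by auto
    have hp: "hd p = last p'" using rp pne pne' by (metis last_ConsR last_rev)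
    note mt = max_tip[OF j P setp]
    have rt: "tailed_cycle E cycle.K H (T(j := p'))"
      using P setp T_H[OF j(1)] T_T[OF j(1)] by (intro replace_tail[OF j(1)]) auto
    interpret R: tailed_cycle E cycle.K H "T(j := p')" by (rule rt)
    have Rt: "R.tip j = last p'"
      unfolding R.tip_def fun_upd_same last_ConsR[OF pne'] by (rule refl)
    have Un: "(\<Union>i<h. set ((T(j := p')) i)) = (\<Union>i<h. set (T i))"
      using setp by (intro SUP_cong) auto
    have cp: "d + 1 \<le> card (nb (last p'))" using mt d(1) by (simp add: tip_def)
    have "nb (R.tip j) \<subseteq> insert (H ! j) (set ((T(j := p')) j))"
    proof (rule R.tail_tip(3)[OF j(1)])
      show "(T(j := p')) j \<noteq> []" using pne' by simp
      show "nb (R.tip j) \<subseteq> set H \<union> (\<Union>i<h. set ((T(j := p')) i))" using mt by (simp only: Rt Un)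
      show "h < 2 * card (nb (R.tip j))" using cp d(2) by (simp only: Rt)
    qed
    then show ?thesis using cp setp by (simp add: Rt hp)
  qed
  ultimately have "end_closed E cycle.K (d + 1) ?B (H ! j)" unfolding end_closed_def by blast
  moreover have "3 \<le> d + 1" using d(2) h2 by simp
  ultimately obtain B where B: "B \<subseteq> ?B" "(d + 1) + 1 \<le> card B"
      "\<And>x y. x \<in> B \<Longrightarrow> y \<in> B \<Longrightarrow> x \<noteq> y \<Longrightarrow> \<exists>q. gpath E B q \<and> hd q = x \<and> last q = y \<and> d + 1 \<le> length q"
    using end_closed_paths[OF sym irr finK] by metis
  have "k * ((d + 1) + 1) \<le> length C"
  proof (rule cycle.linked_set_bound[OF kc _ _ _ k(1)])
    show "B \<subseteq> cycle.K" using B(1) BK by (rule subset_trans)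
    show "k \<le> card B" using B(2) k(3) by simp
    show "k \<le> length C" using k(2) cycle.outside_length_le[OF H] by simp
  qed (rule B(3))
  then show ?thesis by simp
qed

text \<open>The best spread of \<open>x\<close>; it exists because a path off \<open>C\<close> has
  at most \<open>card K\<close> vertices.\<close>

definition reach :: "nat \<Rightarrow> nat" where
  "reach x = (GREATEST b. spread x b)"

lemma reach:
  assumes "x < h"
  shows "spread x (reach x)" "spread x b \<Longrightarrow> b \<le> reach x"
proof -
  have bd: "b \<le> card cycle.K" if b: "spread x b" for b
  proof -
    define y where "y = (if x = 0 then 1 else 0 :: nat)"
    have "y < h" "y \<noteq> x" using h2 by (auto simp: y_def)
    then obtain p where p: "gpath E cycle.K p" "length (T x) + length (T y) + b + 1 \<le> length p"
      using b by (auto simp: spread_def conn_def)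
    have "length p \<le> card cycle.K"
      using card_mono[OF finK gpath_subset[OF p(1)]] distinct_card[OF gpath_distinct[OF p(1)]] by simp
    then show ?thesis using p(2) by simp
  qed
  show "spread x (reach x)"
    unfolding reach_def using spread_half[OF assms] bd by (rule GreatestI_nat)
  show "b \<le> reach x" if "spread x b"
    unfolding reach_def using that bd by (rule Greatest_le_nat)
qed

lemma reach_conn:
  assumes "x < h" "y < h" "x \<noteq> y"
  shows "conn x y (length (T x) + length (T y) + reach x + 1)"
    "conn x y (length (T x) + length (T y) + reach y + 1)"
proof -
  show "conn x y (length (T x) + length (T y) + reach x + 1)"
    using reach(1)[OF assms(1)] assms by (auto simp: spread_def)
  have "conn y x (length (T y) + length (T x) + reach y + 1)"
    using reach(1)[OF assms(2)] assms by (auto simp: spread_def)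
  then show "conn x y (length (T x) + length (T y) + reach y + 1)"
    using conn_sym by (simp add: add.commute)
qed

lemma conn_detour:
  assumes "conn i j m" "p \<in> Z i" "q \<in> Z j" "p < q"
  shows "int m + 1 \<le> int q - int p" "int m + 1 \<le> int (length C) - (int q - int p)"
    "int m + 1 \<le> int (length C) - int q + int p"
proof -
  obtain R where R: "gpath E cycle.K R" "hd R = tip i" "last R = tip j" "m \<le> length R"
    using assms(1) by (auto simp: conn_def)
  have pq: "\<bar>int p - int q\<bar> = int q - int p" using assms(4) by simp
  note dt = cycle.detour[OF R(1), of p q, unfolded pq]
  have "int (length R) + 1 \<le> int q - int p" "int (length R) + 1 \<le> int (length C) - (int q - int p)"
    using dt R assms(2-4) by simp_all
  then show "int m + 1 \<le> int q - int p" "int m + 1 \<le> int (length C) - (int q - int p)"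
    "int m + 1 \<le> int (length C) - int q + int p" using R(4) by linarith+
qed

text \<open>If some member of \<open>I\<close> precedes \<open>x\<close>, the arc from the last such
  member backwards around the end of the list to \<open>x\<close> passes all of \<open>I\<close>;
  otherwise the arc from \<open>x\<close> up to \<open>Max I\<close> does.\<close>

lemma conn_far:
  assumes x: "x < h" and I: "I \<subseteq> {..<h}" "2 \<le> card I"
  obtains i where "i \<in> I" "i \<noteq> x" "conn x i (length (T x) + card I)"
proof -
  have finI: "finite I" using I(1) finite_subset by blast
  show ?thesis
  proof (cases "{i \<in> I. i < x} = {}")
    case True
    then have ge: "\<And>i. i \<in> I \<Longrightarrow> x \<le> i" by (auto simp: not_less)
    have m: "Max I \<in> I" using finI I(2) by (intro Max_in) auto
    have "I \<subseteq> {x..Max I}" using ge finI by auto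
    then have "card I \<le> card {x..Max I}" by (intro card_mono) auto
    then have c: "card I \<le> Max I - x + 1" using ge[OF m] by simp
    then have lt: "x < Max I" using I(2) by linarith
    have "conn x (Max I) (length (T x) + length (T (Max I)) + (Max I - x) + 1)"
      using lt m I(1) by (intro conn_arcs) auto
    then have "conn x (Max I) (length (T x) + card I)" by (rule conn_mono) (use c in simp)
    then show ?thesis using that m lt by blast
  next
    case False
    define i where "i = Max {i \<in> I. i < x}"
    have i: "i \<in> I" "i < x" using Max_in[OF _ False] finI by (auto simp: i_def)
    have "I \<subseteq> {..i} \<union> {x..<h}"
    proof
      fix j assume j: "j \<in> I"
      show "j \<in> {..i} \<union> {x..<h}"
        using Max_ge[of "{i \<in> I. i < x}" j] finI j I(1) by (cases "j < x") (auto simp: i_def)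
    qed
    then have "card I \<le> card ({..i} \<union> {x..<h})" by (intro card_mono) auto
    also have "\<dots> \<le> card {..i} + card {x..<h}" by (rule card_Un_le)
    finally have c: "card I \<le> i + 1 + (h - x)" by simp
    have "conn i x (length (T i) + length (T x) + (h - (x - i)) + 1)"
      using i x by (intro conn_arcs) auto
    then have "conn i x (length (T x) + card I)" by (rule conn_mono) (use c i x in simp)
    then show ?thesis using that i conn_sym by blast
  qed
qed

text \<open>The choice of extreme slots as in \<open>slot_sum\<close>, with the tails
  disregarded.\<close>

lemma conn_two_sets:
  assumes I: "I \<subseteq> {..<h}" "I \<noteq> {}" and J: "J \<subseteq> {..<h}" "J \<noteq> {}"
  obtains i j m where "i \<in> I" "j \<in> J" "conn i j m" "card I + card J \<le> 2 * m"
proof -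
  have fin: "finite I" "finite J" using I J finite_subset by blast+
  have conn_abs: "conn i j (nat \<bar>int i - int j\<bar> + 1)" if ij: "i < h" "j < h" for i j
  proof -
    consider "i < j" | "j < i" | "i = j" by linarith
    then show ?thesis
    proof cases
      case 1
      show ?thesis using conn_arcs(1)[OF 1 ij(2)] by (rule conn_mono) (use 1 in simp)
    next
      case 2
      have "conn j i (nat \<bar>int i - int j\<bar> + 1)"
        using conn_arcs(1)[OF 2 ij(1)] by (rule conn_mono) (use 2 in simp)
      then show ?thesis by (rule conn_sym)
    next
      case 3
      then show ?thesis using conn_refl[OF ij(1)] by simp
    qed
  qed
  define a b c d where "a = Min I" "b = Max I" "c = Min J" "d = Max J"
  have m: "a \<in> I" "b \<in> I" "c \<in> J" "d \<in> J" using fin I J by (auto simp: a_b_c_d_def)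
  have "I \<subseteq> {a..b}" "J \<subseteq> {c..d}" using fin by (auto simp: a_b_c_d_def)
  then have "card I \<le> card {a..b}" "card J \<le> card {c..d}" by (metis card_mono finite_atLeastAtMost)+
  moreover have "a \<le> b" "c \<le> d" using fin m by (auto simp: a_b_c_d_def)
  ultimately have cd: "int (card I) \<le> int b - int a + 1" "int (card J) \<le> int d - int c + 1"
    by (simp_all add: card_atLeastAtMost)
  define u v where "u = nat \<bar>int a - int d\<bar>" "v = nat \<bar>int b - int c\<bar>"
  have "int b - int a + (int d - int c) \<le> int u + int v" by (simp add: u_v_def)
  from larger_half[OF cd this] have "card I + card J \<le> 2 * (u + 1) \<or> card I + card J \<le> 2 * (v + 1)"
    by presburger
  then show ?thesis
  proof
    assume "card I + card J \<le> 2 * (u + 1)"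
    then show ?thesis using that[OF m(1,4) conn_abs] m I(1) J(1) unfolding u_v_def by blast
  next
    assume "card I + card J \<le> 2 * (v + 1)"
    then show ?thesis using that[OF m(2,3) conn_abs] m I(1) J(1) unfolding u_v_def by blast
  qed
qed

text \<open>
  A position on \<open>C\<close> is put into the class of \<open>x\<close> if it represents \<open>x\<close>, or if it
  represents nothing and \<open>x\<close> is the only slot attached to it; all other positions form classes
  of their own.
\<close>

lemma transversal_bound:
  assumes X: "X \<subseteq> {..<h}" "2 \<le> card X" and s: "inj_on s X" "\<And>x. x \<in> X \<Longrightarrow> s x \<in> Z x"
  shows "(\<Sum>x\<in>X. 2 * length (T x) + reach x + 2) + (\<Sum>i<h. card (Z i - s ` X)) \<le> length C"
proof -
  define A where "A = (\<Union>i<h. Z i)"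
  define I where "I b = {i. i < h \<and> b \<in> Z i}" for b
  define D where "D = {b \<in> A - s ` X. \<exists>x\<in>X. I b = {x}}"
  define f where "f b = (if b \<in> s ` X then Inl (inv_into X s b) else if \<exists>x\<in>X. I b = {x} then Inl (THE x. I b = {x}) else Inr b)" for b
  \<comment> \<open>Between representatives of \<open>x\<close> and \<open>y\<close> the gap is at
    least \<open>length (T x) + length (T y) + 2\<close> plus either reach; the mean of the two
    estimates splits into these weights. Any other position is weighted by the number of slots
    attached to it.\<close>
  define w where "w c = (case c of Inl x \<Rightarrow> 2 * int (length (T x)) + int (reach x) + 2 | Inr b \<Rightarrow> int (card (I b)))" for c
  have finA: "finite A" by (simp add: A_def)
  have finX: "finite X" using X(1) finite_subset by blast
  have finI: "finite (I b)" and Ih: "I b \<subseteq> {..<h}" for b by (auto simp: I_def)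
  have Ine: "I b \<noteq> {}" if "b \<in> A" for b using that by (auto simp: A_def I_def)
  have sA: "s ` X \<subseteq> A" using X(1) s(2) by (auto simp: A_def)
  have fs: "f (s x) = Inl x" if "x \<in> X" for x using that s(1) by (simp add: f_def)
  have fD: "f b = Inl x" if "b \<notin> s ` X" "x \<in> X" "I b = {x}" for b x
    using that by (auto simp: f_def)
  have fO: "f b = Inr b" if "b \<notin> s ` X" "b \<notin> D" "b \<in> A" for b
    using that by (auto simp: f_def D_def)
  have cases_f: "(\<exists>x\<in>X. f b = Inl x \<and> b \<in> Z x) \<or> (f b = Inr b \<and> b \<notin> s ` X \<and> (\<forall>x\<in>X. I b \<noteq> {x}))"
    if b: "b \<in> A" for b
  proof -
    consider "b \<in> s ` X" | "b \<notin> s ` X" "b \<in> D" | "b \<notin> s ` X" "b \<notin> D" by blast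
    then show ?thesis
    proof cases
      case 1
      then obtain x where "x \<in> X" "b = s x" by blast
      then show ?thesis using fs s(2) by blast
    next
      case 2
      then obtain x where x: "x \<in> X" "I b = {x}" by (auto simp: D_def)
      then have "x \<in> I b" by simp
      then have "b \<in> Z x" unfolding I_def by simp
      then show ?thesis using fD[OF 2(1) x] x(1) by blast
    next
      case 3
      then show ?thesis using fO[OF 3 b] b by (auto simp: D_def)
    qed
  qed
  have image: "f ` A = Inl ` X \<union> Inr ` (A - s ` X - D)"
  proof
    show "f ` A \<subseteq> Inl ` X \<union> Inr ` (A - s ` X - D)"
    proof
      fix c assume "c \<in> f ` A"
      then obtain b where b: "b \<in> A" "c = f b" by blast
      show "c \<in> Inl ` X \<union> Inr ` (A - s ` X - D)"
        using cases_f[OF b(1)] b by (auto simp: D_def)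
    qed
    show "Inl ` X \<union> Inr ` (A - s ` X - D) \<subseteq> f ` A"
    proof
      fix c assume "c \<in> Inl ` X \<union> Inr ` (A - s ` X - D)"
      then show "c \<in> f ` A"
      proof
        assume "c \<in> Inl ` X"
        then obtain x where "x \<in> X" "c = f (s x)" using fs by auto
        then show ?thesis using sA by blast
      next
        assume "c \<in> Inr ` (A - s ` X - D)"
        then obtain b where "b \<in> A" "c = f b" using fO by auto
        then show ?thesis by blast
      qed
    qed
  qed
  have disj: "Inl ` X \<inter> Inr ` (A - s ` X - D) = {}" by auto
  have cf: "card (f ` A) = card X + card (A - s ` X - D)"
    unfolding image using finX finA disj by (subst card_Un_disjoint) (auto simp: card_image)
  have "sum w (f ` A) + int (card A) - int (card (f ` A)) \<le> int (length C)"
  proof (rule cyclic_weights)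
    show "A \<subseteq> {..<length C}" using cycle.att_less by (auto simp: A_def)
    show "2 \<le> card (f ` A)" using cf X(2) by simp
    show "1 \<le> w (f p)" if p: "p \<in> A" for p
    proof -
      have "0 < card (I p)" using Ine[OF p] finI by (simp add: card_gt_0_iff)
      then show ?thesis using cases_f[OF p] by (auto simp: w_def)
    qed
    fix p q assume pq: "p \<in> A" "q \<in> A" "p < q" "f p \<noteq> f q"
    \<comment> \<open>Two connections from \<open>x\<close> are averaged: one exploits its reach,
      the other the width of the set of slots attached to \<open>b\<close>.\<close>
    have mixed: "\<exists>m m'. 2 * length (T x) + reach x + 2 + card (I b) \<le> m + m' + 2 \<and>
        (\<exists>i. b \<in> Z i \<and> conn x i m) \<and> (\<exists>i. b \<in> Z i \<and> conn x i m')"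
      if x: "x \<in> X" and b: "b \<in> A" "\<forall>x\<in>X. I b \<noteq> {x}" for x b
    proof -
      have xh: "x < h" using x X(1) by auto
      have "\<not> I b \<subseteq> {x}" using Ine[OF b(1)] b(2) x by blast
      then obtain i where i: "i \<in> I b" "i \<noteq> x" by blast
      then have ih: "i < h" "b \<in> Z i" by (auto simp: I_def)
      have c: "conn x i (length (T x) + length (T i) + reach x + 1)"
        using reach_conn(1)[OF xh ih(1)] i(2) by simp
      have c1: "conn x i (length (T x) + reach x + 1)" using c by (rule conn_mono) simp
      show ?thesis
      proof (cases "2 \<le> card (I b)")
        case True
        then obtain i' where i': "i' \<in> I b" "conn x i' (length (T x) + card (I b))"
          using conn_far[OF xh Ih] by metis
        then have "b \<in> Z i'" by (simp add: I_def)
        then show ?thesis using c1 i' ih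
          by (intro exI[of _ "length (T x) + reach x + 1"] exI[of _ "length (T x) + card (I b)"]) auto
      next
        case False
        have c2: "conn x i (length (T x) + 1)" using c by (rule conn_mono) simp
        show ?thesis using c1 c2 ih False
          by (intro exI[of _ "length (T x) + reach x + 1"] exI[of _ "length (T x) + 1"]) auto
      qed
    qed
    have half: "int a \<le> 2 * (int q - int p) \<and> int a \<le> 2 * (int (length C) - (int q - int p))"
      if "conn i j m" "p \<in> Z i" "q \<in> Z j" "conn i' j' m'" "p \<in> Z i'" "q \<in> Z j'" "a \<le> m + m' + 2"
      for a m m' i j i' j'
      using conn_detour[OF that(1-3) pq(3)] conn_detour[OF that(4-6) pq(3)] that(7) by simp
    consider x y where "x \<in> X" "y \<in> X" "f p = Inl x" "f q = Inl y" "p \<in> Z x" "q \<in> Z y"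
      | x where "x \<in> X" "f p = Inl x" "p \<in> Z x" "f q = Inr q" "\<forall>x\<in>X. I q \<noteq> {x}"
      | y where "y \<in> X" "f q = Inl y" "q \<in> Z y" "f p = Inr p" "\<forall>x\<in>X. I p \<noteq> {x}"
      | "f p = Inr p" "f q = Inr q"
      using cases_f[OF pq(1)] cases_f[OF pq(2)] by blast
    then show "w (f p) + w (f q) \<le> 2 * (int q - int p) \<and> w (f p) + w (f q) \<le> 2 * (int (length C) - (int q - int p))"
    proof cases
      case 1
      then have xy: "x < h" "y < h" "x \<noteq> y" using X(1) pq(4) by auto
      have "int (2 * length (T x) + reach x + 2 + (2 * length (T y) + reach y + 2)) \<le> 2 * (int q - int p) \<and>
          int (2 * length (T x) + reach x + 2 + (2 * length (T y) + reach y + 2)) \<le> 2 * (int (length C) - (int q - int p))"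
        by (rule half[OF reach_conn(1)[OF xy] 1(5,6) reach_conn(2)[OF xy] 1(5,6)]) simp
      then show ?thesis using 1 by (simp add: w_def algebra_simps)
    next
      case 2
      then obtain m m' i i' where mi: "2 * length (T x) + reach x + 2 + card (I q) \<le> m + m' + 2"
          "q \<in> Z i" "conn x i m" "q \<in> Z i'" "conn x i' m'" using mixed[OF 2(1) pq(2) 2(5)] by blast
      have "int (2 * length (T x) + reach x + 2 + card (I q)) \<le> 2 * (int q - int p) \<and>
          int (2 * length (T x) + reach x + 2 + card (I q)) \<le> 2 * (int (length C) - (int q - int p))"
        by (rule half[OF mi(3) 2(3) mi(2) mi(5) 2(3) mi(4,1)])
      then show ?thesis using 2 by (simp add: w_def algebra_simps)
    next
      case 3
      then obtain m m' i i' where mi: "2 * length (T y) + reach y + 2 + card (I p) \<le> m + m' + 2"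
          "p \<in> Z i" "conn y i m" "p \<in> Z i'" "conn y i' m'" using mixed[OF 3(1) pq(1) 3(5)] by blast
      have "int (2 * length (T y) + reach y + 2 + card (I p)) \<le> 2 * (int q - int p) \<and>
          int (2 * length (T y) + reach y + 2 + card (I p)) \<le> 2 * (int (length C) - (int q - int p))"
        by (rule half[OF conn_sym[OF mi(3)] mi(2) 3(3) conn_sym[OF mi(5)] mi(4) 3(3) mi(1)])
      then show ?thesis using 3 by (simp add: w_def algebra_simps)
    next
      case 4
      obtain i j m where m: "i \<in> I p" "j \<in> I q" "conn i j m" "card (I p) + card (I q) \<le> 2 * m"
        by (rule conn_two_sets[OF Ih Ine[OF pq(1)] Ih Ine[OF pq(2)]])
      have z: "p \<in> Z i" "q \<in> Z j" using m by (auto simp: I_def)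
      have "int (card (I p) + card (I q)) \<le> 2 * (int q - int p) \<and>
          int (card (I p) + card (I q)) \<le> 2 * (int (length C) - (int q - int p))"
        by (rule half[OF m(3) z m(3) z]) (use m(4) in simp)
      then show ?thesis using 4 by (simp add: w_def)
    qed
  qed
  moreover have "sum w (f ` A) = (\<Sum>x\<in>X. 2 * int (length (T x)) + int (reach x) + 2) + (\<Sum>b\<in>A - s ` X - D. int (card (I b)))"
    unfolding image using finX finA disj by (subst sum.union_disjoint) (auto simp: sum.reindex w_def)
  moreover have "card A = card X + card D + card (A - s ` X - D)"
  proof -
    have "D \<subseteq> A - s ` X" by (auto simp: D_def)
    then have "card (A - s ` X - D) + card D = card (A - s ` X)"
      using finA by (metis card_Diff_subset card_mono finite_Diff finite_subset le_add_diff_inverse2)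
    moreover have "card (A - s ` X) + card (s ` X) = card A"
      using finA sA by (metis card_Diff_subset card_mono finite_subset le_add_diff_inverse2)
    moreover have "card (s ` X) = card X" using s(1) by (rule card_image)
    ultimately show ?thesis by linarith
  qed
  \<comment> \<open>A further position in the class of a slot adds 1 in
    \<open>cyclic_weights\<close>, exactly the single slot attached to it.\<close>
  moreover have "(\<Sum>b\<in>D. card (I b)) = card D"
  proof -
    have "card (I b) = 1" if "b \<in> D" for b using that by (auto simp: D_def)
    then show ?thesis by simp
  qed
  moreover have "(\<Sum>b\<in>A - s ` X. card (I b)) = (\<Sum>b\<in>D. card (I b)) + (\<Sum>b\<in>A - s ` X - D. card (I b))"
  proof -
    have "D \<subseteq> A - s ` X" by (auto simp: D_def)
    then show ?thesis using sum.subset_diff[of D "A - s ` X" "\<lambda>b. card (I b)"] finA by simp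
  qed
  moreover have "(\<Sum>b\<in>A - s ` X. card (I b)) = (\<Sum>i<h. card (Z i - s ` X))"
  proof -
    have "(\<Sum>b\<in>A - s ` X. card (I b)) = (\<Sum>b\<in>A - s ` X. \<Sum>i<h. if b \<in> Z i then 1 else 0)"
      by (intro sum.cong refl) (simp add: I_def sum.If_cases Int_def)
    also have "\<dots> = (\<Sum>i<h. \<Sum>b\<in>A - s ` X. if b \<in> Z i then 1 else 0)" by (rule sum.swap)
    also have "\<dots> = (\<Sum>i<h. card (Z i - s ` X))"
    proof (rule sum.cong[OF refl])
      fix i assume i: "i \<in> {..<h}"
      have "{b \<in> A - s ` X. b \<in> Z i} = Z i - s ` X" using i by (auto simp: A_def)
      moreover have "(\<Sum>b\<in>A - s ` X. if b \<in> Z i then 1 else 0) = card {b \<in> A - s ` X. b \<in> Z i}"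
        using finA by (simp add: sum.If_cases Int_def)
      ultimately show "(\<Sum>b\<in>A - s ` X. if b \<in> Z i then 1 else 0) = card (Z i - s ` X)" by simp
    qed
    finally show ?thesis .
  qed
  moreover have "(\<Sum>x\<in>X. 2 * int (length (T x)) + int (reach x) + 2) = int (\<Sum>x\<in>X. 2 * length (T x) + reach x + 2)"
    by (simp add: algebra_simps)
  moreover have "(\<Sum>b\<in>A - s ` X - D. int (card (I b))) = int (\<Sum>b\<in>A - s ` X - D. card (I b))"
    by simp
  ultimately have "int (\<Sum>x\<in>X. 2 * length (T x) + reach x + 2) + int (\<Sum>i<h. card (Z i - s ` X)) \<le> int (length C)"
    using cf by linarith
  then show ?thesis by linarith
qed

text \<open>
  The slots \<open>x\<close> of the transversal with \<open>reach x < d\<close> are charged to the successors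
  \<open>Suc x mod h\<close>: a bare successor lacks neighbours off \<open>C\<close> except for the tails tapping it, and
  these taps are paid for by the tails themselves.
\<close>

lemma charging:
  assumes light: "\<And>j. j \<in> tailed \<Longrightarrow> dg j \<le> d" and d: "h < 2 * d"
    and X: "tailed \<subseteq> X" "X \<subseteq> {..<h}"
  shows "(\<Sum>x\<in>X. d) \<le> (\<Sum>x\<in>X. 2 * length (T x) + reach x) + (\<Sum>i<h. d - dg i)"
proof -
  let ?nx = "\<lambda>x. Suc x mod h"
  define P where "P = {x \<in> X. reach x < d}"
  define U where "U = ?nx ` P"
  define p where "p u = inv_into P ?nx u" for u
  define c where "c j = card {u \<in> U \<inter> bare. E (H ! u) (hd (T j))}" for j
  have finX: "finite X" using X(2) finite_subset by blast
  have finP: "finite P" using finX by (simp add: P_def)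
  have finU: "finite U" using finP by (simp add: U_def)
  have PX: "P \<subseteq> X" by (auto simp: P_def)
  have Ph: "x < h" if "x \<in> P" for x using that X(2) by (auto simp: P_def)
  have Uh: "u < h" if "u \<in> U" for u using that H_ne by (auto simp: U_def)
  have inj: "inj_on ?nx P"
  proof (rule inj_onI)
    fix x y assume xy: "x \<in> P" "y \<in> P" "?nx x = ?nx y"
    show "x = y" using last_index(1)[OF Ph[OF xy(1)] refl] last_index(1)[OF Ph[OF xy(2)] refl] xy(3) by metis
  qed
  have p: "p u \<in> P" "?nx (p u) = u" if "u \<in> U" for u
  proof -
    have 1: "u \<in> ?nx ` P" using that by (simp only: U_def)
    show "p u \<in> P" "?nx (p u) = u" using inv_into_into[OF 1] f_inv_into_f[OF 1] by (simp_all add: p_def)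
  qed
  have pn: "p (?nx x) = x" if "x \<in> P" for x unfolding p_def by (rule inv_into_f_f[OF inj that])
  have less: "reach (p u) < d" if "u \<in> U" for u using p(1)[OF that] by (simp add: P_def)
  have ph: "p u < h" if "u \<in> U" for u using Ph p(1)[OF that] by blast
  \<comment> \<open>The neighbours on \<open>H\<close> of the bare successor \<open>u\<close> count
    towards the reach of \<open>p u\<close>; its other neighbours off \<open>C\<close> are
    taps.\<close>
  have bare_cost: "d - reach (p u) \<le> (d - dg u) + card (taps u)" if u: "u \<in> U" "T u = []" for u
  proof -
    have "hdeg (H ! u) \<le> reach (p u)"
      using spread_next_degree[OF ph[OF u(1)] p(2)[OF u(1), symmetric]] reach(2)[OF ph[OF u(1)]] by blast
    moreover have "dg u \<le> hdeg (H ! u) + card (taps u)" using bare_degree[of u] u Uh by simp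
    ultimately show ?thesis by linarith
  qed
  have tap_cost: "dg j + hdeg (hd (T j)) \<le> d"
    if u: "u \<in> U" "T u = []" and j: "j \<in> tailed" "E (H ! u) (hd (T j))" "length (T j) < dg j" for u j
  proof -
    have jj: "j < h" "T j \<noteq> []" using j(1) by auto
    have "dg j + hdeg (hd (T j)) - 1 \<le> reach (p u)"
      using spread_next_shared_tail[OF ph[OF u(1)] p(2)[OF u(1), symmetric] u(2) jj j(2) tip_nb[OF jj] j(3)]
        reach(2)[OF ph[OF u(1)]] by blast
    then show ?thesis using less[OF u(1)] by linarith
  qed
  \<comment> \<open>A tail pays for the taps on it and, if its slot is a successor in
    \<open>U\<close>, for the slot before. If its tip has more than \<open>length (T j)\<close>
    neighbours, the reach enlarged by the detours makes \<open>d - dg j\<close> suffice; otherwise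
    the credit \<open>2 * length (T j)\<close> comes in.\<close>
  have tail_cost: "c j + (if j \<in> U then d - reach (p j) else 0) \<le> 2 * length (T j) + (d - dg j)"
    if j: "j \<in> tailed" for j
  proof -
    have jj: "j < h" "T j \<noteq> []" using j by auto
    have c: "c j + 1 \<le> hdeg (hd (T j))" unfolding c_def by (rule tapped_count[OF _ j]) auto
    have l: "0 < length (T j)" using jj(2) by simp
    note td = tailed_degree(1)[OF j] and lj = light[OF j]
    show ?thesis
    proof (cases "length (T j) < dg j")
      case True
      show ?thesis
      proof (cases "j \<in> U")
        case U: True
        have "dg j + hdeg (hd (T j)) - 1 \<le> reach (p j)"
          using spread_next_tail[OF ph[OF U] p(2)[OF U, symmetric] jj(2) tip_nb[OF jj] True] reach(2)[OF ph[OF U]] by blast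
        then show ?thesis using c less[OF U] U by simp
      next
        case False
        show ?thesis
        proof (cases "c j = 0")
          case True
          then show ?thesis using False by simp
        next
          case c0: False
          then have "{u \<in> U \<inter> bare. E (H ! u) (hd (T j))} \<noteq> {}" unfolding c_def by (metis card.empty)
          then obtain u where "u \<in> U" "T u = []" "E (H ! u) (hd (T j))" by blast
          then have "dg j + hdeg (hd (T j)) \<le> d" using tap_cost[of u j] j True by blast
          then show ?thesis using c False by simp
        qed
      qed
    next
      case False
      have r: "h \<le> 2 * reach (p j)" if "j \<in> U"
      proof -
        have "(h + 1) div 2 \<le> reach (p j)" using reach(2)[OF ph[OF that]] spread_half[OF ph[OF that]] by blast
        then show ?thesis by linarith
      qed
      show ?thesis using False c td lj d r l by (cases "j \<in> U") auto
    qed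
  qed
  have UN: "U = (U \<inter> bare) \<union> (U \<inter> tailed)" using Uh by auto
  have "(\<Sum>x\<in>P. d - reach x) = (\<Sum>u\<in>U. d - reach (p u))"
    unfolding U_def using inj pn by (simp add: sum.reindex)
  also have "\<dots> = (\<Sum>u\<in>U \<inter> bare. d - reach (p u)) + (\<Sum>u\<in>U \<inter> tailed. d - reach (p u))"
    by (subst UN, rule sum.union_disjoint) (auto simp: finU)
  also have "(\<Sum>u\<in>U \<inter> bare. d - reach (p u)) \<le> (\<Sum>u\<in>U \<inter> bare. (d - dg u) + card (taps u))"
    by (rule sum_mono) (use bare_cost in auto)
  also have "\<dots> = (\<Sum>u\<in>U \<inter> bare. d - dg u) + (\<Sum>u\<in>U \<inter> bare. card (taps u))" by (rule sum.distrib)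
  also have "(\<Sum>u\<in>U \<inter> bare. d - dg u) \<le> (\<Sum>u\<in>bare. d - dg u)" by (rule sum_mono2) auto
  also have "(\<Sum>u\<in>U \<inter> bare. card (taps u)) = (\<Sum>j\<in>tailed. c j)"
    unfolding c_def by (rule taps_double_count) auto
  also have "(\<Sum>u\<in>U \<inter> tailed. d - reach (p u)) = (\<Sum>j\<in>tailed. if j \<in> U then d - reach (p j) else 0)"
    by (subst sum.inter_filter[symmetric]) (auto intro: sum.cong)
  finally have "(\<Sum>x\<in>P. d - reach x) \<le> (\<Sum>u\<in>bare. d - dg u)
      + ((\<Sum>j\<in>tailed. c j) + (\<Sum>j\<in>tailed. if j \<in> U then d - reach (p j) else 0))" by simp
  also have "(\<Sum>j\<in>tailed. c j) + (\<Sum>j\<in>tailed. if j \<in> U then d - reach (p j) else 0)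
      = (\<Sum>j\<in>tailed. c j + (if j \<in> U then d - reach (p j) else 0))"
    by (rule sum.distrib[symmetric])
  also have "\<dots> \<le> (\<Sum>j\<in>tailed. 2 * length (T j) + (d - dg j))" by (rule sum_mono) (rule tail_cost)
  also have "\<dots> = (\<Sum>j\<in>tailed. 2 * length (T j)) + (\<Sum>j\<in>tailed. d - dg j)" by (rule sum.distrib)
  finally have 1: "(\<Sum>x\<in>P. d - reach x) \<le> (\<Sum>u\<in>bare. d - dg u) + (\<Sum>j\<in>tailed. d - dg j) + (\<Sum>j\<in>tailed. 2 * length (T j))"
    by simp
  have "(\<Sum>i<h. d - dg i) = (\<Sum>i\<in>bare \<union> tailed. d - dg i)" by (rule sum.cong) auto
  also have "\<dots> = (\<Sum>u\<in>bare. d - dg u) + (\<Sum>j\<in>tailed. d - dg j)" by (rule sum.union_disjoint) auto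
  finally have 2: "(\<Sum>i<h. d - dg i) = (\<Sum>u\<in>bare. d - dg u) + (\<Sum>j\<in>tailed. d - dg j)" .
  have 3: "(\<Sum>j\<in>tailed. 2 * length (T j)) \<le> (\<Sum>x\<in>X. 2 * length (T x))" by (rule sum_mono2) (use finX X in auto)
  have "(\<Sum>x\<in>X. d) \<le> (\<Sum>x\<in>X. reach x + (d - reach x))" by (rule sum_mono) simp
  also have "\<dots> = (\<Sum>x\<in>X. reach x) + (\<Sum>x\<in>X. d - reach x)" by (rule sum.distrib)
  also have "(\<Sum>x\<in>X. d - reach x) = (\<Sum>x\<in>P. d - reach x)"
    by (rule sum.mono_neutral_right) (use finX in \<open>auto simp: P_def\<close>)
  finally have 4: "(\<Sum>x\<in>X. d) \<le> (\<Sum>x\<in>X. reach x) + (\<Sum>x\<in>P. d - reach x)" .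
  have 5: "(\<Sum>x\<in>X. 2 * length (T x) + reach x) = (\<Sum>x\<in>X. 2 * length (T x)) + (\<Sum>x\<in>X. reach x)"
    by (rule sum.distrib)
  show ?thesis using 1 2 3 4 5 by linarith
qed

text \<open>A tailed slot pays for itself: \<open>dg x\<close> is at most
  \<open>length (T x)\<close>, or at most \<open>h / 2\<close> and thus at most the reach.\<close>

lemma tailed_charging:
  assumes X: "X \<subseteq> tailed"
  shows "(\<Sum>x\<in>X. d) \<le> (\<Sum>x\<in>X. 2 * length (T x) + reach x) + (\<Sum>i<h. d - dg i)"
proof -
  have "(\<Sum>x\<in>X. d) \<le> (\<Sum>x\<in>X. (2 * length (T x) + reach x) + (d - dg x))"
  proof (rule sum_mono)
    fix x assume "x \<in> X"
    then have x: "x \<in> tailed" using X by blast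
    then have xh: "x < h" by simp
    have "(h + 1) div 2 \<le> reach x" using reach(2)[OF xh] spread_half[OF xh] by blast
    then have "h \<le> 2 * reach x" by linarith
    then show "d \<le> (2 * length (T x) + reach x) + (d - dg x)"
      using tailed_degree(2)[OF x] by (cases "length (T x) < dg x") auto
  qed
  also have "\<dots> = (\<Sum>x\<in>X. 2 * length (T x) + reach x) + (\<Sum>x\<in>X. d - dg x)" by (rule sum.distrib)
  also have "(\<Sum>x\<in>X. d - dg x) \<le> (\<Sum>i<h. d - dg i)" by (rule sum_mono2) (use X in auto)
  finally show ?thesis by simp
qed

text \<open>Tips with at most \<open>\<delta> - k\<close> neighbours off \<open>C\<close> have at
  least \<open>k\<close> on \<open>C\<close>, enough for a greedy choice; bare slots are represented
  by ends of the fan. After removal of the \<open>k\<close> representatives slot \<open>i\<close>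
  keeps at least \<open>\<delta> - k - dg i\<close> attachments, the very terms of the
  charging.\<close>

lemma light_tails_bound:
  assumes light: "\<And>j. j \<in> tailed \<Longrightarrow> dg j \<le> \<delta> - k" and k: "2 \<le> k" "k \<le> \<delta>" and d: "h < 2 * (\<delta> - k)"
    and deg: "\<And>v. v \<in> V \<Longrightarrow> \<delta> \<le> card (nbrs E V v)"
    and X0: "X0 \<subseteq> {..<h}" "card X0 = k" "inj_on a X0" "\<And>i. i \<in> X0 \<Longrightarrow> T i = [] \<Longrightarrow> a i \<in> cycle.att (H ! i)"
  shows "k * (\<delta> - k + 2) \<le> length C"
proof -
  have Zdeg: "\<delta> \<le> dg i + card (Z i)" if "i < h" for i
    using deg[of "tip i"] cycle.degree_split[of "tip i"] tip_K[OF that] by simp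
  have Zk: "k \<le> card (Z j)" if "j \<in> tailed" for j
    using Zdeg[of j] light[OF that] that k(2) by simp
  \<comment> \<open>With at least \<open>k\<close> tailed slots \<open>X\<close> consists of such
    slots only; otherwise it contains all of them and is filled up from the fan. Each alternative
    has its own charging lemma.\<close>
  obtain X s where X: "X \<subseteq> {..<h}" "card X = k" "inj_on s X" "\<And>x. x \<in> X \<Longrightarrow> s x \<in> Z x"
      "X \<subseteq> tailed \<or> tailed \<subseteq> X"
  proof (cases "k \<le> card tailed")
    case True
    then obtain X where X: "X \<subseteq> tailed" "card X = k" "finite X"
      using obtain_subset_with_card_n[OF True] by blast
    have "\<exists>s. inj_on s X \<and> (\<forall>j\<in>X. s j \<in> Z j - {})"
    proof (rule greedy_transversal)
      show "finite (Z j) \<and> card {} + card X \<le> card (Z j)" if "j \<in> X" for j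
        using Zk[of j] that X by auto
    qed (use X in auto)
    then obtain s where "inj_on s X" "\<forall>j\<in>X. s j \<in> Z j" by auto
    then show ?thesis using that[of X s] X by auto
  next
    case False
    have finX0: "finite X0" using X0(1) finite_subset by blast
    have ck: "k - card tailed \<le> card (X0 - tailed)"
      using diff_card_le_card_Diff[of tailed X0] X0(2) by simp
    then obtain Y where Y: "Y \<subseteq> X0 - tailed" "card Y = k - card tailed" "finite Y"
      using obtain_subset_with_card_n[OF ck] by blast
    have "\<exists>s. inj_on s tailed \<and> (\<forall>j\<in>tailed. s j \<in> Z j - a ` Y)"
    proof (rule greedy_transversal)
      show "finite (Z j) \<and> card (a ` Y) + card tailed \<le> card (Z j)" if "j \<in> tailed" for j
        using Zk[OF that] card_image_le[OF Y(3), of a] Y(2) False by simp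
    qed (use Y in auto)
    then obtain s where s: "inj_on s tailed" "\<And>j. j \<in> tailed \<Longrightarrow> s j \<in> Z j - a ` Y" by blast
    define s' where "s' x = (if x \<in> Y then a x else s x)" for x
    have dis: "Y \<inter> tailed = {}" using Y(1) by blast
    have Yb: "y < h \<and> T y = [] \<and> y \<in> X0" if "y \<in> Y" for y using that Y(1) X0(1) by auto
    show ?thesis
    proof (rule that[of "Y \<union> tailed" s'])
      show "Y \<union> tailed \<subseteq> {..<h}" using Yb by auto
      show "card (Y \<union> tailed) = k" using card_Un_disjoint[OF Y(3) _ dis] Y(2) False by simp
      show "inj_on s' (Y \<union> tailed)"
      proof (rule inj_onI)
        fix x y assume xy: "x \<in> Y \<union> tailed" "y \<in> Y \<union> tailed" "s' x = s' y"
        have aY: "inj_on a Y" using X0(3) Y(1) by (meson Diff_subset inj_on_subset subset_trans)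
        consider "x \<in> Y" "y \<in> Y" | "x \<in> Y" "y \<in> tailed" "y \<notin> Y" | "x \<in> tailed" "x \<notin> Y" "y \<in> Y"
          | "x \<in> tailed" "x \<notin> Y" "y \<in> tailed" "y \<notin> Y" using xy by blast
        then show "x = y"
        proof cases
          case 1
          then show ?thesis using xy(3) aY by (simp add: s'_def inj_on_def)
        next
          case 2
          then have "s y \<in> a ` Y" using xy(3) by (metis s'_def imageI)
          then show ?thesis using s(2)[OF 2(2)] by blast
        next
          case 3
          then have "s x \<in> a ` Y" using xy(3) by (metis s'_def imageI)
          then show ?thesis using s(2)[OF 3(1)] by blast
        next
          case 4
          then have "s x = s y" using xy(3) by (simp add: s'_def)
          then show ?thesis using inj_onD[OF s(1) _ 4(1,3)] by blast
        qed
      qed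
      show "s' x \<in> Z x" if "x \<in> Y \<union> tailed" for x
      proof (cases "x \<in> Y")
        case True
        then show ?thesis using X0(4)[of x] Yb[OF True] tip_bare[of x] by (simp add: s'_def)
      next
        case False
        then have "x \<in> tailed" using that by blast
        then show ?thesis using s(2)[of x] False by (simp add: s'_def)
      qed
      show "Y \<union> tailed \<subseteq> tailed \<or> tailed \<subseteq> Y \<union> tailed" by blast
    qed
  qed
  have finX: "finite X" using X(1) finite_subset by blast
  have "(\<Sum>x\<in>X. 2 * length (T x) + reach x + 2) + (\<Sum>i<h. card (Z i - s ` X)) \<le> length C"
    using X k(1) by (intro transversal_bound) auto
  moreover have "(\<Sum>x\<in>X. 2 * length (T x) + reach x + 2) = (\<Sum>x\<in>X. 2 * length (T x) + reach x) + (\<Sum>x\<in>X. 2)"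
    by (rule sum.distrib)
  moreover have "(\<Sum>x\<in>X. 2) = 2 * k" using X(2) by simp
  moreover have "(\<Sum>i<h. (\<delta> - k) - dg i) \<le> (\<Sum>i<h. card (Z i - s ` X))"
  proof (rule sum_mono)
    fix i assume "i \<in> {..<h}"
    then have "\<delta> \<le> dg i + card (Z i)" using Zdeg by simp
    moreover have "card (Z i) - card (s ` X) \<le> card (Z i - s ` X)"
      using finX by (intro diff_card_le_card_Diff) simp
    moreover have "card (s ` X) = k" using X(2,3) by (simp add: card_image)
    ultimately show "(\<delta> - k) - dg i \<le> card (Z i - s ` X)" by linarith
  qed
  moreover have "(\<Sum>x\<in>X. \<delta> - k) \<le> (\<Sum>x\<in>X. 2 * length (T x) + reach x) + (\<Sum>i<h. (\<delta> - k) - dg i)"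
    using X(5)
  proof
    assume "X \<subseteq> tailed"
    then show ?thesis by (rule tailed_charging)
  next
    assume "tailed \<subseteq> X"
    then show ?thesis using light d X(1) by (intro charging) auto
  qed
  moreover have "(\<Sum>x\<in>X. \<delta> - k) = k * (\<delta> - k)" using X(2) by simp
  moreover have "k * (\<delta> - k + 2) = k * (\<delta> - k) + 2 * k" by (simp add: algebra_simps)
  ultimately show ?thesis by linarith
qed

end

context cycle_in_graph
begin

lemma linked_outside_cycle_bound:
  assumes kc: "path_connected_after E V k" and k: "2 \<le> k" "k \<le> length H" "k \<le> \<delta>" "k \<le> \<delta> - k + 2"
    and HL: "longest E K H" and deg: "\<And>v. v \<in> V \<Longrightarrow> \<delta> \<le> card (nbrs E V v)"
  shows "k * (\<delta> - k + 2) \<le> n"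
proof (cases "2 * (\<delta> - k) \<le> length H")
  case True
  show ?thesis by (rule long_outside_cycle_bound[OF kc k(1,2) HL True])
next
  case False
  then have d: "length H < 2 * (\<delta> - k)" by simp
  obtain T X0 a where T: "optimal_tails E K H T" "X0 \<subseteq> {..<length H}" "card X0 = k" "inj_on a X0"
      "\<And>i. i \<in> X0 \<Longrightarrow> T i = [] \<Longrightarrow> a i \<in> att (H ! i)"
    by (rule fan_tails[OF kc k(1,2) HL]) blast
  interpret optimal_tails E K H T by (rule T(1))
  interpret L: tails_off_cycle V E C H T by unfold_locales
  show ?thesis
  proof (cases "\<exists>j\<in>tailed. \<delta> - k < card (nb (tip j))")
    case True
    then obtain j where "j < h" "T j \<noteq> []" "\<delta> - k < card (nb (tip j))" by blast
    then show ?thesis using L.heavy_tail_bound[OF kc k(1,2,4)] d by blast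
  next
    case False
    show ?thesis
    proof (rule L.light_tails_bound[OF _ k(1,3) d deg T(2-4)])
      show "card (nb (tip j)) \<le> \<delta> - k" if "j \<in> tailed" for j using False that by (meson not_le)
      show "a i \<in> att (H ! i)" if "i \<in> X0" "T i = []" for i using T(5)[OF that] .
    qed
  qed
qed

end

section \<open>Consequences of connectivity and minimum degree, and the final bound\<close>

lemma path_connected_after_mono:
  "path_connected_after E V k \<Longrightarrow> j \<le> k \<Longrightarrow> path_connected_after E V j"
  by (auto simp: path_connected_after_def)

text \<open>Deleting fewer than \<open>k\<close> neighbours would cut \<open>v\<close> off from a
  remaining vertex.\<close>

lemma path_connected_after_degree:
  assumes kc: "path_connected_after E V k" and fin: "finite V" and irr: "\<And>v. \<not> E v v"
    and kV: "k < card V" and v: "v \<in> V"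
  shows "k \<le> card (nbrs E V v)"
proof (rule ccontr)
  assume c: "\<not> k \<le> card (nbrs E V v)"
  let ?X = "nbrs E V v"
  have X: "?X \<subseteq> V" "v \<notin> ?X" using irr by (auto simp: nbrs_def)
  have finX: "finite ?X" using X(1) fin finite_subset by blast
  have "card (insert v ?X) < card V" using c kV finX X(2) by simp
  then have "\<not> V \<subseteq> insert v ?X" using card_mono[of "insert v ?X" V] finX by auto
  then obtain w where w: "w \<in> V" "w \<noteq> v" "w \<notin> ?X" by blast
  have "card ?X < k" using c by simp
  then obtain p where p: "gpath E (V - ?X) p" "hd p = v" "last p = w"
    using kc X v w unfolding path_connected_after_def by blast
  obtain q where pq: "p = v # q" using p(1,2) gpath_nonempty by (metis list.collapse)
  have "q \<noteq> []" using pq p(3) w(2) by auto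
  then have "E v (hd q)" "gpath E (V - ?X) q" using p(1) pq by (simp_all add: gpath_Cons)
  then have "hd q \<in> V - ?X" using \<open>q \<noteq> []\<close> gpath_subset hd_in_set by blast
  then show False using \<open>E v (hd q)\<close> by (auto simp: nbrs_def)
qed

text \<open>The start of a longest path has all its neighbours on the path; the edge to the last of
  them closes the cycle.\<close>

lemma long_cycle_of_degree:
  assumes sym: "symp E" and fin: "finite V" and irr: "\<And>v. \<not> E v v" and ne: "V \<noteq> {}" and d: "1 \<le> \<delta>"
    and deg: "\<And>v. v \<in> V \<Longrightarrow> \<delta> \<le> card (nbrs E V v)"
  obtains D where "gcycle E V D" "\<delta> + 1 \<le> length D"
proof -
  have bd: "length p \<le> card V" if "gpath E V p" for p
    using card_mono[OF fin gpath_subset[OF that]] distinct_card[OF gpath_distinct[OF that]] by simp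
  obtain x where "x \<in> V" using ne by blast
  then have "gpath E V [x]" by simp
  then have "\<exists>p. gpath E V p \<and> (\<forall>q. gpath E V q \<longrightarrow> length q \<le> length p)"
    using ex_has_greatest_nat[of "gpath E V" "[x]" length "Suc (card V)"] bd by (auto simp: less_Suc_eq_le)
  then obtain p where p: "gpath E V p" "\<And>q. gpath E V q \<Longrightarrow> length q \<le> length p" by blast
  have pne: "p \<noteq> []" using p(1) by (rule gpath_nonempty)
  have sub: "nbrs E V (hd p) \<subseteq> set p"
  proof
    fix w assume w: "w \<in> nbrs E V (hd p)"
    show "w \<in> set p"
    proof (rule ccontr)
      assume "w \<notin> set p"
      then have "gpath E V (w # p)" using w p(1) pne sym by (auto simp: gpath_Cons nbrs_def symp_def)
      then show False using p(2)[of "w # p"] by simp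
    qed
  qed
  define J where "J = {i. i < length p \<and> E (hd p) (p ! i)}"
  have finJ: "finite J" by (simp add: J_def)
  have "nbrs E V (hd p) \<subseteq> (!) p ` J"
  proof
    fix w assume w: "w \<in> nbrs E V (hd p)"
    then obtain i where "i < length p" "p ! i = w" using sub by (metis in_set_conv_nth subsetD)
    then show "w \<in> (!) p ` J" using w by (auto simp: J_def nbrs_def)
  qed
  then have "card (nbrs E V (hd p)) \<le> card J" using finJ by (meson card_image_le card_mono finite_imageI le_trans)
  moreover have "hd p \<in> V" using p(1) pne gpath_subset hd_in_set by blast
  ultimately have cJ: "\<delta> \<le> card J" using deg by (meson le_trans)
  then have Jne: "J \<noteq> {}" using d by auto
  define i where "i = Max J"
  have i: "i < length p" "E (hd p) (p ! i)" using Max_in[OF finJ Jne] by (auto simp: i_def J_def)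
  have "0 \<notin> J" using irr pne by (simp add: J_def hd_conv_nth)
  then have "J \<subseteq> {1..i}" using finJ by (auto simp: i_def Suc_le_eq intro: gr0I)
  then have "card J \<le> i" using card_mono[of "{1..i}" J] by simp
  have g: "gpath E V (take (Suc i) p)" using p(1) by (rule gpath_takeI) simp
  have "last (take (Suc i) p) = p ! i" "hd (take (Suc i) p) = hd p"
    using i(1) pne by (simp add: take_Suc_conv_app_nth, cases p, auto)
  then have "gcycle E V (take (Suc i) p)" using g i(2) sym by (simp add: gcycle_def symp_def)
  then show ?thesis using that[of "take (Suc i) p"] i(1) \<open>card J \<le> i\<close> cJ by simp
qed

context cycle_in_graph
begin

text \<open>
  Replacing \<open>k\<close> by \<open>\<delta> - k + 2\<close> does not change the bound, so \<open>2 * k \<le> \<delta> + 2\<close> may be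
  assumed.
\<close>

theorem longest_cycle_bound:
  assumes kc: "path_connected_after E V k" and k: "1 \<le> k" "k < card V" "k \<le> \<delta>"
    and deg: "\<And>v. v \<in> V \<Longrightarrow> \<delta> \<le> card (nbrs E V v)"
    and c: "min (int k - 1) (int \<delta> - int k + 1) \<le> int c"
    and out: "c = 0 \<or> (\<exists>H. longest E K H \<and> length H = c)"
  shows "int k * (int \<delta> - int k + 2) \<le> int n"
proof -
  define l where "l = min k (\<delta> - k + 2)"
  have l: "1 \<le> l" "l \<le> k" "l \<le> \<delta>" "l \<le> \<delta> - l + 2" using k by (auto simp: l_def)
  \<comment> \<open>The terms of \<open>min\<close> are \<open>k - 1\<close> and
    \<open>(\<delta> - k + 2) - 1\<close>, so the hypothesis says
    \<open>l - 1 \<le> c\<close>.\<close>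
  have lc: "l \<le> c + 1" using c k by (auto simp: l_def)
  have same: "int k * (int \<delta> - int k + 2) = int (l * (\<delta> - l + 2))"
  proof (cases "k \<le> \<delta> - k + 2")
    case True
    then have "l = k" by (simp add: l_def)
    moreover have "int (\<delta> - k + 2) = int \<delta> - int k + 2" using k by simp
    ultimately show ?thesis by (metis of_nat_mult)
  next
    case False
    then have "l = \<delta> - k + 2" "\<delta> - l + 2 = k" using k by (auto simp: l_def)
    moreover have "int (\<delta> - k + 2) = int \<delta> - int k + 2" using k by simp
    ultimately show ?thesis by (metis of_nat_mult mult.commute)
  qed
  have "l * (\<delta> - l + 2) \<le> n"
  proof (cases "l = 1")
    case True
    \<comment> \<open>For \<open>l = 1\<close> there may be no cycle off \<open>C\<close> at all;
      the bound \<open>\<delta> + 1\<close> comes from the minimum degree alone.\<close>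
    have "V \<noteq> {}" using k(2) by auto
    then obtain D where "gcycle E V D" "\<delta> + 1 \<le> length D"
      using long_cycle_of_degree[OF sym finV irr, of \<delta>] k deg by auto
    then have "\<delta> + 1 \<le> n" using C unfolding longest_def by fastforce
    then show ?thesis using True k by simp
  next
    case False
    then have "c \<noteq> 0" using l lc by auto
    then obtain H where H: "longest E K H" "length H = c" using out by auto
    show ?thesis
    proof (cases "l \<le> c")
      case True
      show ?thesis
        using linked_outside_cycle_bound[OF path_connected_after_mono[OF kc l(2)] _ _ l(3,4) H(1) deg]
          False l(1) True H(2) by simp
    next
      case c: False
      then have lc': "l = length H + 1" using lc H(2) by simp
      then have "(length H + 1) * (\<delta> + 1 - length H) \<le> n"
        using longest_outside_cycle_bound[OF H(1) _ deg] l(3) by simp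
      moreover have "\<delta> + 1 - length H = \<delta> - l + 2" using lc' l(3) by simp
      ultimately show ?thesis using lc' by simp
    qed
  qed
  then show ?thesis by (simp only: same of_nat_le_iff)
qed

end

section \<open>Cycles in digraphs\<close>

abbreviation adjacent :: "('a, 'b) pre_digraph \<Rightarrow> 'a \<Rightarrow> 'a \<Rightarrow> bool" where
  "adjacent G u v \<equiv> (u, v) \<in> arcs_ends G"

context wf_digraph
begin

lemma successively_awalk_verts:
  assumes "awalk u p v"
  shows "successively (adjacent G) (awalk_verts u p)"
  using assms
proof (induction p arbitrary: u)
  case (Cons e p)
  then have e: "e \<in> arcs G" "tail G e = u" "awalk (head G e) p v" by (simp_all add: awalk_Cons_iff)
  then have "awalk_verts (head G e) p \<noteq> []" "hd (awalk_verts (head G e) p) = head G e" by auto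
  moreover have "adjacent G u (head G e)" using e in_arcs_imp_in_arcs_ends by blast
  ultimately show ?case using Cons.IH[OF e(3)] e(2) by (simp add: successively_Cons)
qed simp

lemma awalk_of_successively:
  assumes "vs \<noteq> []" "successively (adjacent G) vs" "set vs \<subseteq> verts G"
  shows "\<exists>p. awalk (hd vs) p (last vs) \<and> awalk_verts (hd vs) p = vs"
  using assms
proof (induction vs)
  case (Cons x vs)
  show ?case
  proof (cases "vs = []")
    case True
    then show ?thesis using Cons.prems by (intro exI[of _ "[]"]) (simp add: awalk_Nil_iff)
  next
    case False
    then have s: "adjacent G x (hd vs)" "successively (adjacent G) vs" using Cons.prems by (simp_all add: successively_Cons)
    obtain p where p: "awalk (hd vs) p (last vs)" "awalk_verts (hd vs) p = vs"
      using Cons.IH[OF False s(2)] Cons.prems by auto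
    obtain e where e: "e \<in> arcs G" "tail G e = x" "head G e = hd vs" using s(1) by auto
    have "awalk x (e # p) (last vs)" using p(1) e by (simp add: awalk_Cons_iff)
    moreover have "awalk_verts x (e # p) = x # vs" using p(2) e by simp
    ultimately show ?thesis using False by (intro exI[of _ "e # p"]) simp
  qed
qed simp

text \<open>The vertex list of a closed walk contains its base at both ends; dropping the first
  entry leaves every vertex once.\<close>

lemma gcycle_of_graph_cycle:
  assumes "graph_cycle G u p"
  obtains D where "gcycle (adjacent G) (verts G) D" "length D = cycle_length p"
    "set D = set (awalk_verts u p)"
proof (cases "p = []")
  case True
  then have "u \<in> verts G" using assms by (simp add: graph_cycle_def awalk_Nil_iff)
  then show ?thesis using that[of "[u]"] True by (simp add: gcycle_def cycle_length_def)
next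
  case False
  then have aw: "awalk u p u" and cyc: "cycle p" using assms by (auto simp: graph_cycle_def)
  \<comment> \<open>The vertex list of a nonempty arc list does not depend on the base, so
    \<open>u'\<close> can be exchanged for \<open>u\<close>.\<close>
  obtain u' where u': "distinct (tl (awalk_verts u' p))" using cyc by (auto simp: cycle_def)
  define D where "D = tl (awalk_verts u p)"
  have hdl: "awhd u p = u" "awlast u p = u" using aw by auto
  have vs: "awalk_verts u p = u # D" using hdl(1) unfolding D_def by (metis awalk_verts_non_Nil list.collapse)
  have len: "length D = length p" using length_awalk_verts[of u p] vs by simp
  then have Dne: "D \<noteq> []" using False by auto
  have dD: "distinct D" using u' awalk_verts_ne_eq[OF False, of u u'] by (simp add: D_def)
  have s: "successively (adjacent G) (u # D)" using successively_awalk_verts[OF aw] vs by simp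
  have l: "last D = u" using hdl(2) vs Dne by simp
  have "set (u # D) \<subseteq> verts G" using aw vs by (metis awalk_conv)
  then have "gcycle (adjacent G) (verts G) D"
    using s Dne dD l by (auto simp: gcycle_def gpath_def successively_Cons)
  moreover have "set D = set (awalk_verts u p)" using vs l Dne by (metis insert_absorb last_in_set list.simps(15))
  ultimately show ?thesis using that len False by (simp add: cycle_length_def)
qed

text \<open>Putting \<open>last D\<close> in front turns the closing edge into the first arc. For
  two vertices this is the walk along an edge and back.\<close>

lemma graph_cycle_of_gcycle:
  assumes "gcycle (adjacent G) (verts G) D"
  obtains u p where "graph_cycle G u p" "cycle_length p = length D"
proof (cases "length D = 1")
  case True
  then obtain x where "D = [x]" by (auto simp: length_Suc_conv)
  then have "x \<in> verts G" using assms by (simp add: gcycle_def)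
  then have "graph_cycle G x []" by (simp add: graph_cycle_def awalk_Nil_iff)
  then show ?thesis using that[of x "[]"] True by (simp add: cycle_length_def)
next
  case False
  then have D: "gpath (adjacent G) (verts G) D" "adjacent G (last D) (hd D)" using assms by (auto simp: gcycle_def)
  have Dne: "D \<noteq> []" using D(1) by (rule gpath_nonempty)
  have "successively (adjacent G) (last D # D)" using D Dne by (simp add: gpath_def successively_Cons)
  moreover have "set (last D # D) \<subseteq> verts G" using D(1) Dne by (auto simp: gpath_def)
  ultimately obtain p where p: "awalk (last D) p (last D)" "awalk_verts (last D) p = last D # D"
    using awalk_of_successively[of "last D # D"] Dne by auto
  have len: "length p = length D" using length_awalk_verts[of "last D" p] p(2) by simp
  then have pne: "p \<noteq> []" using Dne by auto
  have "distinct (tl (awalk_verts (last D) p))" using p(2) D(1) by (simp add: gpath_def)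
  then have "cycle p" using p(1) pne by (auto simp: cycle_def)
  then show ?thesis using that[of "last D" p] p(1) len pne by (simp add: graph_cycle_def cycle_length_def)
qed

lemma gpath_induce: "gpath (adjacent (G \<restriction> S)) S p \<longleftrightarrow> gpath (adjacent G) S p"
proof -
  have "adjacent (G \<restriction> S) u v \<longleftrightarrow> adjacent G u v" if "u \<in> S" "v \<in> S" for u v
    using that by (auto simp: arcs_ends_def arc_to_ends_def)
  then have "successively (adjacent (G \<restriction> S)) p \<longleftrightarrow> successively (adjacent G) p" if "set p \<subseteq> S"
    using that by (intro successively_cong) auto
  then show ?thesis by (auto simp: gpath_def)
qed

lemma gcycle_induce: "gcycle (adjacent (G \<restriction> S)) S p \<longleftrightarrow> gcycle (adjacent G) S p"
proof -
  have "adjacent (G \<restriction> S) (last p) (hd p) \<longleftrightarrow> adjacent G (last p) (hd p)" if "gpath (adjacent G) S p"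
  proof -
    have "last p \<in> S" "hd p \<in> S" using that by (auto simp: gpath_def)
    then show ?thesis by (auto simp: arcs_ends_def arc_to_ends_def)
  qed
  then show ?thesis by (auto simp: gcycle_def gpath_induce)
qed

lemma longest_of_longest_cycle:
  assumes "longest_cycle G u p"
  obtains D where "longest (adjacent G) (verts G) D" "length D = cycle_length p"
    "set D = set (awalk_verts u p)"
proof -
  have gc: "graph_cycle G u p" using assms by (simp add: longest_cycle_def)
  obtain D where D: "gcycle (adjacent G) (verts G) D" "length D = cycle_length p"
    "set D = set (awalk_verts u p)" by (rule gcycle_of_graph_cycle[OF gc]) blast
  have "length D' \<le> length D" if D': "gcycle (adjacent G) (verts G) D'" for D'
  proof -
    obtain v q where vq: "graph_cycle G v q" "cycle_length q = length D'" by (rule graph_cycle_of_gcycle[OF D'])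
    have "cycle_length q \<le> cycle_length p" using assms vq(1) unfolding longest_cycle_def by blast
    then show ?thesis using vq(2) D(2) by simp
  qed
  then show ?thesis using that D by (simp add: longest_def)
qed

text \<open>Cycle lengths are bounded by the number of vertices and single vertices are cycles, so
  the \<open>Max\<close> is taken over a finite nonempty set.\<close>

lemma circumference_attained:
  assumes "finite (verts G)" "circumference G \<noteq> 0"
  shows "\<exists>D. longest (adjacent G) (verts G) D \<and> length D = circumference G"
proof -
  let ?L = "{cycle_length p | u p. graph_cycle G u p}"
  have ne: "verts G \<noteq> {}" using assms(2) by (auto simp: circumference_def)
  have circ: "circumference G = Max ?L" using ne by (simp add: circumference_def)
  have "?L \<subseteq> {..card (verts G)}"
  proof
    fix l assume "l \<in> ?L"
    then obtain u p where up: "graph_cycle G u p" "l = cycle_length p" by blast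
    obtain D where D: "gcycle (adjacent G) (verts G) D" "length D = cycle_length p"
      by (rule gcycle_of_graph_cycle[OF up(1)]) blast
    have g: "gpath (adjacent G) (verts G) D" using D(1) by (simp add: gcycle_def)
    have "length D \<le> card (verts G)"
      using card_mono[OF assms(1) gpath_subset[OF g]] distinct_card[OF gpath_distinct[OF g]] by simp
    then show "l \<in> {..card (verts G)}" using up(2) D(2) by simp
  qed
  then have fin: "finite ?L" using finite_subset by blast
  obtain x where "x \<in> verts G" using ne by blast
  then have "graph_cycle G x []" by (simp add: graph_cycle_def awalk_Nil_iff)
  then have "?L \<noteq> {}" by blast
  then have "Max ?L \<in> ?L" using fin by (rule Max_in[rotated])
  then obtain u p where up: "graph_cycle G u p" "Max ?L = cycle_length p" by blast
  obtain D where D: "gcycle (adjacent G) (verts G) D" "length D = cycle_length p"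
    by (rule gcycle_of_graph_cycle[OF up(1)]) blast
  have "length D' \<le> length D" if D': "gcycle (adjacent G) (verts G) D'" for D'
  proof -
    obtain v q where vq: "graph_cycle G v q" "cycle_length q = length D'" by (rule graph_cycle_of_gcycle[OF D'])
    then have "length D' \<in> ?L" by (metis (mono_tags, lifting) mem_Collect_eq)
    then have "length D' \<le> Max ?L" using fin by (rule Max_ge[rotated])
    then show ?thesis using D(2) up(2) by simp
  qed
  then show ?thesis using D up(2) circ by (intro exI[of _ D]) (simp add: longest_def)
qed

text \<open>\<open>connected\<close> refers to reachability in the symmetric closure, which for a
  symmetric graph is reachability in the graph itself; an \<open>apath\<close> then has distinct
  vertices.\<close>

lemma path_connected_after_of_vertex_connected:
  assumes sym: "symmetric G" and vc: "vertex_connected k G"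
  shows "path_connected_after (adjacent G) (verts G) k"
  unfolding path_connected_after_def
proof (intro allI impI ballI)
  fix X u v assume X: "X \<subseteq> verts G" "card X < k" and uv: "u \<in> verts G - X" "v \<in> verts G - X"
  let ?S = "verts G - X"
  interpret S: wf_digraph "G \<restriction> ?S" by (rule wellformed_induce_subgraph)
  have symS: "symmetric (G \<restriction> ?S)"
    by (rule induced_graph_imp_symmetric[OF sym induced_induce]) blast
  have "connected (G \<restriction> ?S)" using vc X by (simp add: vertex_connected_def)
  then have "u \<rightarrow>\<^sup>*\<^bsub>with_proj (mk_symmetric (G \<restriction> ?S))\<^esub> v"
    using uv by (auto simp: connected_def strongly_connected_def)
  then have "u \<rightarrow>\<^sup>*\<^bsub>G \<restriction> ?S\<^esub> v" using S.reachable_mk_symmetric_eq[OF symS] by simp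
  then obtain p where p: "S.apath u p v" using S.reachable_apath by blast
  then have aw: "S.awalk u p v" and dis: "distinct (S.awalk_verts u p)" by (auto simp: S.apath_def)
  have "set (S.awalk_verts u p) \<subseteq> ?S" using aw by (metis S.awalk_conv induce_subgraph_verts)
  then have "gpath (adjacent (G \<restriction> ?S)) ?S (S.awalk_verts u p)"
    using S.successively_awalk_verts[OF aw] dis by (simp add: gpath_def)
  then have "gpath (adjacent G) ?S (S.awalk_verts u p)" by (simp only: gpath_induce)
  moreover have "S.awhd u p = u" "S.awlast u p = v" using aw by auto
  ultimately show "\<exists>p. gpath (adjacent G) ?S p \<and> hd p = u \<and> last p = v" by blast
qed

end

lemma (in nomulti_digraph) out_degree_eq_card_nbrs:
  "out_degree G v = card (nbrs (adjacent G) (verts G) v)"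
proof -
  have "nbrs (adjacent G) (verts G) v = head G ` out_arcs G v"
    by (auto simp: nbrs_def arcs_ends_def arc_to_ends_def image_iff)
  moreover have "inj_on (head G) (out_arcs G v)"
    by (rule inj_onI) (auto simp: arc_to_ends_def intro: no_multi_arcs)
  ultimately show ?thesis by (simp add: out_degree_def card_image)
qed

theorem theorem4:
  fixes G :: "('a, 'b) pre_digraph" and k \<delta> :: nat and u :: 'a and C :: "'b awalk"
  assumes "graph G"
    and "1 \<le> k"
    and "vertex_connected k G"
    and "\<delta> = min_degree G"
    and "longest_cycle G u C"
    and "min (int k - 1) (int \<delta> - int k + 1) \<le> int (circumference (delete_cycle G u C))"
  shows "int k * (int \<delta> - int k + 2) \<le> int (cycle_length C)"
proof -
  interpret graph G by (rule assms(1))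
  let ?E = "adjacent G" and ?V = "verts G"
  have symE: "symp ?E" using sym_arcs by (auto simp: symmetric_def symp_def sym_def)
  have irr: "\<not> ?E v v" for v using adj_not_same by blast
  have EV: "a \<in> ?V \<and> b \<in> ?V" if "?E a b" for a b using that by auto
  have kV: "k < card ?V" using assms(3) by (simp add: vertex_connected_def)
  have kc: "path_connected_after ?E ?V k"
    using sym_arcs assms(3) by (rule path_connected_after_of_vertex_connected)
  have Vne: "?V \<noteq> {}" using kV by auto
  have deg: "\<delta> \<le> card (nbrs ?E ?V v)" if "v \<in> ?V" for v
    using that finite_verts assms(4) by (auto simp: min_degree_def out_degree_eq_card_nbrs[symmetric])
  obtain v where v: "v \<in> ?V" "card (nbrs ?E ?V v) = \<delta>"
  proof -
    have "\<delta> \<in> out_degree G ` ?V" unfolding assms(4) min_degree_def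
      using Vne finite_verts by (intro Min_in) auto
    then show ?thesis using that out_degree_eq_card_nbrs by auto
  qed
  \<comment> \<open>This makes the differences of natural numbers in the combinatorial bound agree
    with the integer ones of the statement.\<close>
  have k\<delta>: "k \<le> \<delta>" using path_connected_after_degree[OF kc finite_verts irr kV v(1)] v(2) by simp
  obtain D where D: "longest ?E ?V D" "length D = cycle_length C" "set D = set (awalk_verts u C)"
    by (rule longest_of_longest_cycle[OF assms(5)]) blast
  interpret D: cycle_in_graph ?V ?E D
    using finite_verts symE irr EV D(1) by unfold_locales auto
  let ?S = "?V - set D"
  interpret S: wf_digraph "G \<restriction> ?S" by (rule wellformed_induce_subgraph)
  have del: "delete_cycle G u C = G \<restriction> ?S" by (simp add: delete_cycle_def D(3))
  \<comment> \<open>If the long cycle covers all vertices, the circumference is 0 by definition and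
    no \<open>H\<close> exists; \<open>longest_cycle_bound\<close> admits this case.\<close>
  have "\<exists>H. longest ?E ?S H \<and> length H = circumference (G \<restriction> ?S)" if "circumference (G \<restriction> ?S) \<noteq> 0"
    using S.circumference_attained that finite_verts by (simp add: longest_def gcycle_induce)
  then have "int k * (int \<delta> - int k + 2) \<le> int (length D)"
    using assms(2,6) kV k\<delta> deg del by (intro D.longest_cycle_bound[OF kc]) auto
  then show ?thesis using D(2) by simp
qed

end
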